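(* Let $p\in(1,\infty]$ and let $q\in[1,\infty]$ satisfy $q>p^*$. Fix $l\in\mathbb{N}$. Then the pseudo metric space $\big(B(L^p([0,1]^l)),\,d_{R^q_l}/S_{[0,1]}\big)$ is compact.
   Context: $[0,1]^l$ carries Lebesgue measure $\lambda$; $B(L^s(\Omega))$ is the closed unit ball of $L^s(\Omega)$. For $p\in[1,\infty]$, $p^*=p/(p-1)$ if $1<p<\infty$, $p^*=1$ if $p=\infty$, $p^*=\infty$ if $p=1$. $R^q_l:=\{r_1\otimes\cdots\otimes r_l: r_i\in B(L^q([0,1]))\}$, where $(r_1\otimes\cdots\otimes r_l)(x_1,\dots,x_l)=r_1(x_1)\cdots r_l(x_l)$; each $r\in R^q_l$ acts on $f\in B(L^p([0,1]^l))$ by $r(f)=\int r f\,d\lambda$. $\|f\|_{R^q_l}:=\sup_{r\in R^q_l}|r(f)|$ and $d_{R^q_l}(f,g)=\|f-g\|_{R^q_l}$. $S_{[0,1]}$ is the group of measure preserving bijections $\tau:[0,1]\to[0,1]$ ($\lambda(\tau(A))=\lambda(A)$ for measurable $A$), acting on functions on $[0,1]^l$ by $(\tau f)(x_1,\dots,x_l)=f(\tau^{-1}x_1,\dots,\tau^{-1}x_l)$, and $(d_{R^q_l}/S_{[0,1]})(f,g):=\inf_{\tau\in S_{[0,1]}}d_{R^q_l}(f,\tau g)$. Functions may be real or complex valued. *)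

theory Defs
  imports "HOL-Analysis.Analysis" "HOL-Probability.Essential_Supremum"
begin

section \<open>Pseudometric spaces\<close>

definition pseudometric_on :: "'a set \<Rightarrow> ('a \<Rightarrow> 'a \<Rightarrow> real) \<Rightarrow> bool" where
  "pseudometric_on X d \<longleftrightarrow>
     (\<forall>x\<in>X. \<forall>y\<in>X. 0 \<le> d x y) \<and> (\<forall>x\<in>X. d x x = 0) \<and>
     (\<forall>x\<in>X. \<forall>y\<in>X. d x y = d y x) \<and>
     (\<forall>x\<in>X. \<forall>y\<in>X. \<forall>z\<in>X. d x z \<le> d x y + d y z)"

definition pseudometric_topology :: "'a set \<Rightarrow> ('a \<Rightarrow> 'a \<Rightarrow> real) \<Rightarrow> 'a topology" where
  "pseudometric_topology X d =
     topology (\<lambda>U. U \<subseteq> X \<and> (\<forall>x\<in>U. \<exists>e>0. \<forall>y\<in>X. d x y < e \<longrightarrow> y \<in> U))"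

lemma openin_pseudometric_topology:
  "openin (pseudometric_topology X d) U \<longleftrightarrow>
     U \<subseteq> X \<and> (\<forall>x\<in>U. \<exists>e>0. \<forall>y\<in>X. d x y < e \<longrightarrow> y \<in> U)"
proof -
  let ?P = "\<lambda>U. U \<subseteq> X \<and> (\<forall>x\<in>U. \<exists>e>0. \<forall>y\<in>X. d x y < e \<longrightarrow> y \<in> U)"
  have "?P (S \<inter> T)" if S: "?P S" and T: "?P T" for S T
  proof (intro conjI ballI)
    show "S \<inter> T \<subseteq> X" using S by blast
    fix x assume x: "x \<in> S \<inter> T"
    obtain e where e: "e > 0" "\<forall>y\<in>X. d x y < e \<longrightarrow> y \<in> S" using S x by blast
    obtain e' where e': "e' > 0" "\<forall>y\<in>X. d x y < e' \<longrightarrow> y \<in> T" using T x by blast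
    show "\<exists>e>0. \<forall>y\<in>X. d x y < e \<longrightarrow> y \<in> S \<inter> T"
      using e e' by (intro exI[of _ "min e e'"]) auto
  qed
  moreover have "?P (\<Union>K)" if K: "\<forall>U\<in>K. ?P U" for K
  proof (intro conjI ballI)
    show "\<Union>K \<subseteq> X" using K by blast
    fix x assume "x \<in> \<Union>K"
    then obtain U where U: "U \<in> K" "x \<in> U" by blast
    then obtain e where "e > 0" "\<forall>y\<in>X. d x y < e \<longrightarrow> y \<in> U" using K by blast
    then show "\<exists>e>0. \<forall>y\<in>X. d x y < e \<longrightarrow> y \<in> \<Union>K"
      using U by blast
  qed
  ultimately have "istopology ?P"
    unfolding istopology_def by blast
  then show ?thesis
    by (simp add: pseudometric_topology_def topology_inverse')
qed

lemma topspace_pseudometric_topology [simp]: "topspace (pseudometric_topology X d) = X"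
proof -
  have "openin (pseudometric_topology X d) X"
    by (auto simp: openin_pseudometric_topology intro: exI[of _ "1::real"])
  moreover have "topspace (pseudometric_topology X d) \<subseteq> X"
    using openin_topspace[of "pseudometric_topology X d"]
    by (simp only: openin_pseudometric_topology)
  ultimately show ?thesis
    by (simp add: openin_subset subset_antisym)
qed

definition compact_pseudometric_space :: "'a set \<Rightarrow> ('a \<Rightarrow> 'a \<Rightarrow> real) \<Rightarrow> bool" where
  "compact_pseudometric_space X d \<longleftrightarrow>
     pseudometric_on X d \<and> compact_space (pseudometric_topology X d)"

section \<open>Unit balls of \<open>L\<^sup>p\<close> spaces\<close>

text \<open>
  Elements of \<open>L\<^sup>p\<close> are represented by functions rather than by classes modulo almost
  everywhere equality.  Representatives of the same class are at distance 0 for the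
  pseudometric below, so compactness does not depend on this choice.
\<close>

definition conj_exponent :: "ennreal \<Rightarrow> ennreal" where
  "conj_exponent p = (if p = \<infinity> then 1 else if p = 1 then \<infinity> else p / (p - 1))"

definition Lp_space ::
    "'x measure \<Rightarrow> ennreal \<Rightarrow> ('x \<Rightarrow> 'a::real_normed_vector) set" where
  "Lp_space M p = {f \<in> borel_measurable M.
     if p = \<infinity> then esssup M (\<lambda>x. ereal (norm (f x))) < \<infinity>
     else integrable M (\<lambda>x. norm (f x) powr enn2real p)}"

definition Lp_norm :: "'x measure \<Rightarrow> ennreal \<Rightarrow> ('x \<Rightarrow> 'a::real_normed_vector) \<Rightarrow> real" where
  "Lp_norm M p f =
     (if p = \<infinity> then real_of_ereal (esssup M (\<lambda>x. ereal (norm (f x))))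
      else (\<integral>x. norm (f x) powr enn2real p \<partial>M) powr (1 / enn2real p))"

definition Lp_ball ::
    "'x measure \<Rightarrow> ennreal \<Rightarrow> ('x \<Rightarrow> 'a::real_normed_vector) set" where
  "Lp_ball M p = {f \<in> Lp_space M p. Lp_norm M p f \<le> 1}"

section \<open>The norm given by tensor products of functions\<close>

abbreviation unit_interval :: "real measure" where
  "unit_interval \<equiv> lebesgue_on {0..1}"

text \<open>
  Points of \<open>[0,1]\<^sup>l\<close> are extensional functions on \<open>{..<l}\<close>.  The completion turns the product
  measure into Lebesgue measure, defined on all Lebesgue measurable subsets of the cube.
\<close>

definition unit_cube :: "nat \<Rightarrow> (nat \<Rightarrow> real) measure" where
  "unit_cube l = completion (PiM {..<l} (\<lambda>_. unit_interval))"

definition tensor_set ::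
    "ennreal \<Rightarrow> nat \<Rightarrow> ((nat \<Rightarrow> real) \<Rightarrow> 'a::{real_normed_field,banach,second_countable_topology}) set" where
  "tensor_set q l =
     {(\<lambda>x. \<Prod>i<l. r i (x i)) | r. \<forall>i<l. r i \<in> Lp_ball unit_interval q}"

text \<open>
  The real-valued supremum is meaningful whenever \<open>conj_exponent p \<le> q\<close> and \<open>f \<in> Lp_space\<close>:
  the set is nonempty and, by Hoelder's inequality, bounded.
\<close>

definition R_norm ::
    "ennreal \<Rightarrow> nat \<Rightarrow> ((nat \<Rightarrow> real) \<Rightarrow> 'a::{real_normed_field,banach,second_countable_topology}) \<Rightarrow> real" where
  "R_norm q l f = (SUP r\<in>tensor_set q l. norm (\<integral>x. r x * f x \<partial>unit_cube l))"

definition R_dist ::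
    "ennreal \<Rightarrow> nat \<Rightarrow> ((nat \<Rightarrow> real) \<Rightarrow> 'a::{real_normed_field,banach,second_countable_topology})
       \<Rightarrow> ((nat \<Rightarrow> real) \<Rightarrow> 'a) \<Rightarrow> real" where
  "R_dist q l f g = R_norm q l (\<lambda>x. f x - g x)"

section \<open>Measure preserving bijections and the quotient pseudometric\<close>

text \<open>
  Both \<open>\<tau>\<close> and its inverse map Lebesgue measurable sets to Lebesgue measurable sets, so that
  these bijections form a group under composition.
\<close>

definition measure_preserving_bijections :: "(real \<Rightarrow> real) set" where
  "measure_preserving_bijections = {\<tau>. bij_betw \<tau> {0..1} {0..1} \<and>
     (\<forall>A\<subseteq>{0..1}. \<tau> ` A \<in> sets unit_interval \<longleftrightarrow> A \<in> sets unit_interval) \<and>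
     (\<forall>A\<in>sets unit_interval. emeasure unit_interval (\<tau> ` A) = emeasure unit_interval A)}"

definition bijection_action ::
    "nat \<Rightarrow> (real \<Rightarrow> real) \<Rightarrow> ((nat \<Rightarrow> real) \<Rightarrow> 'a) \<Rightarrow> ((nat \<Rightarrow> real) \<Rightarrow> 'a)" where
  "bijection_action l \<tau> f = (\<lambda>x. f (\<lambda>i\<in>{..<l}. inv_into {0..1} \<tau> (x i)))"

definition R_quotient_dist ::
    "ennreal \<Rightarrow> nat \<Rightarrow> ((nat \<Rightarrow> real) \<Rightarrow> 'a::{real_normed_field,banach,second_countable_topology})
       \<Rightarrow> ((nat \<Rightarrow> real) \<Rightarrow> 'a) \<Rightarrow> real" where
  "R_quotient_dist q l f g =
     (INF \<tau>\<in>measure_preserving_bijections. R_dist q l f (bijection_action l \<tau> g))"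

end

theory Submission
  imports Defs "HOL-Probability.Infinite_Product_Measure"
begin

text \<open>
  The orbit space is totally bounded and complete.

  Total boundedness is a weak regularity lemma.  By Young's inequality, a small pairing with all
  tensor products of functions bounded by 1 forces a small \<open>R\<close>-norm on sets bounded in \<open>L\<^sup>p\<close>.  So
  \<open>f\<close> may be truncated at a height \<open>M\<close>, and then an energy decrement, with a projection onto the ball
  of radius \<open>M\<close> after every step, approximates it by an expression of bounded complexity in
  boundedly many tensor products.  Rounding the factors turns them into functions of a finite
  measurable colouring of \<open>[0,1]\<close>.  Up to small measure this colouring is constant on cells of length
  \<open>1/N\<close>, and a permutation of these cells that sorts the colours makes it, up to small measure again,
  a function of \<open>\<lfloor>m x\<rfloor>\<close> with \<open>m\<close> independent of \<open>f\<close>.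

  For completeness, choose bijections along a rapidly Cauchy sequence of orbits such that the
  translated functions \<open>h\<^sub>n\<close> are Cauchy for the \<open>R\<close>-norm.  The elements of the ball that are within
  \<open>\<epsilon>\<^sub>k\<close> of all \<open>h\<^sub>j\<close> with \<open>j \<ge> k\<close>, for all \<open>k \<le> n\<close>, form a decreasing sequence of convex sets.
  Nearly minimising the strictly convex functional \<open>\<integral> sqrt (1 + |g|\<^sup>2)\<close> on them gives a sequence that is
  Cauchy in \<open>L\<^sup>1\<close>, and its limit is the limit of the \<open>h\<^sub>n\<close>.
\<close>

text \<open>The strict inequality between \<open>q\<close> and the conjugate exponent is spent on
  the factors: it leaves room for an exponent \<open>S < Q\<close>, and the part of a factor above a
  height \<open>T\<close> is then small in \<open>L\<^sup>S\<close>, uniformly over the ball. The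
  condition \<open>p > 1\<close> does the same for \<open>f\<close>: the ball is uniformly
  integrable. Together they reduce everything to pairings with bounded factors and to
  \<open>L\<^sup>1\<close> estimates. The order of the constants shapes the regularity argument: the
  factor that turns a small pairing into a small \<open>R\<close>-norm depends on the size of the
  error, and the number of steps depends on that factor. An error that grew with the number of steps
  would make this circular. For completeness, convergence of all pairings does not by itself exhibit
  a limit function. The constraint sets are small for the \<open>R\<close>-norm but need not be
  small in \<open>L\<^sup>1\<close>; strict convexity selects from them a sequence that converges in
  \<open>L\<^sup>1\<close>, so weak compactness is not invoked. The net is sought in the whole
  function space, since approximants leave the ball; its centres are moved into the ball at the
  end.\<close>

type_synonym 'a cube_fun = "(nat \<Rightarrow> real) \<Rightarrow> 'a"

abbreviation "MPB \<equiv> measure_preserving_bijections"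

section \<open>Compactness of orbit spaces of pseudometric spaces\<close>

lemma pseudometric_on_subset:
  "pseudometric_on Y d \<Longrightarrow> X \<subseteq> Y \<Longrightarrow> pseudometric_on X d"
  unfolding pseudometric_on_def by (meson subsetD)

text \<open>A choice function \<open>rep\<close> picks one point from every class of points at
  mutual distance 0. On the set \<open>Q\<close> of representatives \<open>d\<close> is a metric, so
  completeness and total boundedness give compactness there. An open set of the pseudometric
  topology contains with a point its whole class, hence a finite subfamily that covers
  \<open>Q\<close> covers \<open>X\<close>.\<close>

lemma compact_pseudometric_spaceI:
  fixes d :: "'a \<Rightarrow> 'a \<Rightarrow> real"
  assumes pm: "pseudometric_on X d"
    and tb: "\<And>e. e > 0 \<Longrightarrow> \<exists>F. finite F \<and> F \<subseteq> X \<and> (\<forall>x\<in>X. \<exists>y\<in>F. d y x < e)"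
    and cp: "\<And>f. range f \<subseteq> X \<Longrightarrow> (\<forall>e>0. \<exists>N. \<forall>m\<ge>N. \<forall>n\<ge>N. d (f m) (f n) < e)
      \<Longrightarrow> \<exists>x\<in>X. (\<lambda>n::nat. d (f n) x) \<longlonglongrightarrow> 0"
  shows "compact_pseudometric_space X d"
proof -
  have nn: "0 \<le> d x y" and d0: "d x x = 0" and sym: "d x y = d y x" if "x \<in> X" "y \<in> X" for x y
    using pm that by (auto simp: pseudometric_on_def)
  have tri: "d x z \<le> d x y + d y z" if "x \<in> X" "y \<in> X" "z \<in> X" for x y z
    using pm that by (auto simp: pseudometric_on_def)
  define rep where "rep = (\<lambda>x. SOME y. y \<in> X \<and> d x y = 0)"
  have rep: "rep x \<in> X" "d x (rep x) = 0" if "x \<in> X" for x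
    using someI[of "\<lambda>y. y \<in> X \<and> d x y = 0" x] that d0[of x] by (auto simp: rep_def)
  have eq: "d x z = d y z" if "d x y = 0" "x \<in> X" "y \<in> X" "z \<in> X" for x y z
    using tri[of x y z] tri[of y x z] sym[of x y] that by simp
  \<comment> \<open>Points at distance 0 give \<open>SOME\<close> the same predicate, hence
    literally the same representative.\<close>
  have repeq: "rep x = rep y" if "d x y = 0" "x \<in> X" "y \<in> X" for x y
  proof -
    have "(\<lambda>z. z \<in> X \<and> d x z = 0) = (\<lambda>z. z \<in> X \<and> d y z = 0)"
      using eq[OF that] by auto
    then show ?thesis by (simp add: rep_def)
  qed
  define Q where "Q = rep ` X"
  have QX: "Q \<subseteq> X" using rep by (auto simp: Q_def)
  have rr: "rep x = x" if x: "x \<in> Q" for x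
  proof -
    obtain y where y: "y \<in> X" "x = rep y" using x by (auto simp: Q_def)
    then have "rep y = rep (rep y)" using repeq[of y "rep y"] rep[of y] by simp
    then show ?thesis using y by simp
  qed
  \<comment> \<open>\<open>Metric_space\<close> asks for nonnegativity and symmetry on the whole
    type, hence the value 0 off \<open>X\<close>.\<close>
  define d' where "d' = (\<lambda>x y. if x \<in> X \<and> y \<in> X then d x y else 0)"
  have d': "d' x y = d x y" if "x \<in> X" "y \<in> X" for x y using that by (simp add: d'_def)
  have "Metric_space Q d'"
  proof
    show "0 \<le> d' x y" for x y using nn by (simp add: d'_def)
    show "d' x y = d' y x" for x y using sym by (simp add: d'_def)
    show "(d' x y = 0) = (x = y)" if "x \<in> Q" "y \<in> Q" for x y
    proof -
      have "x \<in> X" "y \<in> X" using that QX by auto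
      then show ?thesis using repeq[of x y] d0[of x] that by (auto simp: d' rr)
    qed
    show "d' x z \<le> d' x y + d' y z" if "x \<in> Q" "y \<in> Q" "z \<in> Q" for x y z
      using that QX tri[of x y z] by (simp add: d'_def subset_iff)
  qed
  then interpret M: Metric_space Q d' .
  have "M.mtotally_bounded Q"
    unfolding M.mtotally_bounded_def
  proof (intro allI impI)
    fix e :: real assume "e > 0"
    from tb[OF this] obtain F where F: "finite F" "F \<subseteq> X" "\<forall>x\<in>X. \<exists>y\<in>F. d y x < e"
      by blast
    have "Q \<subseteq> (\<Union>x\<in>rep ` F. M.mball x e)"
    proof
      fix x assume x: "x \<in> Q"
      then obtain y where y: "y \<in> F" "d y x < e" using F QX by blast
      have yx: "y \<in> X" "x \<in> X" using F QX x y by auto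
      then have "d (rep y) x < e" using eq[of y "rep y" x] rep[of y] y by simp
      then have "x \<in> M.mball (rep y) e"
        using x yx rep(1)[of y] by (simp add: M.in_mball d') (simp add: Q_def)
      then show "x \<in> (\<Union>x\<in>rep ` F. M.mball x e)" using y by blast
    qed
    then show "\<exists>K. finite K \<and> K \<subseteq> Q \<and> Q \<subseteq> (\<Union>x\<in>K. M.mball x e)"
      using F by (intro exI[of _ "rep ` F"]) (auto simp: Q_def)
  qed
  moreover have "M.mcomplete"
    unfolding M.mcomplete_def
  proof (intro allI impI)
    fix f assume f: "M.MCauchy f"
    have fQ: "range f \<subseteq> Q" using f by (simp add: M.MCauchy_def)
    then have fX: "f n \<in> X" for n using QX by blast
    have "\<forall>e>0. \<exists>N. \<forall>m\<ge>N. \<forall>n\<ge>N. d (f m) (f n) < e"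
      using f fX by (simp add: M.MCauchy_def d')
    with cp[of f] fX obtain x where x: "x \<in> X" "(\<lambda>n. d (f n) x) \<longlonglongrightarrow> 0" by blast
    have "d' (f n) (rep x) = d (f n) x" for n
      using eq[of x "rep x" "f n"] rep[of x] x fX[of n] sym[of "f n"] by (simp add: d')
    then have "(\<lambda>n. d' (f n) (rep x)) \<longlonglongrightarrow> 0" using x by simp
    then have "limitin M.mtopology f (rep x) sequentially"
      using x fQ by (subst M.limit_metric_sequentially)
        (auto simp: Q_def LIMSEQ_def M.nonneg image_subset_iff)
    then show "\<exists>x. limitin M.mtopology f x sequentially" by blast
  qed
  ultimately have cs: "compact_space M.mtopology"
    by (simp add: M.compact_space_eq_mcomplete_mtotally_bounded)
  have "compact_space (pseudometric_topology X d)"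
    unfolding compact_space_alt topspace_pseudometric_topology
  proof (intro allI impI, elim conjE)
    fix \<U> assume op: "\<forall>U\<in>\<U>. openin (pseudometric_topology X d) U" and cov: "X \<subseteq> \<Union>\<U>"
    have nbhd: "\<exists>e>0. \<forall>y\<in>X. d x y < e \<longrightarrow> y \<in> U" if "U \<in> \<U>" "x \<in> U" for U x
      using op[rule_format, OF that(1), unfolded openin_pseudometric_topology] that(2) by simp
    have o: "openin M.mtopology (U \<inter> Q)" if UU: "U \<in> \<U>" for U
      unfolding M.openin_mtopology
    proof (intro conjI allI impI)
      fix x assume x: "x \<in> U \<inter> Q"
      then obtain e where e: "e > 0" "\<forall>y\<in>X. d x y < e \<longrightarrow> y \<in> U"
        using nbhd[OF UU, of x] by auto
      have "M.mball x e \<subseteq> U \<inter> Q" using e QX by (auto simp: M.in_mball d' subset_iff)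
      then show "\<exists>r>0. M.mball x r \<subseteq> U \<inter> Q" using e by blast
    qed auto
    have "\<exists>\<F>. finite \<F> \<and> \<F> \<subseteq> (\<lambda>U. U \<inter> Q) ` \<U> \<and> Q \<subseteq> \<Union>\<F>"
      using cs[unfolded compact_space_alt, rule_format, of "(\<lambda>U. U \<inter> Q) ` \<U>"] o cov QX by auto
    then obtain \<G> where G: "\<G> \<subseteq> \<U>" "finite \<G>" "Q \<subseteq> \<Union>((\<lambda>U. U \<inter> Q) ` \<G>)"
      by (metis (no_types, lifting) finite_subset_image)
    have "X \<subseteq> \<Union>\<G>"
    proof
      fix x assume x: "x \<in> X"
      then obtain U where U: "U \<in> \<G>" "rep x \<in> U" using G by (auto simp: Q_def)
      then obtain e where e: "e > 0" "\<forall>y\<in>X. d (rep x) y < e \<longrightarrow> y \<in> U"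
        using nbhd[of U "rep x"] G by auto
      have "d (rep x) x = 0" using rep[of x] sym[of x "rep x"] x by simp
      then show "x \<in> \<Union>\<G>" using e U x by auto
    qed
    then show "\<exists>\<F>. finite \<F> \<and> \<F> \<subseteq> \<U> \<and> X \<subseteq> \<Union>\<F>" using G by blast
  qed
  then show ?thesis using pm by (simp add: compact_pseudometric_space_def)
qed

text \<open>The group laws are required only up to distance 0: elements of the function space are
  total functions, and translations compose correctly only at points of the cube, their values
  elsewhere being uncontrolled. \<open>Y\<close> is meant to be the whole function space, with the
  ball as an invariant subset.\<close>

locale isometric_action =
  fixes Y :: "'a set" and \<delta> :: "'a \<Rightarrow> 'a \<Rightarrow> real" and G :: "'g set" and act :: "'g \<Rightarrow> 'a \<Rightarrow> 'a"
  assumes pm: "pseudometric_on Y \<delta>"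
    and act_in: "g \<in> G \<Longrightarrow> x \<in> Y \<Longrightarrow> act g x \<in> Y"
    and isometry: "g \<in> G \<Longrightarrow> x \<in> Y \<Longrightarrow> y \<in> Y \<Longrightarrow> \<delta> (act g x) (act g y) = \<delta> x y"
    and neutral: "\<exists>e\<in>G. \<forall>x\<in>Y. \<forall>y\<in>Y. \<delta> x (act e y) = \<delta> x y"
    and adjoint: "g \<in> G \<Longrightarrow> \<exists>g'\<in>G. \<forall>x\<in>Y. \<forall>y\<in>Y. \<delta> (act g x) y = \<delta> x (act g' y)"
    and compose: "g \<in> G \<Longrightarrow> h \<in> G \<Longrightarrow>
      \<exists>k\<in>G. \<forall>x\<in>Y. \<forall>y\<in>Y. \<delta> x (act g (act h y)) = \<delta> x (act k y)"
begin

definition orbit_dist :: "'a \<Rightarrow> 'a \<Rightarrow> real" where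
  "orbit_dist x y = (INF g\<in>G. \<delta> x (act g y))"

lemma nonneg: "x \<in> Y \<Longrightarrow> y \<in> Y \<Longrightarrow> 0 \<le> \<delta> x y"
  and zero: "x \<in> Y \<Longrightarrow> \<delta> x x = 0"
  and sym: "x \<in> Y \<Longrightarrow> y \<in> Y \<Longrightarrow> \<delta> x y = \<delta> y x"
  and tri: "x \<in> Y \<Longrightarrow> y \<in> Y \<Longrightarrow> z \<in> Y \<Longrightarrow> \<delta> x z \<le> \<delta> x y + \<delta> y z"
  using pm by (auto simp: pseudometric_on_def)

lemma orbit_dist_le: "x \<in> Y \<Longrightarrow> y \<in> Y \<Longrightarrow> g \<in> G \<Longrightarrow> orbit_dist x y \<le> \<delta> x (act g y)"
  unfolding orbit_dist_def
  by (intro cINF_lower bdd_belowI[of _ 0]) (auto simp: nonneg act_in)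

lemma orbit_dist_less:
  assumes "x \<in> Y" "y \<in> Y" "orbit_dist x y < e"
  obtains g where "g \<in> G" "\<delta> x (act g y) < e"
proof -
  have "G \<noteq> {}" using neutral by blast
  then show ?thesis
    using cInf_lessD[of "(\<lambda>g. \<delta> x (act g y)) ` G" e] assms that
    by (auto simp: orbit_dist_def)
qed

lemma orbit_dist_le_dist: "x \<in> Y \<Longrightarrow> y \<in> Y \<Longrightarrow> orbit_dist x y \<le> \<delta> x y"
  using neutral orbit_dist_le by metis

lemma orbit_dist_sym_le:
  assumes "x \<in> Y" "y \<in> Y" shows "orbit_dist x y \<le> orbit_dist y x"
proof (rule field_le_epsilon)
  fix e :: real assume "e > 0"
  then obtain g where g: "g \<in> G" "\<delta> y (act g x) < orbit_dist y x + e"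
    using orbit_dist_less[of y x "orbit_dist y x + e"] assms by auto
  obtain g' where "g' \<in> G" "\<delta> (act g x) y = \<delta> x (act g' y)" using adjoint g assms by blast
  then show "orbit_dist x y \<le> orbit_dist y x + e"
    using orbit_dist_le[of x y g'] sym[of y "act g x"] g assms act_in[of g x] by auto
qed

lemma pseudometric_on_orbit_dist: "pseudometric_on Y orbit_dist"
  unfolding pseudometric_on_def
proof (intro conjI ballI)
  have ne: "G \<noteq> {}" using neutral by blast
  fix x assume x: "x \<in> Y"
  show nn: "0 \<le> orbit_dist x y" if "y \<in> Y" for y
    unfolding orbit_dist_def using that x ne by (intro cINF_greatest) (auto simp: nonneg act_in)
  show "orbit_dist x x = 0" using orbit_dist_le_dist[of x x] nn[of x] zero x by simp
  fix y assume y: "y \<in> Y"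
  show "orbit_dist x y = orbit_dist y x" using orbit_dist_sym_le x y by (meson order_antisym)
  fix z assume z: "z \<in> Y"
  show "orbit_dist x z \<le> orbit_dist x y + orbit_dist y z"
  proof (rule field_le_epsilon)
    fix e :: real assume e: "e > 0"
    obtain g where g: "g \<in> G" "\<delta> x (act g y) < orbit_dist x y + e/2"
      using orbit_dist_less[of x y "orbit_dist x y + e/2"] x y e by auto
    obtain h where h: "h \<in> G" "\<delta> y (act h z) < orbit_dist y z + e/2"
      using orbit_dist_less[of y z "orbit_dist y z + e/2"] z y e by auto
    obtain k where k: "k \<in> G" "\<delta> x (act g (act h z)) = \<delta> x (act k z)"
      using compose g h x z by blast
    have "orbit_dist x z \<le> \<delta> x (act g (act h z))" using orbit_dist_le k x z by simp
    also have "\<dots> \<le> \<delta> x (act g y) + \<delta> (act g y) (act g (act h z))"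
      using x y z g h by (intro tri) (auto intro: act_in)
    also have "\<dots> = \<delta> x (act g y) + \<delta> y (act h z)"
      using isometry y z g h by (simp add: act_in)
    finally show "orbit_dist x z \<le> orbit_dist x y + orbit_dist y z + e" using g h by simp
  qed
qed

text \<open>The distance from \<open>h k\<close> to any later term is at most the geometric tail
  \<open>2 * (1/2)^k\<close>. Two later terms are joined through \<open>h k\<close>, whence the
  4.\<close>

lemma geometric_cauchy:
  assumes "range h \<subseteq> Y" and "\<And>k. \<delta> (h k) (h (Suc k)) \<le> (1/2)^k" and "i \<ge> k" "j \<ge> k"
  shows "\<delta> (h i) (h j) \<le> 4 * (1/2)^k"
proof -
  have hY: "h n \<in> Y" for n using assms by auto
  have a: "\<delta> (h k) (h (k+n)) \<le> 2 * (1/2)^k - 2 * (1/2)^(k+n)" for n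
  proof (induction n)
    case (Suc n)
    have "\<delta> (h k) (h (k + Suc n)) \<le> \<delta> (h k) (h (k+n)) + \<delta> (h (k+n)) (h (k + Suc n))"
      using hY by (intro tri)
    with Suc assms(2)[of "k+n"] show ?case by simp
  qed (simp add: zero hY)
  have b: "\<delta> (h k) (h i) \<le> 2 * (1/2)^k" if ik: "i \<ge> k" for i
  proof -
    obtain n where "i = k + n" using ik le_iff_add by auto
    moreover have "0 \<le> 2 * (1/2::real)^(k+n)" by simp
    ultimately show ?thesis using a[of n] by (simp only:)
  qed
  have "\<delta> (h i) (h j) \<le> \<delta> (h i) (h k) + \<delta> (h k) (h j)" using hY by (intro tri)
  then show ?thesis using b[of i] b[of j] sym[of "h i" "h k"] hY assms by simp
qed

text \<open>The assumption \<open>complete\<close> receives a Cauchy sequence together with an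
  explicit rate \<open>\<epsilon>\<close>, because its proof for functions builds constraint sets
  from that rate. The limit is first reached along a subsequence of orbits; the Cauchy property
  extends this to the whole sequence.\<close>

lemma orbit_dist_complete:
  assumes X: "X \<subseteq> Y" and inv: "\<And>g x. g \<in> G \<Longrightarrow> x \<in> X \<Longrightarrow> act g x \<in> X"
    and complete: "\<And>h \<epsilon>. range h \<subseteq> X \<Longrightarrow> \<epsilon> \<longlonglongrightarrow> 0 \<Longrightarrow>
      (\<And>k i j. i \<ge> k \<Longrightarrow> j \<ge> k \<Longrightarrow> \<delta> (h i) (h j) \<le> \<epsilon> k) \<Longrightarrow> \<exists>x\<in>X. (\<lambda>n::nat. \<delta> (h n) x) \<longlonglongrightarrow> 0"
    and f: "range f \<subseteq> X" and cauchy: "\<forall>e>0. \<exists>N. \<forall>m\<ge>N. \<forall>n\<ge>N. orbit_dist (f m) (f n) < e"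
  shows "\<exists>x\<in>X. (\<lambda>n::nat. orbit_dist (f n) x) \<longlonglongrightarrow> 0"
proof -
  have fX: "f n \<in> X" and fY: "f n \<in> Y" for n using f X by auto
  have "\<exists>r. \<forall>k. (\<forall>m\<ge>r k. \<forall>n\<ge>r k. orbit_dist (f m) (f n) < (1/2)^k) \<and> r k < r (Suc k)"
  proof (rule dependent_nat_choice)
    show "\<exists>x. \<forall>m\<ge>x. \<forall>n\<ge>x. orbit_dist (f m) (f n) < (1/2)^0" using cauchy by simp
    fix x k
    obtain N where "\<forall>m\<ge>N. \<forall>n\<ge>N. orbit_dist (f m) (f n) < (1/2)^Suc k"
      using cauchy[rule_format, of "(1/2)^Suc k"] by auto
    then show "\<exists>y. (\<forall>m\<ge>y. \<forall>n\<ge>y. orbit_dist (f m) (f n) < (1/2)^Suc k) \<and> x < y"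
      by (intro exI[of _ "max N (Suc x)"]) auto
  qed
  then obtain r where r: "\<And>k m n. m \<ge> r k \<Longrightarrow> n \<ge> r k \<Longrightarrow> orbit_dist (f m) (f n) < (1/2)^k"
    and rS: "\<And>k. r k < r (Suc k)" by blast
  have mono: "strict_mono r" by (rule strict_mono_Suc_iff[THEN iffD2]) (use rS in auto)
  have step: "orbit_dist (f (r k)) (f (r (Suc k))) < (1/2)^k" for k
    using r[of k "r k" "r (Suc k)"] rS[of k] by simp
  \<comment> \<open>If \<open>s\<close> was chosen for \<open>f (r k)\<close> and \<open>t\<close>
    brings \<open>f (r (Suc k))\<close> near \<open>f (r k)\<close>, the next choice is the
    composite of \<open>s\<close> and \<open>t\<close>: acting with \<open>s\<close> on both sides
    leaves the distance unchanged.\<close>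
  have "\<exists>\<sigma>. \<forall>k. \<sigma> k \<in> G \<and> \<delta> (act (\<sigma> k) (f (r k))) (act (\<sigma> (Suc k)) (f (r (Suc k)))) < (1/2)^k"
  proof (rule dependent_nat_choice)
    show "\<exists>x. x \<in> G" using neutral by blast
    fix s k assume s: "s \<in> G"
    obtain t where t: "t \<in> G" "\<delta> (f (r k)) (act t (f (r (Suc k)))) < (1/2)^k"
      using orbit_dist_less[OF fY fY step] by blast
    obtain u where u: "u \<in> G" "\<forall>x\<in>Y. \<forall>y\<in>Y. \<delta> x (act s (act t y)) = \<delta> x (act u y)"
      using compose s t by blast
    have "\<delta> (act s (f (r k))) (act u (f (r (Suc k)))) =
        \<delta> (act s (f (r k))) (act s (act t (f (r (Suc k)))))"
      using u s fY act_in by auto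
    also have "\<dots> < (1/2)^k" using isometry s t fY act_in by auto
    finally show "\<exists>y. y \<in> G \<and> \<delta> (act s (f (r k))) (act y (f (r (Suc k)))) < (1/2)^k" using u by blast
  qed
  then obtain \<sigma> where \<sigma>: "\<And>k. \<sigma> k \<in> G"
    and \<sigma>d: "\<And>k. \<delta> (act (\<sigma> k) (f (r k))) (act (\<sigma> (Suc k)) (f (r (Suc k)))) < (1/2)^k"
    by blast
  define h where "h = (\<lambda>k. act (\<sigma> k) (f (r k)))"
  have hX: "range h \<subseteq> X" using \<sigma> fX inv by (auto simp: h_def)
  have "\<exists>x\<in>X. (\<lambda>n. \<delta> (h n) x) \<longlonglongrightarrow> 0"
  proof (rule complete[OF hX])
    show "(\<lambda>k. 4 * (1/2::real)^k) \<longlonglongrightarrow> 0" by (intro tendsto_mult_right_zero LIMSEQ_power_zero) auto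
    show "\<delta> (h i) (h j) \<le> 4 * (1/2)^k" if "i \<ge> k" "j \<ge> k" for i j k
      by (rule geometric_cauchy) (use hX X that \<sigma>d in \<open>auto simp: h_def less_imp_le\<close>)
  qed
  then obtain x where x: "x \<in> X" "(\<lambda>n. \<delta> (h n) x) \<longlonglongrightarrow> 0" by blast
  have xY: "x \<in> Y" using x X by auto
  have od: "orbit_dist (f (r n)) x \<le> \<delta> (h n) x" for n
  proof -
    obtain g where "g \<in> G" "\<delta> (h n) x = \<delta> (f (r n)) (act g x)"
      using adjoint[OF \<sigma>[of n]] fY[of "r n"] xY unfolding h_def by blast
    then show ?thesis using orbit_dist_le[OF fY[of "r n"] xY, of g] by simp
  qed
  have "(\<lambda>n. orbit_dist (f n) x) \<longlonglongrightarrow> 0"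
  proof (rule LIMSEQ_I)
    fix e :: real assume e: "e > 0"
    obtain N where N: "\<And>m n. m \<ge> N \<Longrightarrow> n \<ge> N \<Longrightarrow> orbit_dist (f m) (f n) < e/2"
      using cauchy[rule_format, of "e/2"] e by auto
    obtain K where K: "\<And>n. n \<ge> K \<Longrightarrow> norm (\<delta> (h n) x - 0) < e/2"
      using LIMSEQ_D[OF x(2), of "e/2"] e by auto
    define k where "k = max N K"
    have rk: "r k \<ge> N" using seq_suble[OF mono, of k] by (simp add: k_def)
    have "norm (orbit_dist (f n) x - 0) < e" if n: "n \<ge> N" for n
    proof -
      have "orbit_dist (f n) x \<le> orbit_dist (f n) (f (r k)) + orbit_dist (f (r k)) x"
        and "0 \<le> orbit_dist (f n) x"
        using pseudometric_on_orbit_dist fY[of n] fY[of "r k"] xY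
        unfolding pseudometric_on_def by blast+
      moreover have "orbit_dist (f (r k)) x < e/2" using od[of k] K[of k] by (simp add: k_def)
      ultimately show ?thesis using N[OF n rk] by simp
    qed
    then show "\<exists>N. \<forall>n\<ge>N. norm (orbit_dist (f n) x - 0) < e" by blast
  qed
  then show ?thesis using x by blast
qed

end

section \<open>Rearranging a finite measurable colouring of the unit interval\<close>

lemma sets_unit_interval_iff: "A \<in> sets unit_interval \<longleftrightarrow> A \<subseteq> {0..1} \<and> A \<in> sets lebesgue"
  by (subst sets_restrict_space_iff) auto

lemma emeasure_unit_interval: "A \<subseteq> {0..1} \<Longrightarrow> emeasure unit_interval A = emeasure lebesgue A"
  by (subst emeasure_restrict_space) auto

text \<open>A piecewise translation with finitely many measurable pieces. Membership in
  \<open>MPB\<close> demands that measurability be preserved and reflected, so the pieces of an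
  image are also translated back. Injectivity keeps images of disjoint pieces disjoint, and measures
  add up.\<close>

lemma measure_preserving_bijectionI:
  fixes \<tau> :: "real \<Rightarrow> real" and I :: "'j \<Rightarrow> real set"
  assumes bij: "bij_betw \<tau> {0..1} {0..1}"
    and J: "finite J" "disjoint_family_on I J" "(\<Union>j\<in>J. I j) = {0..1}"
    and I: "\<And>j. j \<in> J \<Longrightarrow> I j \<in> sets lebesgue"
    and trans: "\<And>j x. j \<in> J \<Longrightarrow> x \<in> I j \<Longrightarrow> \<tau> x = a j + x"
  shows "\<tau> \<in> MPB"
proof -
  have inj: "inj_on \<tau> {0..1}" and surj: "\<tau> ` {0..1} = {0..1}"
    using bij by (auto simp: bij_betw_def)
  have I01: "I j \<subseteq> {0..1}" if "j \<in> J" for j using J that by blast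
  have piece: "\<tau> ` (A \<inter> I j) = (\<lambda>x. a j + x) ` (A \<inter> I j)" if "j \<in> J" for A j
    using trans[OF that] by (intro image_cong) auto
  have split: "A = (\<Union>j\<in>J. A \<inter> I j)" if "A \<subseteq> {0..1}" for A
    using J that by blast
  have split': "\<tau> ` A = (\<Union>j\<in>J. \<tau> ` (A \<inter> I j))" if "A \<subseteq> {0..1}" for A
    using split[OF that] by blast
  have m: "\<tau> ` A \<in> sets lebesgue" if A: "A \<subseteq> {0..1}" "A \<in> sets lebesgue" for A
  proof (subst split'[OF A(1)], intro sets.finite_UN J(1))
    show "\<tau> ` (A \<inter> I j) \<in> sets lebesgue" if "j \<in> J" for j
      using piece[OF that] lebesgue_sets_translation[of "A \<inter> I j"] I[OF that] A by auto
  qed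
  have m': "A \<in> sets lebesgue" if A: "A \<subseteq> {0..1}" "\<tau> ` A \<in> sets lebesgue" for A
  proof (subst split[OF A(1)], intro sets.finite_UN J(1))
    fix j assume j: "j \<in> J"
    have "\<tau> ` (A \<inter> I j) = \<tau> ` A \<inter> \<tau> ` I j"
      using inj_on_image_Int[OF inj A(1) I01[OF j]] .
    also have "\<dots> \<in> sets lebesgue" using A m[OF I01[OF j] I[OF j]] by auto
    finally have "(\<lambda>x. - a j + x) ` \<tau> ` (A \<inter> I j) \<in> sets lebesgue"
      by (rule lebesgue_sets_translation)
    moreover have "(\<lambda>x. - a j + x) ` \<tau> ` (A \<inter> I j) = A \<inter> I j"
      unfolding piece[OF j] by (auto simp: image_image)
    ultimately show "A \<inter> I j \<in> sets lebesgue" by simp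
  qed
  have tr: "emeasure lebesgue ((\<lambda>x. b + x) ` S) = emeasure lebesgue S" for b :: real and S
    using emeasure_lebesgue_affine[of 1 b S] by (simp add: add.commute[of _ b])
  have e: "emeasure lebesgue (\<tau> ` A) = emeasure lebesgue A" if A: "A \<subseteq> {0..1}" "A \<in> sets lebesgue" for A
  proof -
    have AI: "A \<inter> I j \<in> sets lebesgue" if "j \<in> J" for j using A I that by auto
    have disj: "disjoint_family_on (\<lambda>j. A \<inter> I j) J" using J(2) by (auto simp: disjoint_family_on_def)
    have disj': "disjoint_family_on (\<lambda>j. \<tau> ` (A \<inter> I j)) J"
      unfolding disjoint_family_on_def
    proof (intro ballI impI)
      fix i j assume ij: "i \<in> J" "j \<in> J" "i \<noteq> j"
      then have "\<tau> ` (A \<inter> I i) \<inter> \<tau> ` (A \<inter> I j) = \<tau> ` ((A \<inter> I i) \<inter> (A \<inter> I j))"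
        by (intro inj_on_image_Int[OF inj, symmetric]) (use A in auto)
      also have "\<dots> = {}" using disj ij by (auto simp: disjoint_family_on_def)
      finally show "\<tau> ` (A \<inter> I i) \<inter> \<tau> ` (A \<inter> I j) = {}" .
    qed
    have "emeasure lebesgue (\<tau> ` A) = (\<Sum>j\<in>J. emeasure lebesgue (\<tau> ` (A \<inter> I j)))"
      using A by (subst split'[OF A(1)], subst sum_emeasure[OF _ disj' J(1)]) (auto intro!: m AI)
    also have "\<dots> = (\<Sum>j\<in>J. emeasure lebesgue (A \<inter> I j))"
      by (intro sum.cong refl) (simp add: piece tr)
    also have "\<dots> = emeasure lebesgue (\<Union>j\<in>J. A \<inter> I j)"
      by (rule sum_emeasure[OF _ disj J(1)]) (auto intro!: AI)
    finally show ?thesis using split[OF A(1)] by simp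
  qed
  show ?thesis
    unfolding measure_preserving_bijections_def
  proof (intro CollectI conjI allI impI ballI bij)
    show "(\<tau> ` A \<in> sets unit_interval) = (A \<in> sets unit_interval)" if A: "A \<subseteq> {0..1}" for A
    proof -
      have "\<tau> ` A \<subseteq> {0..1}" using image_mono[OF A, of \<tau>] surj by simp
      moreover have "\<tau> ` A \<in> sets lebesgue \<longleftrightarrow> A \<in> sets lebesgue"
        by (rule iffI[OF m'[OF A] m[OF A]])
      ultimately show ?thesis unfolding sets_unit_interval_iff using A by blast
    qed
    show "emeasure unit_interval (\<tau> ` A) = emeasure unit_interval A" if "A \<in> sets unit_interval" for A
    proof -
      have A: "A \<subseteq> {0..1}" "A \<in> sets lebesgue" using that by (auto simp: sets_unit_interval_iff)
      have "\<tau> ` A \<subseteq> {0..1}" using image_mono[OF A(1), of \<tau>] surj by simp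
      then show ?thesis using e[OF A] A by (simp add: emeasure_unit_interval)
    qed
  qed
qed

text \<open>The right end point has \<open>cell N 1 = N\<close>, one beyond the indices of the
  \<open>N\<close> cells that tile \<open>[0,1)\<close>; it recurs below as a piece of its own or as
  an exceptional point.\<close>

definition cell :: "nat \<Rightarrow> real \<Rightarrow> nat" where
  "cell N x = nat \<lfloor>real N * x\<rfloor>"

lemma cell_eq_iff:
  assumes "N > 0" "0 \<le> x"
  shows "cell N x = k \<longleftrightarrow> real k / real N \<le> x \<and> x < (real k + 1) / real N"
proof -
  have "cell N x = k \<longleftrightarrow> \<lfloor>real N * x\<rfloor> = int k"
    using assms by (auto simp: cell_def)
  also have "\<dots> \<longleftrightarrow> real k \<le> real N * x \<and> real N * x < real k + 1"
    by (simp add: floor_eq_iff)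
  finally show ?thesis using assms by (simp add: field_simps)
qed

lemma cell_less:
  assumes "N > 0" "0 \<le> x" "x < 1" shows "cell N x < N"
proof -
  have "real N * x < real N" using assms by simp
  then have "\<lfloor>real N * x\<rfloor> < int N" by (simp add: floor_less_iff)
  then show ?thesis using assms by (simp add: cell_def nat_less_iff)
qed

text \<open>Being the identity off \<open>[0,1)\<close>, in particular at 1, it turns inverse
  permutations into inverse maps of the whole line.\<close>

definition cell_exchange :: "nat \<Rightarrow> (nat \<Rightarrow> nat) \<Rightarrow> real \<Rightarrow> real" where
  "cell_exchange N \<pi> x = (if 0 \<le> x \<and> x < 1
     then (real (\<pi> (cell N x)) - real (cell N x)) / real N + x else x)"

lemma cell_exchange:
  assumes N: "N > 0" and \<pi>: "\<pi> ` {..<N} \<subseteq> {..<N}" and x: "0 \<le> x" "x < 1"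
  shows "0 \<le> cell_exchange N \<pi> x" "cell_exchange N \<pi> x < 1"
    "cell N (cell_exchange N \<pi> x) = \<pi> (cell N x)"
proof -
  define k where "k = cell N x"
  have k: "real k / real N \<le> x" "x < (real k + 1) / real N" "k < N"
    using cell_eq_iff[OF N x(1), of k] cell_less[OF N x] by (auto simp: k_def)
  have \<pi>k: "\<pi> k < N" using \<pi> k by auto
  have ex: "cell_exchange N \<pi> x = (real (\<pi> k) - real k) / real N + x"
    using x by (simp add: cell_exchange_def k_def)
  have l: "real (\<pi> k) / real N \<le> cell_exchange N \<pi> x"
    and u: "cell_exchange N \<pi> x < (real (\<pi> k) + 1) / real N"
    using k unfolding ex by (simp_all add: diff_divide_distrib add_divide_distrib)
  show 0: "0 \<le> cell_exchange N \<pi> x" using l by (rule order_trans[rotated]) simp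
  have "(real (\<pi> k) + 1) / real N \<le> 1" using \<pi>k N by simp
  with u show "cell_exchange N \<pi> x < 1" by linarith
  show "cell N (cell_exchange N \<pi> x) = \<pi> (cell N x)"
    using l u cell_eq_iff[OF N 0] by (simp add: k_def)
qed

lemma cell_exchange_inverse:
  assumes N: "N > 0" and \<pi>: "\<pi> ` {..<N} \<subseteq> {..<N}" and inv: "\<And>k. k < N \<Longrightarrow> \<sigma> (\<pi> k) = k"
  shows "cell_exchange N \<sigma> (cell_exchange N \<pi> x) = x"
proof (cases "0 \<le> x \<and> x < 1")
  case True
  note X = cell_exchange[OF N \<pi>, of x]
  have "cell N x < N" using cell_less N True by blast
  then show ?thesis using X True inv[of "cell N x"] N
    by (simp add: cell_exchange_def[of N \<sigma>]) (simp add: cell_exchange_def field_simps)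
next
  case False
  then show ?thesis by (auto simp: cell_exchange_def)
qed

lemma cell_exchange_in_bijections:
  assumes N: "N > 0" and \<pi>: "bij_betw \<pi> {..<N} {..<N}"
  shows "cell_exchange N \<pi> \<in> MPB"
proof -
  define \<sigma> where "\<sigma> = inv_into {..<N} \<pi>"
  have \<sigma>: "bij_betw \<sigma> {..<N} {..<N}" unfolding \<sigma>_def by (rule bij_betw_inv_into[OF \<pi>])
  have im: "\<pi> ` {..<N} \<subseteq> {..<N}" "\<sigma> ` {..<N} \<subseteq> {..<N}"
    using \<pi> \<sigma> by (auto simp: bij_betw_def)
  have inv1: "\<sigma> (\<pi> k) = k" if "k < N" for k
    unfolding \<sigma>_def using bij_betw_inv_into_left[OF \<pi>] that by simp
  have inv2: "\<pi> (\<sigma> k) = k" if "k < N" for k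
    unfolding \<sigma>_def using bij_betw_inv_into_right[OF \<pi>] that by simp
  have in01: "cell_exchange N \<rho> x \<in> {0..1}" if "\<rho> ` {..<N} \<subseteq> {..<N}" "x \<in> {0..1}" for \<rho> x
    using cell_exchange(1,2)[OF N that(1), of x] that(2)
    by (cases "x = 1") (auto simp: cell_exchange_def)
  have bij: "bij_betw (cell_exchange N \<pi>) {0..1} {0..1}"
    by (rule bij_betw_byWitness[where f' = "cell_exchange N \<sigma>"])
      (use in01 im cell_exchange_inverse[OF N] inv1 inv2 in auto)
  \<comment> \<open>One piece for every cell, and the piece \<open>{1}\<close> with index
    \<open>N\<close>, which is translated by 0.\<close>
  define I where "I k = {x\<in>{0..1}. if k = N then x = 1 else real k / N \<le> x \<and> x < (real k + 1) / N}" for k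
  have Icell: "x \<in> I k \<longleftrightarrow> (if x = 1 then k = N else k = cell N x)" if "k \<le> N" "x \<in> {0..1}" for x k
  proof -
    have "cell N 1 = N" by (simp add: cell_def)
    then show ?thesis using that cell_eq_iff[OF N, of x k] cell_less[OF N, of x] by (auto simp: I_def)
  qed
  show ?thesis
  proof (rule measure_preserving_bijectionI[OF bij, where J = "{..N}" and I = I
        and a = "\<lambda>k. if k = N then 0 else (real (\<pi> k) - real k) / real N"])
    show "disjoint_family_on I {..N}"
      unfolding disjoint_family_on_def
    proof (intro ballI impI)
      fix m n assume mn: "m \<in> {..N}" "n \<in> {..N}" "m \<noteq> n"
      have "x \<notin> I m \<inter> I n" for x
      proof (cases "x \<in> {0..1}")
        case True
        then show ?thesis using Icell[of m x] Icell[of n x] mn by auto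
      qed (auto simp: I_def)
      then show "I m \<inter> I n = {}" by blast
    qed
    show "(\<Union>j\<le>N. I j) = {0..1}"
    proof
      show "{0..1} \<subseteq> (\<Union>j\<le>N. I j)"
      proof
        fix x :: real assume x: "x \<in> {0..1}"
        show "x \<in> (\<Union>j\<le>N. I j)"
          using x Icell[of N x] Icell[of "cell N x" x] cell_less[OF N, of x] by (cases "x = 1") auto
      qed
    qed (auto simp: I_def)
    show "I j \<in> sets lebesgue" if "j \<in> {..N}" for j
      by (cases "j = N") (auto simp: I_def)
    show "cell_exchange N \<pi> x = (if j = N then 0 else (real (\<pi> j) - real j) / real N) + x"
      if "j \<in> {..N}" "x \<in> I j" for j x
    proof -
      have "x \<in> {0..1}" using that by (simp add: I_def)
      then show ?thesis
        using that Icell[of j x] cell_less[OF N, of x] by (auto simp: cell_exchange_def split: if_splits)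
    qed
  qed simp
qed

lemma step_approximation:
  fixes c :: "real \<Rightarrow> 'z"
  assumes Z: "finite Z" and \<eta>: "\<eta> > 0" and cZ: "\<And>x. x \<in> {0..1} \<Longrightarrow> c x \<in> Z"
    and meas: "\<And>z. z \<in> Z \<Longrightarrow> {x\<in>{0..1}. c x = z} \<in> sets lebesgue"
  shows "\<exists>N0. \<forall>N\<ge>N0. \<exists>c' E. (\<forall>k. c' k \<in> Z) \<and> E \<in> sets lebesgue \<and> E \<subseteq> {0..1} \<and>
    measure lebesgue E \<le> \<eta> \<and> (\<forall>x\<in>{0..1} - E. c x = c' (cell N x))"
proof -
  define S where "S z = {x\<in>{0..1}. c x = z}" for z
  have ZZ: "Z \<noteq> {}" using cZ[of 0] by auto
  then have cardZ: "0 < card Z" using Z by (simp add: card_gt_0_iff)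
  have "\<exists>K. closed K \<and> K \<subseteq> S z \<and> S z - K \<in> lmeasurable \<and> measure lebesgue (S z - K) \<le> \<eta> / card Z"
    if z: "z \<in> Z" for z
  proof -
    have p: "0 < \<eta> / card Z" using \<eta> cardZ by simp
    obtain K where K: "closed K" "K \<subseteq> S z" "S z - K \<in> lmeasurable"
      "emeasure lebesgue (S z - K) < ennreal (\<eta> / card Z)"
      using sets_lebesgue_inner_closed[OF meas[OF z] p] unfolding S_def by blast
    moreover have "measure lebesgue (S z - K) \<le> \<eta> / card Z"
      using K(4) p by (simp add: Sigma_Algebra.measure_def enn2real_leI less_imp_le)
    ultimately show ?thesis by blast
  qed
  then obtain K where K: "\<And>z. z \<in> Z \<Longrightarrow> closed (K z)" "\<And>z. z \<in> Z \<Longrightarrow> K z \<subseteq> S z"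
    "\<And>z. z \<in> Z \<Longrightarrow> S z - K z \<in> lmeasurable"
    "\<And>z. z \<in> Z \<Longrightarrow> measure lebesgue (S z - K z) \<le> \<eta> / card Z"
    by metis
  have S01: "S z \<subseteq> {0..1}" for z by (auto simp: S_def)
  have "\<forall>\<^sub>F N in sequentially. \<forall>p\<in>{p \<in> Z \<times> Z. fst p \<noteq> snd p}. \<forall>x\<in>K (fst p). \<forall>y\<in>K (snd p). cell N x \<noteq> cell N y"
  proof (rule eventually_ball_finite)
    show "finite {p \<in> Z \<times> Z. fst p \<noteq> snd p}" using Z by simp
    show "\<forall>p\<in>{p \<in> Z \<times> Z. fst p \<noteq> snd p}. \<forall>\<^sub>F N in sequentially.
       \<forall>x\<in>K (fst p). \<forall>y\<in>K (snd p). cell N x \<noteq> cell N y"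
    proof
      fix p assume "p \<in> {p \<in> Z \<times> Z. fst p \<noteq> snd p}"
      then obtain z w where p: "p = (z, w)" and zw: "z \<in> Z" "w \<in> Z" "z \<noteq> w" by (cases p) auto
      have cz: "compact (K z)"
        using K(1,2)[OF zw(1)] S01[of z]
        by (meson bounded_closed_interval bounded_subset compact_eq_bounded_closed subset_trans)
      have dz: "K z \<inter> K w = {}" using K(2)[OF zw(1)] K(2)[OF zw(2)] zw(3) by (auto simp: S_def)
      obtain d where d: "d > 0" "\<forall>x\<in>K z. \<forall>y\<in>K w. d \<le> dist x y"
        using separate_compact_closed[OF cz K(1)[OF zw(2)] dz] by blast
      obtain N0 :: nat where N0: "1 / d < real N0" using reals_Archimedean2 by blast
      have "cell N x \<noteq> cell N y" if N: "N0 \<le> N" and x: "x \<in> K z" and y: "y \<in> K w" for N x y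
      proof
        assume eq: "cell N x = cell N y"
        have "1 / d < real N" using N0 N by linarith
        moreover from this have Npos: "N > 0" using d by (auto intro: gr0I)
        ultimately have N1: "1 / real N < d" using d by (simp add: field_simps)
        have "0 \<le> x" "0 \<le> y" using x y K(2)[OF zw(1)] K(2)[OF zw(2)] S01[of z] S01[of w] by force+
        then have "\<bar>x - y\<bar> < 1 / real N"
          using cell_eq_iff[OF Npos, of x "cell N x"] cell_eq_iff[OF Npos, of y "cell N x"] eq
          by (auto simp: add_divide_distrib abs_if)
        then show False using N1 d(2) x y by (fastforce simp: dist_real_def)
      qed
      then show "\<forall>\<^sub>F N in sequentially. \<forall>x\<in>K (fst p). \<forall>y\<in>K (snd p). cell N x \<noteq> cell N y"
        unfolding eventually_sequentially p by auto
    qed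
  qed
  then obtain N0 where "\<forall>N\<ge>N0. \<forall>p\<in>{p \<in> Z \<times> Z. fst p \<noteq> snd p}. \<forall>x\<in>K (fst p). \<forall>y\<in>K (snd p). cell N x \<noteq> cell N y"
    unfolding eventually_sequentially by blast
  then have N0: "cell N x \<noteq> cell N y"
    if "N \<ge> N0" "z \<in> Z" "w \<in> Z" "z \<noteq> w" "x \<in> K z" "y \<in> K w" for N z w x y
    using that by (auto dest!: spec[of _ N] bspec[of _ _ "(z, w)"])
  show ?thesis
  proof (intro exI[of _ N0] allI impI)
    fix N assume N: "N \<ge> N0"
    \<comment> \<open>For \<open>N \<ge> N0\<close> at most one colour has a point of its compact
      subset in cell \<open>k\<close>; a cell that meets none of these subsets gets an arbitrary
      colour.\<close>
    define c' where "c' k = (if \<exists>z\<in>Z. \<exists>x\<in>K z. cell N x = k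
      then (SOME z. z \<in> Z \<and> (\<exists>x\<in>K z. cell N x = k)) else (SOME z. z \<in> Z))" for k
    define E where "E = (\<Union>z\<in>Z. S z - K z)"
    have c'Z: "c' k \<in> Z" for k
    proof (cases "\<exists>z\<in>Z. \<exists>x\<in>K z. cell N x = k")
      case True
      then have "\<exists>z. z \<in> Z \<and> (\<exists>x\<in>K z. cell N x = k)" by blast
      from someI_ex[OF this] show ?thesis using True by (simp add: c'_def)
    next
      case False
      then show ?thesis using ZZ by (auto simp: c'_def some_in_eq)
    qed
    have "c x = c' (cell N x)" if x: "x \<in> {0..1} - E" for x
    proof -
      have xz: "c x \<in> Z" "x \<in> K (c x)" using x cZ by (auto simp: E_def S_def)
      then have ex: "\<exists>z\<in>Z. \<exists>y\<in>K z. cell N y = cell N x" by blast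
      then have "\<exists>z. z \<in> Z \<and> (\<exists>y\<in>K z. cell N y = cell N x)" by blast
      from someI_ex[OF this] obtain y where y: "c' (cell N x) \<in> Z" "y \<in> K (c' (cell N x))" "cell N y = cell N x"
        using ex by (auto simp: c'_def)
      then show ?thesis using N0[OF N xz(1) y(1) _ xz(2) y(2)] by metis
    qed
    moreover have "E \<in> sets lebesgue" unfolding E_def
      using K(3) by (intro sets.finite_UN Z) (auto simp: fmeasurable_def)
    moreover have "E \<subseteq> {0..1}" using S01 by (auto simp: E_def)
    moreover have "measure lebesgue E \<le> \<eta>"
    proof -
      have "measure lebesgue E \<le> (\<Sum>z\<in>Z. measure lebesgue (S z - K z))"
        unfolding E_def by (rule measure_UNION_le[OF Z]) (use K(3) in \<open>auto simp: fmeasurable_def\<close>)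
      also have "\<dots> \<le> (\<Sum>z\<in>Z. \<eta> / card Z)" using K(4) by (intro sum_mono)
      also have "\<dots> = \<eta>" using cardZ by simp
      finally show ?thesis .
    qed
    ultimately show "\<exists>c' E. (\<forall>k. c' k \<in> Z) \<and> E \<in> sets lebesgue \<and> E \<subseteq> {0..1} \<and>
      measure lebesgue E \<le> \<eta> \<and> (\<forall>x\<in>{0..1} - E. c x = c' (cell N x))"
      using c'Z by blast
  qed
qed

text \<open>After sorting, position \<open>i\<close> is occupied by cell \<open>xs ! i\<close>. The
  permutation sought sends a cell to its position, so it is the inverse of this listing. Colours are
  numbers here in order to be comparable.\<close>

lemma sorting_permutation:
  fixes c :: "nat \<Rightarrow> nat"
  obtains \<pi> s where "bij_betw \<pi> {..<N} {..<N}" "\<And>k. k < N \<Longrightarrow> c k = s (\<pi> k)"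
    "\<And>i j. i \<le> j \<Longrightarrow> j < N \<Longrightarrow> s i \<le> s j" "\<And>i. i < N \<Longrightarrow> s i \<in> c ` {..<N}"
proof -
  define xs where "xs = sort_key c [0..<N]"
  have len: "length xs = N" and set: "set xs = {..<N}" and dist: "distinct xs"
    by (auto simp: xs_def atLeast0LessThan)
  have srt: "sorted (map c xs)" by (simp add: xs_def)
  have bij: "bij_betw (\<lambda>i. xs ! i) {..<N} {..<N}"
    using bij_betw_nth[OF dist] len set by blast
  define \<pi> where "\<pi> = inv_into {..<N} (\<lambda>i. xs ! i)"
  show thesis
  proof (rule that[of \<pi> "\<lambda>i. c (xs ! i)"])
    show "bij_betw \<pi> {..<N} {..<N}" unfolding \<pi>_def by (rule bij_betw_inv_into[OF bij])
    show "c k = c (xs ! \<pi> k)" if "k < N" for k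
      unfolding \<pi>_def using bij_betw_inv_into_right[OF bij, of k] that by simp
    show "c (xs ! i) \<le> c (xs ! j)" if "i \<le> j" "j < N" for i j
      using sorted_nth_mono[OF srt, of i j] that len by simp
    show "c (xs ! i) \<in> c ` {..<N}" if "i < N" for i
      using bij that by (auto simp: bij_betw_def)
  qed
qed

text \<open>A block on which \<open>s\<close> is not constant is determined by the value of \<open>s\<close> at its first point.\<close>

lemma card_nonconstant_blocks:
  fixes s :: "nat \<Rightarrow> nat"
  assumes mono: "\<And>i j. i \<le> j \<Longrightarrow> j < m * n \<Longrightarrow> s i \<le> s j"
    and bd: "\<And>i. i < m * n \<Longrightarrow> s i < k"
  shows "card {i. i < m * n \<and> s i \<noteq> s (i div n * n)} \<le> k * n"
proof (cases "n = 0")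
  case False
  define B where "B = {b. b < m \<and> (\<exists>i<m*n. i div n = b \<and> s i \<noteq> s (b * n))}"
  have "inj_on (\<lambda>b. s (b * n)) B"
  proof (rule linorder_inj_onI)
    fix b b' assume b: "b < b'" "b \<in> B" "b' \<in> B"
    then obtain i where i: "i < m * n" "i div n = b" "s i \<noteq> s (b * n)" by (auto simp: B_def)
    have "b * n \<le> i" using i(2) by (metis div_times_less_eq_dividend)
    then have "s (b * n) < s i" using mono[of "b * n" i] i by simp
    moreover have "i \<le> b' * n"
    proof -
      have "i div n < b'" using i b by simp
      then have "i < b' * n" using False by (simp add: div_less_iff_less_mult)
      then show ?thesis by simp
    qed
    moreover have "b' * n < m * n" using b False by (simp add: B_def)
    ultimately show "s (b * n) \<noteq> s (b' * n)" using mono[of i "b' * n"] by simp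
  qed auto
  moreover have "(\<lambda>b. s (b * n)) ` B \<subseteq> {..<k}" using bd False by (auto simp: B_def)
  ultimately have cB: "card B \<le> k" using card_inj_on_le[of _ B "{..<k}"] by simp
  have fB: "finite B" by (simp add: B_def)
  have "{i. i < m * n \<and> s i \<noteq> s (i div n * n)} \<subseteq> (\<Union>b\<in>B. {b * n..<b * n + n})"
  proof
    fix i assume "i \<in> {i. i < m * n \<and> s i \<noteq> s (i div n * n)}"
    then have i: "i < m * n" "s i \<noteq> s (i div n * n)" by auto
    have "i div n < m" using i False by (simp add: div_less_iff_less_mult)
    then have "i div n \<in> B" using i by (auto simp: B_def)
    moreover have "i \<in> {i div n * n..<i div n * n + n}"
      using False dividend_less_div_times[of n i] by (simp add: div_times_less_eq_dividend)
    ultimately show "i \<in> (\<Union>b\<in>B. {b * n..<b * n + n})" by blast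
  qed
  then have "card {i. i < m * n \<and> s i \<noteq> s (i div n * n)} \<le> card (\<Union>b\<in>B. {b * n..<b * n + n})"
    using fB by (intro card_mono) auto
  also have "\<dots> \<le> (\<Sum>b\<in>B. card {b * n..<b * n + n})" by (rule card_UN_le[OF fB])
  also have "\<dots> = card B * n" by simp
  also have "\<dots> \<le> k * n" using cB by simp
  finally show ?thesis .
qed simp

lemma cell_div:
  assumes "m > 0" "n > 0" "0 \<le> y"
  shows "cell m y = cell (m * n) y div n"
proof -
  define i where "i = cell (m * n) y"
  define b where "b = i div n"
  have i: "real i / real (m * n) \<le> y" "y < (real i + 1) / real (m * n)"
    using cell_eq_iff[of "m * n" y i] assms by (auto simp: i_def)
  have b: "b * n \<le> i" "i + 1 \<le> (b + 1) * n"
    using dividend_less_div_times[of n i] assms(2) by (simp_all add: b_def div_times_less_eq_dividend)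
  have "real b / real m = real (b * n) / real (m * n)" using assms by simp
  also have "\<dots> \<le> real i / real (m * n)" using b(1) by (intro divide_right_mono) (auto simp flip: of_nat_mult)
  finally have l: "real b / real m \<le> y" using i by simp
  have "(real i + 1) / real (m * n) \<le> real ((b + 1) * n) / real (m * n)"
    using b(2) by (intro divide_right_mono) (simp_all flip: of_nat_mult of_nat_Suc)
  also have "\<dots> = (real b + 1) / real m" using assms by (simp add: field_simps)
  finally have "y < (real b + 1) / real m" using i by simp
  with l show ?thesis using cell_eq_iff[of m y b] assms by (simp add: b_def i_def)
qed

text \<open>\<open>m\<close> is fixed before the colouring and depends on \<open>card Z\<close> and
  \<open>\<eta>\<close> alone; this uniformity is what makes the net finite. After sorting at most
  \<open>card Z\<close> of the \<open>m\<close> blocks are not constant, and each has measure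
  \<open>1/m\<close>, which costs half of \<open>\<eta>\<close>; the approximation by cells costs
  the other half.\<close>

lemma rearrangement_to_uniform_steps:
  fixes Z :: "'z set"
  assumes Z: "finite Z" and \<eta>: "\<eta> > 0"
  obtains m where "m > 0" "\<And>c. \<lbrakk>\<And>x. x \<in> {0..1} \<Longrightarrow> c x \<in> Z; \<And>z. z \<in> Z \<Longrightarrow> {x\<in>{0..1}. c x = z} \<in> sets lebesgue\<rbrakk> \<Longrightarrow>
    \<exists>\<tau>\<in>MPB. \<exists>e E. (\<forall>b. e b \<in> Z) \<and> E \<in> sets lebesgue \<and> E \<subseteq> {0..1} \<and>
      measure lebesgue E \<le> \<eta> \<and> (\<forall>x\<in>{0..1} - E. c x = e (cell m (\<tau> x)))"
proof -
  obtain m :: nat where m0: "2 * real (card Z) / \<eta> < real m" using reals_Archimedean2 by blast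
  moreover have "0 \<le> 2 * real (card Z) / \<eta>" using \<eta> by simp
  ultimately have "0 < real m" by linarith
  then have m: "m > 0" by simp
  have km: "real (card Z) / m \<le> \<eta> / 2" using m0 \<eta> m by (simp add: field_simps)
  show thesis
  proof (rule that[OF m])
    fix c assume cZ: "\<And>x. x \<in> {0..1::real} \<Longrightarrow> c x \<in> Z"
      and meas: "\<And>z. z \<in> Z \<Longrightarrow> {x\<in>{0..1}. c x = z} \<in> sets lebesgue"
    have "c 0 \<in> Z" using cZ by simp
    then have k0: "card Z > 0" using Z card_gt_0_iff by blast
    obtain h where h: "bij_betw h {0..<card Z} Z" using ex_bij_betw_nat_finite[OF Z] by blast
    define h' where "h' = inv_into {0..<card Z} h"
    have h'l: "h' z < card Z" and hh': "h (h' z) = z" if "z \<in> Z" for z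
      using bij_betw_inv_into_right[OF h that] bij_betw_apply[OF bij_betw_inv_into[OF h] that]
      by (auto simp: h'_def)
    obtain N0 where N0: "\<And>N. N \<ge> N0 \<Longrightarrow> \<exists>c' E. (\<forall>k. c' k \<in> Z) \<and> E \<in> sets lebesgue \<and> E \<subseteq> {0..1} \<and>
      measure lebesgue E \<le> \<eta> / 2 \<and> (\<forall>x\<in>{0..1} - E. c x = c' (cell N x))"
      using step_approximation[OF Z half_gt_zero[OF \<eta>] cZ meas] by blast
    define n where "n = Suc N0"
    \<comment> \<open>A multiple of \<open>m\<close>, so that a block of length \<open>1/m\<close>
      consists of exactly \<open>n\<close> cells of length \<open>1/N\<close>.\<close>
    define N where "N = m * n"
    have n: "n > 0" and N: "N > 0" using m by (auto simp: n_def N_def)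
    have "N \<ge> N0" using m by (cases m) (auto simp: N_def n_def)
    from N0[OF this] obtain c' E where c'Z: "\<And>k. c' k \<in> Z" and E: "E \<in> sets lebesgue" "E \<subseteq> {0..1}"
      "measure lebesgue E \<le> \<eta> / 2" and cc': "\<And>x. x \<in> {0..1} - E \<Longrightarrow> c x = c' (cell N x)"
      by blast
    obtain \<pi> s where \<pi>: "bij_betw \<pi> {..<N} {..<N}" and cs: "\<And>k. k < N \<Longrightarrow> h' (c' k) = s (\<pi> k)"
      and mono: "\<And>i j. i \<le> j \<Longrightarrow> j < N \<Longrightarrow> s i \<le> s j"
      and s: "\<And>i. i < N \<Longrightarrow> s i \<in> (\<lambda>k. h' (c' k)) ` {..<N}"
      using sorting_permutation[of N "\<lambda>k. h' (c' k)"] by blast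
    have sZ: "s i < card Z" if "i < N" for i using s[OF that] h'l[OF c'Z] by auto
    have \<pi>N: "\<pi> ` {..<N} \<subseteq> {..<N}" using \<pi> by (simp add: bij_betw_def)
    \<comment> \<open>The cells whose position after sorting lies in a block whose first position,
      \<open>\<pi> k div n * n\<close>, carries another colour.\<close>
    define B where "B = {k. k < N \<and> s (\<pi> k) \<noteq> s (\<pi> k div n * n)}"
    have fB: "finite B" by (simp add: B_def)
    have BN: "B \<subseteq> {..<N}" by (auto simp: B_def)
    have "card B = card (\<pi> ` B)"
      using card_image[OF inj_on_subset[OF bij_betw_imp_inj_on[OF \<pi>] BN]] by simp
    also have "\<dots> \<le> card {i. i < m * n \<and> s i \<noteq> s (i div n * n)}"
    proof (rule card_mono)
      show "\<pi> ` B \<subseteq> {i. i < m * n \<and> s i \<noteq> s (i div n * n)}"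
      proof
        fix i assume "i \<in> \<pi> ` B"
        then obtain k where k: "k \<in> B" "i = \<pi> k" by blast
        then have "\<pi> k \<in> {..<N}" using BN \<pi>N by blast
        then show "i \<in> {i. i < m * n \<and> s i \<noteq> s (i div n * n)}"
          using k by (simp add: B_def N_def)
      qed
    qed simp
    also have "\<dots> \<le> card Z * n"
      by (rule card_nonconstant_blocks[OF mono[unfolded N_def] sZ[unfolded N_def]])
    finally have cB: "card B \<le> card Z * n" .
    define J where "J k = {real k / N..<(real k + 1) / N} \<inter> {0..1}" for k
    \<comment> \<open>The point 1 is exceptional because its cell index \<open>N\<close> lies
      outside the domain \<open>{..<N}\<close> of the permutation.\<close>
    define F where "F = E \<union> {1} \<union> (\<Union>k\<in>B. J k)"
    have Jm: "J k \<in> lmeasurable" for k unfolding J_def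
      by (rule bounded_set_imp_lmeasurable) (auto intro!: bounded_Int)
    have mJ: "measure lebesgue (J k) \<le> 1 / N" for k
    proof -
      have "measure lebesgue (J k) \<le> measure lebesgue {real k / N..(real k + 1) / N}"
        by (intro measure_mono_fmeasurable fmeasurableD[OF Jm] lmeasurable_interval)
          (auto simp: J_def)
      also have "\<dots> = 1 / N" by (simp add: add_divide_distrib divide_right_mono)
      finally show ?thesis .
    qed
    have "measure lebesgue (\<Union>k\<in>B. J k) \<le> (\<Sum>k\<in>B. measure lebesgue (J k))"
      by (rule measure_UNION_le[OF fB]) (use Jm in \<open>auto simp: fmeasurable_def\<close>)
    also have "\<dots> \<le> (\<Sum>k\<in>B. 1 / N)" by (intro sum_mono mJ)
    also have "\<dots> \<le> real (card Z * n) / N" using cB by (simp add: divide_right_mono flip: of_nat_mult)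
    also have "\<dots> = real (card Z) / m" using n by (simp add: N_def)
    finally have mB: "measure lebesgue (\<Union>k\<in>B. J k) \<le> \<eta> / 2" using km by linarith
    have UJ: "(\<Union>k\<in>B. J k) \<in> lmeasurable" using Jm fB by (intro fmeasurable.finite_UN) auto
    have one: "{1::real} \<in> sets lebesgue" by (rule negligible_imp_sets[OF negligible_sing])
    have E1: "E \<union> {1} \<in> sets lebesgue" by (rule sets.Un[OF E(1) one])
    have "measure lebesgue F \<le> measure lebesgue (E \<union> {1}) + measure lebesgue (\<Union>k\<in>B. J k)"
      unfolding F_def by (rule measure_Un_le[OF E1 fmeasurableD[OF UJ]])
    moreover have "measure lebesgue (E \<union> {1}) \<le> measure lebesgue E + measure lebesgue {1::real}"
      by (rule measure_Un_le[OF E(1) one])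
    moreover have "measure lebesgue {1::real} = 0" by simp
    ultimately have mF: "measure lebesgue F \<le> \<eta>" using mB E(3) by linarith
    have FL: "F \<in> sets lebesgue" unfolding F_def by (rule sets.Un[OF E1 fmeasurableD[OF UJ]])
    have F01: "F \<subseteq> {0..1}" using E by (auto simp: F_def J_def)
    \<comment> \<open>\<open>e\<close> must take values in \<open>Z\<close> at every index; beyond
      the last block the filler is \<open>h 0\<close>, which lies in \<open>Z\<close> because
      \<open>Z\<close> is nonempty.\<close>
    define e where "e b = (if b < m then h (s (b * n)) else h 0)" for b
    have eZ: "e b \<in> Z" for b
    proof -
      have "s (b * n) \<in> {0..<card Z}" if "b < m" using sZ[of "b * n"] that n by (simp add: N_def)
      then show ?thesis using bij_betw_apply[OF h] k0 by (simp add: e_def)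
    qed
    have "c x = e (cell m (cell_exchange N \<pi> x))" if x: "x \<in> {0..1} - F" for x
    proof -
      have x1: "0 \<le> x" "x < 1" using x by (auto simp: F_def)
      define k where "k = cell N x"
      have k: "k < N" using cell_less[OF N x1] by (simp add: k_def)
      have "x \<in> J k" using cell_eq_iff[OF N x1(1), of k] x1 by (simp add: J_def k_def)
      then have "k \<notin> B" using x by (auto simp: F_def)
      then have sk: "s (\<pi> k) = s (\<pi> k div n * n)" using k by (simp add: B_def)
      note X = cell_exchange[OF N \<pi>N x1]
      have cm: "cell m (cell_exchange N \<pi> x) = \<pi> k div n"
        using cell_div[OF m n X(1)] X(3) by (simp add: N_def k_def)
      have "cell m (cell_exchange N \<pi> x) < m" using cell_less[OF m X(1,2)] .
      then have "e (cell m (cell_exchange N \<pi> x)) = h (s (\<pi> k div n * n))" by (simp add: e_def cm)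
      also have "\<dots> = h (h' (c' k))" using sk cs[OF k] by simp
      also have "\<dots> = c' k" using hh'[OF c'Z] .
      also have "\<dots> = c x" using cc'[of x] x by (auto simp: k_def F_def)
      finally show ?thesis by simp
    qed
    then show "\<exists>\<tau>\<in>MPB. \<exists>e E. (\<forall>b. e b \<in> Z) \<and> E \<in> sets lebesgue \<and> E \<subseteq> {0..1} \<and>
      measure lebesgue E \<le> \<eta> \<and> (\<forall>x\<in>{0..1} - E. c x = e (cell m (\<tau> x)))"
      using cell_exchange_in_bijections[OF N \<pi>] eZ FL F01 mF
      by (intro bexI[of _ "cell_exchange N \<pi>"] exI[of _ e] exI[of _ F]) auto
  qed
qed

section \<open>The group of measure preserving bijections and the unit cube\<close>

text \<open>\<open>MPB\<close> is defined through images. As \<open>\<tau>\<close> maps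
  \<open>[0,1]\<close> onto itself, a measurable set is the image of its preimage, and since
  measurability is reflected the preimage is measurable.\<close>

lemma bijections_measurable:
  assumes "\<tau> \<in> MPB"
  shows "\<tau> \<in> measurable unit_interval unit_interval" "distr unit_interval unit_interval \<tau> = unit_interval"
proof -
  have surj: "\<tau> ` {0..1} = {0..1}"
    and m: "\<And>A. A \<subseteq> {0..1} \<Longrightarrow> \<tau> ` A \<in> sets unit_interval \<longleftrightarrow> A \<in> sets unit_interval"
    and e: "\<And>A. A \<in> sets unit_interval \<Longrightarrow> emeasure unit_interval (\<tau> ` A) = emeasure unit_interval A"
    using assms by (auto simp: measure_preserving_bijections_def bij_betw_def)
  have pre: "\<tau> ` (\<tau> -` A \<inter> {0..1}) = A" if "A \<in> sets unit_interval" for A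
    using that surj by (fastforce simp: sets_unit_interval_iff)
  have pm: "\<tau> -` A \<inter> {0..1} \<in> sets unit_interval" if "A \<in> sets unit_interval" for A
    using m[of "\<tau> -` A \<inter> {0..1}"] pre[OF that] that by simp
  show meas: "\<tau> \<in> measurable unit_interval unit_interval"
    using surj pm by (intro measurableI) auto
  show "distr unit_interval unit_interval \<tau> = unit_interval"
  proof (rule measure_eqI)
    fix A assume "A \<in> sets (distr unit_interval unit_interval \<tau>)"
    then have A: "A \<in> sets unit_interval" by simp
    then show "emeasure (distr unit_interval unit_interval \<tau>) A = emeasure unit_interval A"
      using e[OF pm[OF A]] pre[OF A] by (simp add: emeasure_distr[OF meas A])
  qed simp
qed

lemma id_in_bijections: "id \<in> MPB"
  by (simp add: measure_preserving_bijections_def)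

lemma bijectionsD:
  assumes "\<tau> \<in> MPB"
  shows "bij_betw \<tau> {0..1} {0..1}"
    and "A \<subseteq> {0..1} \<Longrightarrow> \<tau> ` A \<subseteq> {0..1}"
    and "A \<subseteq> {0..1} \<Longrightarrow> \<tau> ` A \<in> sets unit_interval \<longleftrightarrow> A \<in> sets unit_interval"
    and "A \<in> sets unit_interval \<Longrightarrow> emeasure unit_interval (\<tau> ` A) = emeasure unit_interval A"
proof -
  show 1: "bij_betw \<tau> {0..1} {0..1}" using assms by (simp add: measure_preserving_bijections_def)
  show "A \<subseteq> {0..1} \<Longrightarrow> \<tau> ` A \<subseteq> {0..1}"
    using image_mono[of A "{0..1}" \<tau>] bij_betw_imp_surj_on[OF 1] by simp
qed (use assms in \<open>simp_all add: measure_preserving_bijections_def\<close>)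

lemma comp_in_bijections:
  assumes \<sigma>: "\<sigma> \<in> MPB" and \<tau>: "\<tau> \<in> MPB"
  shows "\<sigma> \<circ> \<tau> \<in> MPB"
  unfolding measure_preserving_bijections_def
proof (intro CollectI conjI allI impI ballI)
  show "bij_betw (\<sigma> \<circ> \<tau>) {0..1} {0..1}"
    by (rule bij_betw_trans[OF bijectionsD(1)[OF \<tau>] bijectionsD(1)[OF \<sigma>]])
  show "(\<sigma> \<circ> \<tau>) ` A \<in> sets unit_interval \<longleftrightarrow> A \<in> sets unit_interval" if "A \<subseteq> {0..1}" for A
    using bijectionsD(3)[OF \<sigma> bijectionsD(2)[OF \<tau> that]] bijectionsD(3)[OF \<tau> that]
    by (simp only: image_comp[symmetric])
  show "emeasure unit_interval ((\<sigma> \<circ> \<tau>) ` A) = emeasure unit_interval A"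
    if A: "A \<in> sets unit_interval" for A
  proof -
    have "A \<subseteq> {0..1}" using A by (simp add: sets_unit_interval_iff)
    then have "\<tau> ` A \<in> sets unit_interval" using bijectionsD(3)[OF \<tau>] A by blast
    then show ?thesis
      using bijectionsD(4)[OF \<sigma>] bijectionsD(4)[OF \<tau> A] by (simp only: image_comp[symmetric])
  qed
qed

lemma inv_in_bijections:
  assumes "\<tau> \<in> MPB"
  shows "inv_into {0..1} \<tau> \<in> MPB"
proof -
  let ?\<sigma> = "inv_into {0..1} \<tau>"
  note bij = bijectionsD(1)[OF assms] and m = bijectionsD(3)[OF assms] and e = bijectionsD(4)[OF assms]
  have bij': "bij_betw ?\<sigma> {0..1} {0..1}" using bij by (rule bij_betw_inv_into)
  have sub: "?\<sigma> ` A \<subseteq> {0..1}" and can: "\<tau> ` ?\<sigma> ` A = A" if "A \<subseteq> {0..1}" for A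
    using bij bij' that image_inv_into_cancel[of \<tau> "{0..1}" "{0..1}" A] image_mono[OF that, of ?\<sigma>]
    by (simp_all add: bij_betw_def)
  have im: "?\<sigma> ` A \<in> sets unit_interval \<longleftrightarrow> A \<in> sets unit_interval" if "A \<subseteq> {0..1}" for A
    using m[OF sub[OF that]] can[OF that] by simp
  have "emeasure unit_interval (?\<sigma> ` A) = emeasure unit_interval A" if "A \<in> sets unit_interval" for A
  proof -
    have A: "A \<subseteq> {0..1}" using that by (simp add: sets_unit_interval_iff)
    show ?thesis using e[of "?\<sigma> ` A"] im[OF A] can[OF A] that by simp
  qed
  then show ?thesis using bij' im by (simp add: measure_preserving_bijections_def)
qed

section \<open>The unit cube, tensor products and unit balls\<close>

lemma space_unit_cube: "space (unit_cube l) = PiE {..<l} (\<lambda>_. {0..1})"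
  by (simp add: unit_cube_def space_PiM)

lemma prob_space_unit_interval: "prob_space unit_interval"
  by (rule prob_spaceI) (simp add: emeasure_restrict_space)

lemma prob_space_unit_cube: "prob_space (unit_cube l)"
  unfolding unit_cube_def
  by (intro prob_space.prob_space_completion prob_space_PiM prob_space_unit_interval)

lemma measurable_unit_cube_component [measurable]:
  "i < l \<Longrightarrow> (\<lambda>x. x i) \<in> measurable (unit_cube l) unit_interval"
  unfolding unit_cube_def by (intro measurable_completion measurable_component_singleton) simp

text \<open>The coordinatewise map preserves the product measure. This passes to the completion
  because preimages of null sets are then null sets.\<close>

lemma unit_cube_map:
  assumes \<sigma>: "\<sigma> \<in> measurable unit_interval unit_interval" "distr unit_interval unit_interval \<sigma> = unit_interval"
  shows "compose {..<l} \<sigma> \<in> measurable (unit_cube l) (unit_cube l)" (is ?m)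
    and "distr (unit_cube l) (unit_cube l) (compose {..<l} \<sigma>) = unit_cube l" (is ?d)
proof -
  define P where "P = PiM {..<l} (\<lambda>_. unit_interval)"
  define X where "X = compose {..<l} \<sigma>"
  have C: "unit_cube l = completion P" by (simp add: unit_cube_def P_def)
  have X: "X \<in> measurable P P"
    unfolding X_def P_def compose_def
    by (rule measurable_restrict,
        rule measurable_compose[OF measurable_component_singleton[where M = "\<lambda>_. unit_interval"] \<sigma>(1)])
  have dP: "distr P P X = P"
    unfolding X_def P_def
    by (subst distr_PiM_finite_prob_space') (simp_all add: \<sigma> prob_space_unit_interval)
  have dC: "distr (completion P) P X = P" by (subst distr_completion[OF X]) (rule dP)
  note X' = measurable_completion[OF X]
  have "X \<in> measurable (completion P) (completion P)"
    by (rule completion.measurable_completion2[OF X']) (simp add: dC)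
  then show ?m by (simp add: C X_def)
  have "completion P = distr (completion P) (completion P) X"
    using completion.completion_distr_eq[OF X'] by (simp add: dC)
  then show ?d by (simp add: C X_def)
qed

definition tensor :: "nat \<Rightarrow> (nat \<Rightarrow> real \<Rightarrow> 'a) \<Rightarrow> 'a::comm_monoid_mult cube_fun" where
  "tensor l r x = (\<Prod>i<l. r i (x i))"

lemma tensor_set_eq: "tensor_set q l = {tensor l r | r. \<forall>i<l. r i \<in> Lp_ball unit_interval q}"
  by (simp add: tensor_set_def tensor_def[abs_def])

lemma borel_measurable_tensor:
  fixes r :: "nat \<Rightarrow> real \<Rightarrow> 'a::{real_normed_field,banach,second_countable_topology}"
  assumes "\<And>i. i < l \<Longrightarrow> r i \<in> borel_measurable unit_interval"
  shows "tensor l r \<in> borel_measurable (unit_cube l)"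
  unfolding tensor_def[abs_def]
  by (intro borel_measurable_prod measurable_compose[OF measurable_unit_cube_component] assms) auto

lemma
  fixes f :: "nat \<Rightarrow> real \<Rightarrow> 'a::{real_normed_field,banach,second_countable_topology}"
  assumes f: "\<And>i. i < l \<Longrightarrow> integrable unit_interval (f i)"
  shows integrable_tensor: "integrable (unit_cube l) (tensor l f)"
    and integral_tensor: "(\<integral>x. tensor l f x \<partial>unit_cube l) = (\<Prod>i<l. \<integral>x. f i x \<partial>unit_interval)"
proof -
  define P where "P = PiM {..<l} (\<lambda>_. unit_interval)"
  interpret product_sigma_finite "\<lambda>_. unit_interval"
    using prob_space_unit_interval
    by (simp add: product_sigma_finite_def prob_space_imp_sigma_finite)
  have C: "unit_cube l = completion P" by (simp add: unit_cube_def P_def)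
  have t: "tensor l f = (\<lambda>x. \<Prod>i\<in>{..<l}. f i (x i))" by (simp add: tensor_def[abs_def])
  have i: "integrable P (tensor l f)"
    unfolding t P_def by (rule product_integrable_prod) (use f in auto)
  then show "integrable (unit_cube l) (tensor l f)"
    unfolding C by (subst integrable_completion) auto
  have "(\<integral>x. tensor l f x \<partial>unit_cube l) = (\<integral>x. tensor l f x \<partial>P)"
    unfolding C using i by (intro integral_completion) auto
  also have "\<dots> = (\<Prod>i<l. \<integral>x. f i x \<partial>unit_interval)"
    unfolding t P_def by (rule product_integral_prod) (use f in auto)
  finally show "(\<integral>x. tensor l f x \<partial>unit_cube l) = (\<Prod>i<l. \<integral>x. f i x \<partial>unit_interval)" .
qed

lemma
  fixes g :: "real \<Rightarrow> real"
  assumes i: "i < l" and g: "integrable unit_interval g"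
  shows integrable_component: "integrable (unit_cube l) (\<lambda>x. g (x i))"
    and integral_component: "(\<integral>x. g (x i) \<partial>unit_cube l) = (\<integral>x. g x \<partial>unit_interval)"
proof -
  interpret U: prob_space unit_interval by (rule prob_space_unit_interval)
  \<comment> \<open>The tensor product with \<open>g\<close> in place \<open>i\<close> and 1
    elsewhere; the other factors integrate to 1.\<close>
  define f where "f j = (if j = i then g else (\<lambda>_. 1))" for j
  have f: "integrable unit_interval (f j)" for j using g by (simp add: f_def)
  have t: "tensor l f = (\<lambda>x. g (x i))"
  proof
    fix x
    have "(\<Prod>j<l. f j (x j)) = (\<Prod>j<l. if j = i then g (x i) else 1)"
      by (intro prod.cong) (auto simp: f_def)
    then show "tensor l f x = g (x i)" using i by (simp add: tensor_def)
  qed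
  have u1: "measure unit_interval {0..1} = 1" using U.prob_space by simp
  have "(\<Prod>j<l. \<integral>x. f j x \<partial>unit_interval) = (\<Prod>j<l. if j = i then \<integral>x. g x \<partial>unit_interval else 1)"
    by (intro prod.cong) (auto simp: f_def u1)
  then show "(\<integral>x. g (x i) \<partial>unit_cube l) = (\<integral>x. g x \<partial>unit_interval)"
    using integral_tensor[of l f] f t i by simp
  show "integrable (unit_cube l) (\<lambda>x. g (x i))" using integrable_tensor[of l f] f t by simp
qed

lemma Lp_ball_infinity:
  fixes f :: "'x \<Rightarrow> 'a::real_normed_vector"
  shows "f \<in> Lp_ball M \<infinity> \<longleftrightarrow> f \<in> borel_measurable M \<and> (AE x in M. norm (f x) \<le> 1)"
proof (cases "f \<in> borel_measurable M")
  case True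
  let ?e = "esssup M (\<lambda>x. ereal (norm (f x)))"
  have m: "(\<lambda>x. ereal (norm (f x))) \<in> borel_measurable M" using True by measurable
  \<comment> \<open>\<open>real_of_ereal\<close> sends both infinities to 0, so it is the first
    conjunct that rules out an essentially unbounded \<open>f\<close>.\<close>
  have "?e < \<infinity> \<and> real_of_ereal ?e \<le> 1 \<longleftrightarrow> ?e \<le> 1"
    by (cases ?e) (auto simp: one_ereal_def)
  also have "\<dots> \<longleftrightarrow> (AE x in M. norm (f x) \<le> 1)"
  proof
    assume "?e \<le> 1"
    then show "AE x in M. norm (f x) \<le> 1"
      using esssup_AE[of "\<lambda>x. ereal (norm (f x))" M]
      by (auto elim!: eventually_mono simp: one_ereal_def dest: order_trans)
  next
    assume "AE x in M. norm (f x) \<le> 1"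
    then show "?e \<le> 1"
      by (intro esssup_I[OF m]) (simp add: one_ereal_def)
  qed
  finally show ?thesis using True by (simp add: Lp_ball_def Lp_space_def Lp_norm_def)
qed (simp add: Lp_ball_def Lp_space_def)

lemma Lp_ball_finite:
  fixes f :: "'x \<Rightarrow> 'a::real_normed_vector"
  assumes "P > 0"
  shows "f \<in> Lp_ball M (ennreal P) \<longleftrightarrow> f \<in> borel_measurable M \<and>
    integrable M (\<lambda>x. norm (f x) powr P) \<and> (\<integral>x. norm (f x) powr P \<partial>M) \<le> 1"
proof -
  have "I powr (1 / P) \<le> 1 \<longleftrightarrow> I \<le> 1" if "0 \<le> I" for I :: real
  proof (cases "I \<le> 1")
    case True
    then show ?thesis using powr_le1[of "1 / P" I] that assms by simp
  next
    case False
    then have "1 < I powr (1 / P)" using assms by (intro gr_one_powr) auto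
    then show ?thesis using False by linarith
  qed
  moreover have "0 \<le> (\<integral>x. norm (f x) powr P \<partial>M)" by simp
  ultimately show ?thesis using assms by (auto simp: Lp_ball_def Lp_space_def Lp_norm_def)
qed

section \<open>Tensor products against \<open>L\<^sup>p\<close> functions\<close>

text \<open>Bounding the sum by twice the larger norm gives a crude substitute for Minkowski's
  inequality. It serves where membership in the space and some uniform bound are all that matters;
  the ball itself is handled by convexity.\<close>

lemma powr_norm_add_le:
  fixes a b :: "'a::real_normed_vector"
  assumes "P > 0"
  shows "norm (a + b) powr P \<le> 2 powr P * (norm a powr P + norm b powr P)"
proof -
  have "norm (a + b) \<le> 2 * max (norm a) (norm b)"
    using norm_triangle_ineq[of a b] by linarith
  then have "norm (a + b) powr P \<le> (2 * max (norm a) (norm b)) powr P"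
    using assms by (intro powr_mono2) auto
  also have "\<dots> = 2 powr P * max (norm a) (norm b) powr P" by (simp add: powr_mult)
  also have "max (norm a) (norm b) powr P \<le> norm a powr P + norm b powr P" by (auto simp: max_def)
  finally show ?thesis by simp
qed

lemma powr_le_one_plus_powr: "0 \<le> t \<Longrightarrow> 0 \<le> a \<Longrightarrow> a \<le> b \<Longrightarrow> t powr a \<le> 1 + t powr b" for t :: real
proof (cases "t \<le> 1")
  case True
  assume "0 \<le> t" "0 \<le> a"
  then have "t powr a \<le> 1" using True by (simp add: powr_le1)
  then show ?thesis using powr_ge_zero[of t b] by linarith
next
  case False
  assume "a \<le> b"
  then have "t powr a \<le> t powr b" using False by (intro powr_mono) auto
  then show ?thesis by simp
qed

lemma Lp_space_finite:
  "P > 0 \<Longrightarrow> f \<in> Lp_space M (ennreal P) \<longleftrightarrow> f \<in> borel_measurable M \<and> integrable M (\<lambda>x. norm (f x) powr P)"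
  by (simp add: Lp_space_def)

lemma Lp_space_add:
  fixes f g :: "'x \<Rightarrow> 'a::{real_normed_vector,second_countable_topology}"
  assumes P: "P > 0" and f: "f \<in> Lp_space M (ennreal P)" and g: "g \<in> Lp_space M (ennreal P)"
  shows "(\<lambda>x. f x + g x) \<in> Lp_space M (ennreal P)"
    and "(\<integral>x. norm (f x + g x) powr P \<partial>M) \<le>
      2 powr P * ((\<integral>x. norm (f x) powr P \<partial>M) + (\<integral>x. norm (g x) powr P \<partial>M))"
proof -
  have [measurable]: "f \<in> borel_measurable M" "g \<in> borel_measurable M"
    and i: "integrable M (\<lambda>x. norm (f x) powr P)" "integrable M (\<lambda>x. norm (g x) powr P)"
    using f g P by (auto simp: Lp_space_finite)
  have i2: "integrable M (\<lambda>x. 2 powr P * (norm (f x) powr P + norm (g x) powr P))"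
    using i by simp
  have i3: "integrable M (\<lambda>x. norm (f x + g x) powr P)"
    by (rule Bochner_Integration.integrable_bound[OF i2])
      (use powr_norm_add_le[OF P] in \<open>auto simp: abs_mult\<close>)
  then show "(\<lambda>x. f x + g x) \<in> Lp_space M (ennreal P)" using P by (simp add: Lp_space_finite)
  have "(\<integral>x. norm (f x + g x) powr P \<partial>M) \<le> (\<integral>x. 2 powr P * (norm (f x) powr P + norm (g x) powr P) \<partial>M)"
    using i2 i3 powr_norm_add_le[OF P] by (intro integral_mono) auto
  then show "(\<integral>x. norm (f x + g x) powr P \<partial>M) \<le>
      2 powr P * ((\<integral>x. norm (f x) powr P \<partial>M) + (\<integral>x. norm (g x) powr P \<partial>M))"
    using i by simp
qed

lemma Lp_space_diff:
  fixes f g :: "'x \<Rightarrow> 'a::{real_normed_vector,second_countable_topology}"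
  assumes P: "P > 0" and f: "f \<in> Lp_space M (ennreal P)" and g: "g \<in> Lp_space M (ennreal P)"
  shows "(\<lambda>x. f x - g x) \<in> Lp_space M (ennreal P)"
    and "(\<integral>x. norm (f x - g x) powr P \<partial>M) \<le>
      2 powr P * ((\<integral>x. norm (f x) powr P \<partial>M) + (\<integral>x. norm (g x) powr P \<partial>M))"
proof -
  have "(\<lambda>x. - g x) \<in> Lp_space M (ennreal P)" using g P by (simp add: Lp_space_finite)
  from Lp_space_add[OF P f this] show "(\<lambda>x. f x - g x) \<in> Lp_space M (ennreal P)"
    and "(\<integral>x. norm (f x - g x) powr P \<partial>M) \<le>
      2 powr P * ((\<integral>x. norm (f x) powr P \<partial>M) + (\<integral>x. norm (g x) powr P \<partial>M))"
    by simp_all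
qed

text \<open>On a probability space the \<open>L\<^sup>\<infinity>\<close> ball lies in every
  \<open>L\<^sup>t\<close> ball, so estimates for infinite exponents can be made at finite
  ones.\<close>

lemma ball_finite_exponent:
  fixes f :: "'x \<Rightarrow> 'a::real_normed_vector"
  assumes "prob_space M" and "s = ennreal t \<or> s = \<infinity>" and "0 < t" and "f \<in> Lp_ball M s"
  shows "f \<in> Lp_ball M (ennreal t)"
  using assms(2)
proof
  assume "s = \<infinity>"
  interpret prob_space M by fact
  have [measurable]: "f \<in> borel_measurable M" and ae: "AE x in M. norm (f x) \<le> 1"
    using assms \<open>s = \<infinity>\<close> Lp_ball_infinity by auto
  have le: "AE x in M. norm (f x) powr t \<le> 1"
    using ae by eventually_elim (use \<open>0 < t\<close> in \<open>simp add: powr_le1\<close>)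
  have i: "integrable M (\<lambda>x. norm (f x) powr t)"
    by (rule integrable_const_bound[of _ 1]) (use le in auto)
  have "(\<integral>x. norm (f x) powr t \<partial>M) \<le> (\<integral>x. 1 \<partial>M)"
    by (rule integral_mono_AE) (use i le in auto)
  then show ?thesis using i \<open>0 < t\<close> by (simp add: Lp_ball_finite prob_space)
qed (use assms in simp)

lemma norm_tensor_powr:
  fixes r :: "nat \<Rightarrow> real \<Rightarrow> 'a::real_normed_field"
  shows "norm (tensor l r x) powr s = tensor l (\<lambda>i x. norm (r i x) powr s) x"
  by (simp add: tensor_def prod_norm[symmetric] prod_powr_distrib)

lemma tensor_setE:
  fixes u :: "'a::{real_normed_field,banach,second_countable_topology} cube_fun"
  assumes "u \<in> tensor_set q l"
  obtains r where "u = tensor l r" "\<And>i. i < l \<Longrightarrow> r i \<in> Lp_ball unit_interval q"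
  using assms by (auto simp: tensor_set_eq)

lemma norm_tensor_le_1:
  fixes r :: "nat \<Rightarrow> real \<Rightarrow> 'a::real_normed_field"
  assumes "\<And>i. i < l \<Longrightarrow> norm (r i (x i)) \<le> 1"
  shows "norm (tensor l r x) \<le> 1"
  unfolding tensor_def prod_norm[symmetric] using assms by (intro prod_le_1) auto

text \<open>Finite stand-ins: \<open>P\<close> for \<open>p\<close>, its conjugate \<open>S\<close>,
  and \<open>Q\<close> for \<open>q\<close>. If \<open>p\<close> or \<open>q\<close> is infinite,
  \<open>P\<close> or \<open>Q\<close> may be chosen freely within the stated relations. The gap
  \<open>S < Q\<close> is where the strict inequality of the theorem enters.\<close>

locale exponents =
  fixes l :: nat and p q :: ennreal and P Q S :: real
  assumes P: "1 < P" and S: "1 < S" and conj: "1 / P + 1 / S = 1" and SQ: "S < Q"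
    and p: "p = ennreal P \<or> p = \<infinity>" and q: "q = ennreal Q \<or> q = \<infinity>"
begin

abbreviation "cube \<equiv> unit_cube l"

abbreviation LP :: "('a::{real_normed_field,banach,second_countable_topology} cube_fun) set" where
  "LP \<equiv> Lp_space cube (ennreal P)"

lemma ball_pD:
  fixes f :: "'a::{real_normed_field,banach,second_countable_topology} cube_fun"
  assumes "f \<in> Lp_ball cube p"
  shows "f \<in> LP" "(\<integral>x. norm (f x) powr P \<partial>cube) \<le> 1"
  using ball_finite_exponent[OF prob_space_unit_cube p _ assms] P
  by (auto simp: Lp_ball_finite Lp_space_finite)

lemma ball_qD:
  fixes r :: "real \<Rightarrow> 'a::{real_normed_field,banach,second_countable_topology}"
  assumes "r \<in> Lp_ball unit_interval q"
  shows "r \<in> borel_measurable unit_interval"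
    "integrable unit_interval (\<lambda>x. norm (r x) powr Q)" "(\<integral>x. norm (r x) powr Q \<partial>unit_interval) \<le> 1"
    "integrable unit_interval (\<lambda>x. norm (r x) powr S)" "(\<integral>x. norm (r x) powr S \<partial>unit_interval) \<le> 2"
proof -
  interpret prob_space unit_interval by (rule prob_space_unit_interval)
  have Q: "Q > 0" using S SQ by simp
  show [measurable]: "r \<in> borel_measurable unit_interval"
    and i: "integrable unit_interval (\<lambda>x. norm (r x) powr Q)" and I: "(\<integral>x. norm (r x) powr Q \<partial>unit_interval) \<le> 1"
    using ball_finite_exponent[OF prob_space_unit_interval q Q assms] Q by (auto simp: Lp_ball_finite)
  have le: "norm (r x) powr S \<le> 1 + norm (r x) powr Q" for x
    using S SQ by (intro powr_le_one_plus_powr) auto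
  have i1: "integrable unit_interval (\<lambda>x. 1 + norm (r x) powr Q)" using i by simp
  show iS: "integrable unit_interval (\<lambda>x. norm (r x) powr S)"
    by (rule Bochner_Integration.integrable_bound[OF i1]) (use le in auto)
  have "(\<integral>x. norm (r x) powr S \<partial>unit_interval) \<le> (\<integral>x. 1 + norm (r x) powr Q \<partial>unit_interval)"
    by (rule integral_mono[OF iS i1 le])
  also have "\<dots> = 1 + (\<integral>x. norm (r x) powr Q \<partial>unit_interval)"
    using prob_space by (subst Bochner_Integration.integral_add[OF _ i]) simp_all
  finally show "(\<integral>x. norm (r x) powr S \<partial>unit_interval) \<le> 2" using I by simp
qed

text \<open>Young's inequality for \<open>c * a\<close> and \<open>b / c\<close>, with the weights
  \<open>1 / P\<close> and \<open>1 / S\<close> bounded by 1. The free scale \<open>c\<close> allows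
  one term to be made small at once, at a price in the other term that a later choice pays.\<close>

lemma scaled_Young:
  assumes "0 < c" "0 \<le> a" "0 \<le> b"
  shows "a * b \<le> c powr P * a powr P + c powr (- S) * b powr S"
proof -
  have "a * b = (c * a) * (b / c)" using assms by simp
  also have "\<dots> \<le> (c * a) powr P / P + (b / c) powr S / S"
    using assms P S conj by (intro Youngs_inequality) auto
  also have "\<dots> \<le> (c * a) powr P + (b / c) powr S"
    using P S by (intro add_mono) (simp_all add: divide_le_eq mult_le_cancel_left1)
  also have "\<dots> = c powr P * a powr P + c powr (- S) * b powr S"
    using assms by (simp add: powr_mult powr_divide powr_minus_divide)
  finally show ?thesis .
qed

lemma tensor_powr_integral:
  fixes r :: "nat \<Rightarrow> real \<Rightarrow> 'a::{real_normed_field,banach,second_countable_topology}"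
  assumes r: "\<And>i. i < l \<Longrightarrow> r i \<in> Lp_ball unit_interval q"
  shows "integrable cube (\<lambda>x. norm (tensor l r x) powr S)"
    and "(\<integral>x. norm (tensor l r x) powr S \<partial>cube) \<le> 2 ^ l"
proof -
  note i = ball_qD(4,5)[OF r]
  show "integrable cube (\<lambda>x. norm (tensor l r x) powr S)"
    unfolding norm_tensor_powr by (rule integrable_tensor) (rule i)
  have "(\<integral>x. norm (tensor l r x) powr S \<partial>cube) = (\<Prod>i<l. \<integral>x. norm (r i x) powr S \<partial>unit_interval)"
    unfolding norm_tensor_powr by (rule integral_tensor) (rule i)
  also have "\<dots> \<le> (\<Prod>i<l. 2)" using i by (intro prod_mono) auto
  finally show "(\<integral>x. norm (tensor l r x) powr S \<partial>cube) \<le> 2 ^ l" by simp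
qed

lemma integral_pairing_le:
  fixes f g :: "'a::{real_normed_field,banach,second_countable_topology} cube_fun"
  assumes f: "f \<in> LP" and [measurable]: "g \<in> borel_measurable cube"
    and g: "integrable cube (\<lambda>x. norm (g x) powr S)" and c: "0 < c"
  shows "integrable cube (\<lambda>x. g x * f x)"
    and "norm (\<integral>x. g x * f x \<partial>cube) \<le>
      c powr P * (\<integral>x. norm (f x) powr P \<partial>cube) + c powr (- S) * (\<integral>x. norm (g x) powr S \<partial>cube)"
proof -
  have [measurable]: "f \<in> borel_measurable cube"
    and fi: "integrable cube (\<lambda>x. norm (f x) powr P)"
    using f P by (auto simp: Lp_space_finite)
  have i: "integrable cube (\<lambda>x. c powr P * norm (f x) powr P + c powr (- S) * norm (g x) powr S)"
    using fi g by simp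
  have le: "norm (g x * f x) \<le> c powr P * norm (f x) powr P + c powr (- S) * norm (g x) powr S" for x
    using scaled_Young[OF c, of "norm (f x)" "norm (g x)"] by (simp add: norm_mult mult.commute)
  show gf: "integrable cube (\<lambda>x. g x * f x)"
  proof (rule Bochner_Integration.integrable_bound[OF i])
    show "AE x in unit_cube l. norm (g x * f x) \<le> norm (c powr P * norm (f x) powr P + c powr (- S) * norm (g x) powr S)"
      using le by (intro AE_I2) (rule order_trans, auto)
  qed measurable
  have "norm (\<integral>x. g x * f x \<partial>cube) \<le> (\<integral>x. norm (g x * f x) \<partial>cube)"
    by (rule integral_norm_bound)
  also have "\<dots> \<le> (\<integral>x. c powr P * norm (f x) powr P + c powr (- S) * norm (g x) powr S \<partial>cube)"
    using gf i le by (intro integral_mono) auto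
  also have "\<dots> = c powr P * (\<integral>x. norm (f x) powr P \<partial>cube) + c powr (- S) * (\<integral>x. norm (g x) powr S \<partial>cube)"
    using fi g by simp
  finally show "norm (\<integral>x. g x * f x \<partial>cube) \<le>
      c powr P * (\<integral>x. norm (f x) powr P \<partial>cube) + c powr (- S) * (\<integral>x. norm (g x) powr S \<partial>cube)" .
qed

lemma pairing:
  fixes f u :: "'a::{real_normed_field,banach,second_countable_topology} cube_fun"
  assumes f: "f \<in> LP" and u: "u \<in> tensor_set q l"
  shows integrable_pairing: "integrable cube (\<lambda>x. u x * f x)"
    and pairing_bound: "norm (\<integral>x. u x * f x \<partial>cube) \<le> (\<integral>x. norm (f x) powr P \<partial>cube) + 2 ^ l"
proof -
  obtain r where r: "u = tensor l r" "\<And>i. i < l \<Longrightarrow> r i \<in> Lp_ball unit_interval q"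
    using tensor_setE[OF u] by metis
  have m: "u \<in> borel_measurable cube"
    unfolding r(1) by (intro borel_measurable_tensor ball_qD(1) r)
  note i = tensor_powr_integral[of r, OF r(2), folded r(1)]
  show "integrable cube (\<lambda>x. u x * f x)" by (rule integral_pairing_le[OF f m i(1) zero_less_one])
  show "norm (\<integral>x. u x * f x \<partial>cube) \<le> (\<integral>x. norm (f x) powr P \<partial>cube) + 2 ^ l"
    using integral_pairing_le(2)[OF f m i(1) zero_less_one] i(2) by simp
qed

section \<open>The \<open>R\<close>-norm as a seminorm, and its control by bounded factors\<close>

lemma tensor_set_nonempty:
  "tensor_set q l \<noteq> ({} :: ('a::{real_normed_field,banach,second_countable_topology} cube_fun) set)"
proof -
  have "(\<lambda>_. 0 :: 'a) \<in> Lp_ball unit_interval q"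
    using q S SQ by (auto simp: Lp_ball_infinity[unfolded infinity_ennreal_def] Lp_ball_finite)
  then have "tensor l (\<lambda>_ _. 0 :: 'a) \<in> tensor_set q l"
    unfolding tensor_set_eq by (intro CollectI exI[of _ "\<lambda>_ _. 0"]) simp
  then show ?thesis by blast
qed

lemma le_R_norm:
  fixes f u :: "'a::{real_normed_field,banach,second_countable_topology} cube_fun"
  assumes "f \<in> LP" "u \<in> tensor_set q l"
  shows "norm (\<integral>x. u x * f x \<partial>cube) \<le> R_norm q l f"
  unfolding R_norm_def using assms
  by (intro cSUP_upper bdd_aboveI2[where M = "(\<integral>x. norm (f x) powr P \<partial>cube) + 2 ^ l"])
    (auto intro: pairing_bound)

lemma R_norm_le:
  fixes f :: "'a::{real_normed_field,banach,second_countable_topology} cube_fun"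
  assumes "\<And>u. u \<in> tensor_set q l \<Longrightarrow> norm (\<integral>x. u x * f x \<partial>cube) \<le> c"
  shows "R_norm q l f \<le> c"
  unfolding R_norm_def using assms by (intro cSUP_least tensor_set_nonempty)

lemma R_norm_nonneg:
  fixes f :: "'a::{real_normed_field,banach,second_countable_topology} cube_fun"
  assumes "f \<in> LP" shows "0 \<le> R_norm q l f"
proof -
  obtain u :: "'a cube_fun" where "u \<in> tensor_set q l" using tensor_set_nonempty by blast
  from le_R_norm[OF assms this] show ?thesis by (rule order_trans[OF norm_ge_zero])
qed

lemma R_norm_add:
  fixes f g :: "'a::{real_normed_field,banach,second_countable_topology} cube_fun"
  assumes "f \<in> LP" "g \<in> LP"
  shows "R_norm q l (\<lambda>x. f x + g x) \<le> R_norm q l f + R_norm q l g"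
proof (rule R_norm_le)
  fix u :: "'a cube_fun" assume u: "u \<in> tensor_set q l"
  have "(\<integral>x. u x * (f x + g x) \<partial>cube) = (\<integral>x. u x * f x \<partial>cube) + (\<integral>x. u x * g x \<partial>cube)"
    using assms u by (simp add: distrib_left integrable_pairing)
  then show "norm (\<integral>x. u x * (f x + g x) \<partial>cube) \<le> R_norm q l f + R_norm q l g"
    using norm_triangle_mono[OF le_R_norm[OF assms(1) u] le_R_norm[OF assms(2) u]] by simp
qed

lemma R_norm_cmult:
  fixes f :: "'a::{real_normed_field,banach,second_countable_topology} cube_fun"
  assumes "f \<in> LP"
  shows "R_norm q l (\<lambda>x. c * f x) \<le> norm c * R_norm q l f"
proof (rule R_norm_le)
  fix u :: "'a cube_fun" assume u: "u \<in> tensor_set q l"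
  have "(\<integral>x. u x * (c * f x) \<partial>cube) = c * (\<integral>x. u x * f x \<partial>cube)"
    by (subst integral_mult_right_zero[symmetric]) (simp add: ac_simps)
  then show "norm (\<integral>x. u x * (c * f x) \<partial>cube) \<le> norm c * R_norm q l f"
    using le_R_norm[OF assms u] by (simp add: norm_mult mult_left_mono)
qed

lemma pseudometric_R_dist:
  "pseudometric_on (LP :: ('a::{real_normed_field,banach,second_countable_topology} cube_fun) set) (R_dist q l)"
  unfolding pseudometric_on_def
proof (intro conjI ballI)
  have P0: "P > 0" using P by simp
  fix f :: "'a cube_fun" assume f: "f \<in> LP"
  show "R_dist q l f f = 0"
    by (simp add: R_dist_def R_norm_def cSUP_const[OF tensor_set_nonempty])
  fix g :: "'a cube_fun" assume g: "g \<in> LP"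
  show "0 \<le> R_dist q l f g" unfolding R_dist_def by (intro R_norm_nonneg Lp_space_diff P0 f g)
  have le: "R_dist q l f g \<le> R_dist q l g f" if "f \<in> LP" "g \<in> LP" for f g :: "'a cube_fun"
    using R_norm_cmult[OF Lp_space_diff(1)[OF P0 that(2,1)], of "- 1"] by (simp add: R_dist_def)
  show "R_dist q l f g = R_dist q l g f" using le[OF f g] le[OF g f] by (rule order_antisym)
  fix h :: "'a cube_fun" assume h: "h \<in> LP"
  show "R_dist q l f h \<le> R_dist q l f g + R_dist q l g h"
    using R_norm_add[OF Lp_space_diff(1)[OF P0 f g] Lp_space_diff(1)[OF P0 g h]]
    by (simp add: R_dist_def)
qed

text \<open>A bound for the analogue of the cut norm, which tests against factors bounded by 1.\<close>

definition cut_bounded :: "('a::{real_normed_field,banach,second_countable_topology} cube_fun) \<Rightarrow> real \<Rightarrow> bool" where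
  "cut_bounded h \<kappa> \<longleftrightarrow> (\<forall>r. (\<forall>i<l. r i \<in> borel_measurable unit_interval \<and> (\<forall>x. norm (r i x) \<le> 1)) \<longrightarrow>
    norm (\<integral>x. tensor l r x * h x \<partial>cube) \<le> \<kappa>)"

lemma cut_boundedI:
  fixes h :: "'a::{real_normed_field,banach,second_countable_topology} cube_fun"
  assumes h: "integrable cube h" and le: "(\<integral>x. norm (h x) \<partial>cube) \<le> \<kappa>"
  shows "cut_bounded h \<kappa>"
  unfolding cut_bounded_def
proof (intro allI impI)
  fix r :: "nat \<Rightarrow> real \<Rightarrow> 'a"
  assume r: "\<forall>i<l. r i \<in> borel_measurable unit_interval \<and> (\<forall>x. norm (r i x) \<le> 1)"
  have [measurable]: "tensor l r \<in> borel_measurable cube" "h \<in> borel_measurable cube"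
    using r h by (auto intro: borel_measurable_tensor)
  have t: "norm (tensor l r x * h x) \<le> norm (h x)" for x
    using norm_tensor_le_1[of l r x] r by (simp add: norm_mult mult_left_le_one_le)
  have i: "integrable cube (\<lambda>x. tensor l r x * h x)"
    by (rule Bochner_Integration.integrable_bound[OF h]) (use t in auto)
  have "norm (\<integral>x. tensor l r x * h x \<partial>cube) \<le> (\<integral>x. norm (tensor l r x * h x) \<partial>cube)"
    by (rule integral_norm_bound)
  also have "\<dots> \<le> (\<integral>x. norm (h x) \<partial>cube)" using i h t by (intro integral_mono) auto
  finally show "norm (\<integral>x. tensor l r x * h x \<partial>cube) \<le> \<kappa>" using le by simp
qed

text \<open>Every factor is truncated at a height \<open>T\<close>. The truncated factors divided by
  \<open>T\<close> are admissible in the cut bound, which yields \<open>L = T ^ l\<close>. Where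
  truncation changes the product, some factor exceeds \<open>T\<close>, and trading its exponent
  \<open>S\<close> for \<open>Q\<close> gains \<open>T powr (S - Q)\<close>. Young's inequality
  turns this gain into the error \<open>\<epsilon>\<close>. What matters later is that
  \<open>L\<close> does not depend on \<open>h\<close>.\<close>

lemma R_norm_le_cut_bound:
  assumes B: "0 \<le> B" and \<epsilon>: "0 < \<epsilon>"
  obtains L where "0 < L"
    "\<And>(h :: 'a::{real_normed_field,banach,second_countable_topology} cube_fun) \<kappa>. \<lbrakk>h \<in> LP; (\<integral>x. norm (h x) powr P \<partial>cube) \<le> B; cut_bounded h \<kappa>\<rbrakk>
      \<Longrightarrow> R_norm q l h \<le> L * \<kappa> + \<epsilon>"
proof -
  \<comment> \<open>Makes the contribution of \<open>h\<close> to Young's inequality at most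
    \<open>\<epsilon> / 2\<close>; \<open>B + 1\<close> instead of \<open>B\<close> avoids a
    division by 0. The height \<open>T\<close> is chosen after \<open>c\<close>, for the other
    contribution.\<close>
  define c where "c = (\<epsilon> / (2 * (B + 1))) powr (1 / P)"
  have c: "0 < c" using B \<epsilon> by (simp add: c_def)
  have "c powr P * B = \<epsilon> / (2 * (B + 1)) * B" using P B \<epsilon> by (simp add: c_def powr_powr)
  also have "\<dots> \<le> \<epsilon> / 2" using B \<epsilon> by (simp add: field_simps)
  finally have cB: "c powr P * B \<le> \<epsilon> / 2" .
  define C where "C = c powr (- S) * (real l * 2 ^ l)"
  have "((\<lambda>t. C * t powr (S - Q)) \<longlongrightarrow> C * 0) at_top"
    using SQ by (intro tendsto_mult tendsto_const tendsto_neg_powr filterlim_ident) auto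
  then have "\<forall>\<^sub>F t in at_top. C * t powr (S - Q) < \<epsilon> / 2"
    using \<epsilon> by (intro order_tendstoD) auto
  then have "\<forall>\<^sub>F t in at_top. C * t powr (S - Q) < \<epsilon> / 2 \<and> 1 \<le> t"
    using eventually_ge_at_top[of "1::real"] by eventually_elim auto
  then obtain T where T: "C * T powr (S - Q) < \<epsilon> / 2" "1 \<le> T"
    by (auto dest: eventually_happens)
  show thesis
  proof (rule that[of "T ^ l"])
    show "0 < T ^ l" using T by simp
    fix h :: "'a cube_fun" and \<kappa>
    assume h: "h \<in> LP" and hB: "(\<integral>x. norm (h x) powr P \<partial>cube) \<le> B" and cut: "cut_bounded h \<kappa>"
    show "R_norm q l h \<le> T ^ l * \<kappa> + \<epsilon>"
    proof (rule R_norm_le)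
      fix u :: "'a cube_fun" assume u: "u \<in> tensor_set q l"
      then obtain r where r: "u = tensor l r" "\<And>i. i < l \<Longrightarrow> r i \<in> Lp_ball unit_interval q"
        using tensor_setE[OF u] by metis
      note rm = ball_qD[OF r(2)]
      define a where "a i x = (if norm (r i x) \<le> T then r i x else 0)" for i x
      have am: "a i \<in> borel_measurable unit_interval" if "i < l" for i
        using rm(1)[OF that] unfolding a_def by measurable
      define D where "D x = tensor l r x - tensor l a x" for x
      have Dm[measurable]: "D \<in> borel_measurable cube"
        unfolding D_def[abs_def] by (intro borel_measurable_diff borel_measurable_tensor am rm(1)) auto
      \<comment> \<open>Only the factor with index \<open>i\<close> carries the exponent
        \<open>Q\<close>; every factor still has an integral of at most 2.\<close>
      define b where "b i j x = norm (r j x) powr (if j = i then Q else S)" for i j x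
      have bi: "integrable unit_interval (b i j)" "(\<integral>x. b i j x \<partial>unit_interval) \<le> 2" if "j < l" for i j
        using rm(2-5)[OF that] by (cases "j = i"; simp add: b_def[abs_def])+
      have tb: "(\<integral>x. tensor l (b i) x \<partial>cube) \<le> 2 ^ l" for i
      proof -
        have "(\<integral>x. tensor l (b i) x \<partial>cube) = (\<Prod>j<l. \<integral>x. b i j x \<partial>unit_interval)"
          by (rule integral_tensor) (rule bi)
        also have "\<dots> \<le> (\<Prod>j<l. 2)" using bi by (intro prod_mono) (auto simp: b_def)
        finally show ?thesis by simp
      qed
      have tbi: "integrable cube (tensor l (b i))" for i by (rule integrable_tensor) (rule bi)
      have bnn: "0 \<le> tensor l (b i) x" for i x unfolding tensor_def b_def by (intro prod_nonneg) simp
      \<comment> \<open>Which factor exceeds \<open>T\<close> depends on \<open>x\<close>; the sum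
        over \<open>i\<close> covers all cases.\<close>
      have Dle: "norm (D x) powr S \<le> T powr (S - Q) * (\<Sum>i<l. tensor l (b i) x)" for x
      proof (cases "\<exists>i<l. norm (r i (x i)) > T")
        case False
        then have "tensor l a x = tensor l r x"
          unfolding tensor_def by (intro prod.cong) (force simp: a_def)+
        then show ?thesis using bnn T S by (simp add: D_def sum_nonneg)
      next
        case True
        then obtain i where i: "i < l" "norm (r i (x i)) > T" by blast
        have "a i (x i) = 0" using i by (simp add: a_def)
        then have "tensor l a x = 0" unfolding tensor_def using i by (intro prod_zero) auto
        then have "norm (D x) powr S = (\<Prod>j<l. norm (r j (x j)) powr S)"
          by (simp add: D_def norm_tensor_powr) (simp add: tensor_def)
        also have "\<dots> \<le> (\<Prod>j<l. (if j = i then T powr (S - Q) else 1) * b i j (x j))"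
        proof (intro prod_mono conjI)
          fix j assume "j \<in> {..<l}"
          show "norm (r j (x j)) powr S \<le> (if j = i then T powr (S - Q) else 1) * b i j (x j)"
          proof (cases "j = i")
            case True
            have "norm (r i (x i)) powr S = norm (r i (x i)) powr (S - Q) * norm (r i (x i)) powr Q"
              by (simp add: powr_add[symmetric])
            also have "\<dots> \<le> T powr (S - Q) * norm (r i (x i)) powr Q"
              using i T SQ by (intro mult_right_mono powr_mono2') auto
            finally show ?thesis using True by (simp add: b_def)
          qed (simp add: b_def)
        qed simp
        also have "\<dots> = T powr (S - Q) * tensor l (b i) x"
          using i by (simp add: prod.distrib tensor_def)
        also have "\<dots> \<le> T powr (S - Q) * (\<Sum>i<l. tensor l (b i) x)"
          using i bnn by (intro mult_left_mono member_le_sum) auto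
        finally show ?thesis .
      qed
      have bI: "integrable cube (\<lambda>x. T powr (S - Q) * (\<Sum>i<l. tensor l (b i) x))"
        by (intro integrable_mult_right Bochner_Integration.integrable_sum tbi)
      have DI: "integrable cube (\<lambda>x. norm (D x) powr S)"
        by (rule Bochner_Integration.integrable_bound[OF bI]) (use Dle in \<open>auto intro: order_trans[OF _ abs_ge_self]\<close>)
      have "(\<integral>x. norm (D x) powr S \<partial>cube) \<le> (\<integral>x. T powr (S - Q) * (\<Sum>i<l. tensor l (b i) x) \<partial>cube)"
        by (rule integral_mono[OF DI bI Dle])
      also have "\<dots> = T powr (S - Q) * (\<Sum>i<l. \<integral>x. tensor l (b i) x \<partial>cube)"
        by (subst integral_mult_right_zero, subst Bochner_Integration.integral_sum) (auto intro: tbi)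
      also have "\<dots> \<le> T powr (S - Q) * (\<Sum>i<l. 2 ^ l)" using tb by (intro mult_left_mono sum_mono) auto
      finally have DS: "(\<integral>x. norm (D x) powr S \<partial>cube) \<le> T powr (S - Q) * (real l * 2 ^ l)" by simp
      have "norm (\<integral>x. D x * h x \<partial>cube) \<le>
        c powr P * (\<integral>x. norm (h x) powr P \<partial>cube) + c powr (- S) * (\<integral>x. norm (D x) powr S \<partial>cube)"
        by (rule integral_pairing_le(2)[OF h Dm DI c])
      also have "\<dots> \<le> c powr P * B + c powr (- S) * (T powr (S - Q) * (real l * 2 ^ l))"
        using hB DS by (intro add_mono mult_left_mono) auto
      also have "\<dots> \<le> \<epsilon>" using cB T(1) by (simp add: C_def ac_simps)
      finally have 1: "norm (\<integral>x. D x * h x \<partial>cube) \<le> \<epsilon>" .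
      define a' where "a' i x = a i x / of_real T" for i x
      have ta: "tensor l a x = of_real T ^ l * tensor l a' x" for x
        using T by (simp add: tensor_def a'_def prod_dividef)
      have a'1: "norm (a' i x) \<le> 1" for i x using T by (auto simp: a'_def a_def norm_divide)
      have a'm: "a' i \<in> borel_measurable unit_interval" if "i < l" for i
        using am[OF that] unfolding a'_def by measurable
      have "norm (\<integral>x. tensor l a' x * h x \<partial>cube) \<le> \<kappa>"
        using cut a'1 a'm unfolding cut_bounded_def by blast
      then have 2: "norm (\<integral>x. tensor l a x * h x \<partial>cube) \<le> T ^ l * \<kappa>"
        using T by (simp add: ta mult.assoc norm_mult norm_power mult_left_mono)
      have iu: "integrable cube (\<lambda>x. tensor l r x * h x)"
        using integrable_pairing[OF h u] r by simp
      have iD: "integrable cube (\<lambda>x. D x * h x)"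
        by (rule integral_pairing_le(1)[OF h Dm DI c])
      have ia: "integrable cube (\<lambda>x. tensor l a x * h x)"
        using Bochner_Integration.integrable_diff[OF iu iD] by (simp add: D_def algebra_simps)
      have "(\<integral>x. u x * h x \<partial>cube) = (\<integral>x. tensor l a x * h x + D x * h x \<partial>cube)"
        by (simp add: r(1) D_def algebra_simps)
      also have "\<dots> = (\<integral>x. tensor l a x * h x \<partial>cube) + (\<integral>x. D x * h x \<partial>cube)"
        by (rule Bochner_Integration.integral_add[OF ia iD])
      finally show "norm (\<integral>x. u x * h x \<partial>cube) \<le> T ^ l * \<kappa> + \<epsilon>"
        using norm_triangle_mono[OF 2 1] by simp
    qed
  qed
qed

end

section \<open>The action of the measure preserving bijections\<close>

text \<open>Distances see a function only on the cube, and it is there that the group laws of the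
  action hold.\<close>

lemma R_dist_cong:
  assumes "\<And>x. x \<in> space (unit_cube l) \<Longrightarrow> f x = f' x" "\<And>x. x \<in> space (unit_cube l) \<Longrightarrow> g x = g' x"
  shows "R_dist q l f g = R_dist q l f' g'"
  unfolding R_dist_def R_norm_def
  by (intro SUP_cong refl arg_cong[where f = norm] Bochner_Integration.integral_cong) (simp_all add: assms)

lemma bijection_action_eq:
  "bijection_action l \<tau> f = (\<lambda>x. f (compose {..<l} (inv_into {0..1} \<tau>) x))"
  by (simp add: bijection_action_def compose_def)

lemma bijection_action_inverse:
  assumes \<tau>: "\<tau> \<in> MPB" and x: "x \<in> space (unit_cube l)"
  shows "bijection_action l (inv_into {0..1} \<tau>) (bijection_action l \<tau> f) x = f x"
proof -
  let ?\<sigma> = "inv_into {0..1} \<tau>"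
  note bij = bijectionsD(1)[OF \<tau>]
  have "?\<sigma> (inv_into {0..1} ?\<sigma> t) = t" if "t \<in> {0..1}" for t
    by (rule bij_betw_inv_into_right[OF bij_betw_inv_into[OF bij] that])
  then have "compose {..<l} ?\<sigma> (compose {..<l} (inv_into {0..1} ?\<sigma>) x) = x"
    using x by (auto simp: space_unit_cube compose_def PiE_iff extensional_def fun_eq_iff)
  then show ?thesis by (simp add: bijection_action_eq)
qed

lemma bijection_action_comp:
  assumes \<sigma>: "\<sigma> \<in> MPB" and \<tau>: "\<tau> \<in> MPB"
    and x: "x \<in> space (unit_cube l)"
  shows "bijection_action l \<sigma> (bijection_action l \<tau> f) x = bijection_action l (\<sigma> \<circ> \<tau>) f x"
proof -
  note bij = bijectionsD(1)[OF \<sigma>] bijectionsD(1)[OF \<tau>]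
  have "inv_into {0..1} (\<sigma> \<circ> \<tau>) t = inv_into {0..1} \<tau> (inv_into {0..1} \<sigma> t)" if t: "t \<in> {0..1}" for t
  proof (rule inv_into_f_eq)
    show "inj_on (\<sigma> \<circ> \<tau>) {0..1}"
      by (rule bij_betw_imp_inj_on[OF bij_betw_trans[OF bij(2,1)]])
    have 1: "inv_into {0..1} \<sigma> t \<in> {0..1}" by (rule bij_betw_apply[OF bij_betw_inv_into[OF bij(1)] t])
    show "inv_into {0..1} \<tau> (inv_into {0..1} \<sigma> t) \<in> {0..1}"
      by (rule bij_betw_apply[OF bij_betw_inv_into[OF bij(2)] 1])
    show "(\<sigma> \<circ> \<tau>) (inv_into {0..1} \<tau> (inv_into {0..1} \<sigma> t)) = t"
      using bij_betw_inv_into_right[OF bij(2) 1] bij_betw_inv_into_right[OF bij(1) t] by simp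
  qed
  then have "compose {..<l} (inv_into {0..1} \<tau>) (compose {..<l} (inv_into {0..1} \<sigma>) x) =
      compose {..<l} (inv_into {0..1} (\<sigma> \<circ> \<tau>)) x"
    using x by (auto simp: space_unit_cube compose_def PiE_iff fun_eq_iff)
  then show ?thesis by (simp add: bijection_action_eq)
qed

lemma borel_measurable_bijection_action:
  assumes "\<tau> \<in> MPB" "f \<in> borel_measurable (unit_cube l)"
  shows "bijection_action l \<tau> f \<in> borel_measurable (unit_cube l)"
  unfolding bijection_action_eq
  by (rule measurable_compose[OF unit_cube_map(1)[OF bijections_measurable[OF inv_in_bijections[OF assms(1)]]] assms(2)])

lemma
  fixes f :: "_ \<Rightarrow> 'b::{banach,second_countable_topology}"
  assumes \<tau>: "\<tau> \<in> MPB" and f: "f \<in> borel_measurable (unit_cube l)"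
  shows integrable_bijection_action:
      "integrable (unit_cube l) (bijection_action l \<tau> f) \<longleftrightarrow> integrable (unit_cube l) f"
    and integral_bijection_action:
      "(\<integral>x. bijection_action l \<tau> f x \<partial>unit_cube l) = (\<integral>x. f x \<partial>unit_cube l)"
proof -
  let ?X = "compose {..<l} (inv_into {0..1} \<tau>)"
  note m = unit_cube_map[OF bijections_measurable[OF inv_in_bijections[OF \<tau>]], of l]
  show "integrable (unit_cube l) (bijection_action l \<tau> f) \<longleftrightarrow> integrable (unit_cube l) f"
    unfolding bijection_action_eq using integrable_distr_eq[OF m(1) f] by (simp add: m(2))
  show "(\<integral>x. bijection_action l \<tau> f x \<partial>unit_cube l) = (\<integral>x. f x \<partial>unit_cube l)"
    unfolding bijection_action_eq using integral_distr[OF m(1) f] by (simp add: m(2))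
qed

lemma Lp_ball_precompose:
  fixes r :: "'x \<Rightarrow> 'a::real_normed_vector"
  assumes r: "r \<in> Lp_ball M s" and T: "T \<in> measurable M M" "distr M M T = M"
    and s: "s = \<infinity> \<or> (\<exists>t>0. s = ennreal t)"
  shows "(\<lambda>x. r (T x)) \<in> Lp_ball M s"
  using s
proof
  assume s: "s = \<infinity>"
  have [measurable]: "r \<in> borel_measurable M" and ae: "AE x in M. norm (r x) \<le> 1"
    using r s Lp_ball_infinity by auto
  have "AE x in distr M M T. norm (r x) \<le> 1" unfolding T(2) by (rule ae)
  then have "AE x in M. norm (r (T x)) \<le> 1" using T(1) by (subst (asm) AE_distr_iff) auto
  then show ?thesis using measurable_compose[OF T(1), of r borel] s Lp_ball_infinity by auto
next
  assume "\<exists>t>0. s = ennreal t"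
  then obtain t where t: "t > 0" "s = ennreal t" by blast
  have rm[measurable]: "r \<in> borel_measurable M" and i: "integrable M (\<lambda>x. norm (r x) powr t)"
    and I: "(\<integral>x. norm (r x) powr t \<partial>M) \<le> 1"
    using r t by (auto simp: Lp_ball_finite)
  have g: "(\<lambda>x. norm (r x) powr t) \<in> borel_measurable M" by measurable
  show ?thesis
    using measurable_compose[OF T(1) rm] integrable_distr_eq[OF T(1) g] integral_distr[OF T(1) g] i I t
    by (simp add: Lp_ball_finite T(2))
qed

context exponents
begin

lemma exponent_cases: "p = \<infinity> \<or> (\<exists>t>0. p = ennreal t)" "q = \<infinity> \<or> (\<exists>t>0. q = ennreal t)"
  using p q P S SQ by (auto intro: exI[of _ P] exI[of _ Q])

lemma bijection_action_in_ball:
  fixes f :: "'a::{real_normed_field,banach,second_countable_topology} cube_fun"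
  assumes \<tau>: "\<tau> \<in> MPB" and f: "f \<in> Lp_ball cube p"
  shows "bijection_action l \<tau> f \<in> Lp_ball cube p"
  unfolding bijection_action_eq
  by (rule Lp_ball_precompose[OF f unit_cube_map[OF bijections_measurable[OF inv_in_bijections[OF \<tau>]]] exponent_cases(1)])

lemma bijection_action_in_LP:
  fixes f :: "'a::{real_normed_field,banach,second_countable_topology} cube_fun"
  assumes \<tau>: "\<tau> \<in> MPB" and f: "f \<in> LP"
  shows "bijection_action l \<tau> f \<in> LP"
proof -
  have P0: "P > 0" using P by simp
  have [measurable]: "f \<in> borel_measurable cube" and i: "integrable cube (\<lambda>x. norm (f x) powr P)"
    using f P0 by (auto simp: Lp_space_finite)
  have "integrable cube (bijection_action l \<tau> (\<lambda>x. norm (f x) powr P))"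
    using i by (subst integrable_bijection_action[OF \<tau>]) auto
  then show ?thesis
    using borel_measurable_bijection_action[OF \<tau>, of f l] P0 by (simp add: Lp_space_finite bijection_action_def)
qed

text \<open>A substitution moves \<open>\<tau>\<close> from \<open>f\<close> to the factors. The
  functions \<open>r i \<circ> \<tau>\<close> stay in the ball, so a pairing with the translate of
  \<open>f\<close> is a pairing with \<open>f\<close>.\<close>

lemma R_norm_bijection_action_le:
  fixes f :: "'a::{real_normed_field,banach,second_countable_topology} cube_fun"
  assumes \<tau>: "\<tau> \<in> MPB" and f: "f \<in> LP"
  shows "R_norm q l (bijection_action l \<tau> f) \<le> R_norm q l f"
proof (rule R_norm_le)
  fix u :: "'a cube_fun" assume "u \<in> tensor_set q l"
  then obtain r where r: "u = tensor l r" "\<And>i. i < l \<Longrightarrow> r i \<in> Lp_ball unit_interval q"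
    using tensor_setE by metis
  define r' where "r' i x = r i (\<tau> x)" for i x
  have r': "r' i \<in> Lp_ball unit_interval q" if "i < l" for i
    unfolding r'_def by (rule Lp_ball_precompose[OF r(2)[OF that] bijections_measurable[OF \<tau>] exponent_cases(2)])
  have u': "tensor l r' \<in> tensor_set q l" using r' by (auto simp: tensor_set_eq)
  have "tensor l r x = bijection_action l \<tau> (tensor l r') x" if x: "x \<in> space cube" for x
  proof -
    have "r i (x i) = r' i (inv_into {0..1} \<tau> (x i))" if "i < l" for i
      using bij_betw_inv_into_right[OF bijectionsD(1)[OF \<tau>], of "x i"] x that
      by (auto simp: r'_def space_unit_cube PiE_iff)
    then show ?thesis by (simp add: tensor_def bijection_action_def)
  qed
  then have "(\<integral>x. u x * bijection_action l \<tau> f x \<partial>cube) =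
      (\<integral>x. bijection_action l \<tau> (\<lambda>x. tensor l r' x * f x) x \<partial>cube)"
    unfolding r(1) by (intro Bochner_Integration.integral_cong refl) (simp add: bijection_action_def)
  also have "\<dots> = (\<integral>x. tensor l r' x * f x \<partial>cube)"
    using integrable_pairing[OF f u'] by (intro integral_bijection_action[OF \<tau>]) auto
  finally show "norm (\<integral>x. u x * bijection_action l \<tau> f x \<partial>cube) \<le> R_norm q l f"
    using le_R_norm[OF f u'] by simp
qed

lemma R_dist_bijection_action:
  fixes f g :: "'a::{real_normed_field,banach,second_countable_topology} cube_fun"
  assumes \<tau>: "\<tau> \<in> MPB" and f: "f \<in> LP" and g: "g \<in> LP"
  shows "R_dist q l (bijection_action l \<tau> f) (bijection_action l \<tau> g) = R_dist q l f g"
proof -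
  have P0: "P > 0" using P by simp
  have le: "R_dist q l (bijection_action l \<tau> f) (bijection_action l \<tau> g) \<le> R_dist q l f g"
    if \<tau>: "\<tau> \<in> MPB" and f: "f \<in> LP" and g: "g \<in> LP"
    for \<tau> and f g :: "'a cube_fun"
    using R_norm_bijection_action_le[OF \<tau> Lp_space_diff(1)[OF P0 f g]]
    by (simp add: R_dist_def bijection_action_def)
  have "R_dist q l f g =
      R_dist q l (bijection_action l (inv_into {0..1} \<tau>) (bijection_action l \<tau> f))
        (bijection_action l (inv_into {0..1} \<tau>) (bijection_action l \<tau> g))"
    by (intro R_dist_cong bijection_action_inverse[symmetric] \<tau>)
  also have "\<dots> \<le> R_dist q l (bijection_action l \<tau> f) (bijection_action l \<tau> g)"
    by (intro le inv_in_bijections bijection_action_in_LP \<tau> f g)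
  finally show ?thesis using le[OF \<tau> f g] by simp
qed

lemma isometric_action_bijections:
  "isometric_action (LP :: ('a::{real_normed_field,banach,second_countable_topology} cube_fun) set)
    (R_dist q l) MPB (bijection_action l)"
proof
  show "pseudometric_on LP (R_dist q l :: ('a cube_fun) \<Rightarrow> _)" by (rule pseudometric_R_dist)
  show "\<exists>e\<in>MPB. \<forall>x\<in>LP. \<forall>y\<in>LP.
      R_dist q l x (bijection_action l e y) = R_dist q l x (y :: 'a cube_fun)"
  proof (intro bexI[OF _ id_in_bijections] ballI R_dist_cong refl)
    fix y :: "'a cube_fun" and x assume x: "x \<in> space cube"
    have "inv_into {0..1} id t = t" if "t \<in> {0..1::real}" for t
      using inv_into_f_f[of id "{0..1}" t] that by simp
    then have "(\<lambda>i\<in>{..<l}. inv_into {0..1} id (x i)) = x"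
      using x by (auto simp: space_unit_cube PiE_iff extensional_def fun_eq_iff)
    then show "bijection_action l id y x = y x" by (simp add: bijection_action_def)
  qed
  fix g assume g: "g \<in> MPB"
  show "bijection_action l g x \<in> LP" if "x \<in> LP" for x :: "'a cube_fun"
    using bijection_action_in_LP g that .
  show "R_dist q l (bijection_action l g x) (bijection_action l g y) = R_dist q l x y"
    if "x \<in> LP" "y \<in> LP" for x y :: "'a cube_fun"
    using R_dist_bijection_action g that .
  show "\<exists>g'\<in>MPB. \<forall>x\<in>LP. \<forall>y\<in>LP.
      R_dist q l (bijection_action l g x) y = R_dist q l x (bijection_action l g' (y :: 'a cube_fun))"
  proof (intro bexI ballI)
    let ?g' = "inv_into {0..1} g"
    show g': "?g' \<in> MPB" by (rule inv_in_bijections[OF g])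
    fix x y :: "'a cube_fun" assume x: "x \<in> LP" and y: "y \<in> LP"
    have "R_dist q l (bijection_action l g x) y =
        R_dist q l (bijection_action l ?g' (bijection_action l g x)) (bijection_action l ?g' y)"
      by (rule R_dist_bijection_action[symmetric, OF g' bijection_action_in_LP[OF g x] y])
    also have "\<dots> = R_dist q l x (bijection_action l ?g' y)"
      by (intro R_dist_cong bijection_action_inverse g refl)
    finally show "R_dist q l (bijection_action l g x) y = R_dist q l x (bijection_action l ?g' y)" .
  qed
  fix h assume h: "h \<in> MPB"
  show "\<exists>k\<in>MPB. \<forall>x\<in>LP. \<forall>y\<in>LP.
      R_dist q l x (bijection_action l g (bijection_action l h y)) =
      R_dist q l x (bijection_action l k (y :: 'a cube_fun))"
    by (intro bexI[OF _ comp_in_bijections[OF g h]] ballI R_dist_cong bijection_action_comp g h refl)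
qed

end

section \<open>Completeness\<close>

lemma Fatou_bound:
  fixes u :: "nat \<Rightarrow> 'x \<Rightarrow> real"
  assumes u: "\<And>n. integrable M (u n)" "\<And>n x. 0 \<le> u n x" and v: "v \<in> borel_measurable M"
    and lim: "AE x in M. (\<lambda>n. u n x) \<longlonglongrightarrow> v x"
    and c: "\<forall>\<^sub>F n in sequentially. (\<integral>x. u n x \<partial>M) \<le> c"
  shows "integrable M v" "(\<integral>x. v x \<partial>M) \<le> c"
proof -
  have v0: "AE x in M. 0 \<le> v x"
    using lim by eventually_elim (rule LIMSEQ_le_const, auto simp: u)
  have c0: "0 \<le> c"
  proof -
    obtain n where "(\<integral>x. u n x \<partial>M) \<le> c" using c by (auto simp: eventually_sequentially)
    moreover have "0 \<le> (\<integral>x. u n x \<partial>M)" by (simp add: u)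
    ultimately show ?thesis by linarith
  qed
  have "(\<integral>\<^sup>+x. ennreal (v x) \<partial>M) = (\<integral>\<^sup>+x. liminf (\<lambda>n. ennreal (u n x)) \<partial>M)"
    by (rule nn_integral_cong_AE)
      (use lim in \<open>eventually_elim, auto intro!: lim_imp_Liminf[symmetric] tendsto_ennrealI\<close>)
  also have "\<dots> \<le> liminf (\<lambda>n. \<integral>\<^sup>+x. ennreal (u n x) \<partial>M)"
    using u(1) by (intro nn_integral_liminf) auto
  also have "\<dots> \<le> liminf (\<lambda>n. ennreal c)"
  proof (rule Liminf_mono)
    show "\<forall>\<^sub>F n in sequentially. (\<integral>\<^sup>+x. ennreal (u n x) \<partial>M) \<le> ennreal c"
      using c by eventually_elim (simp add: nn_integral_eq_integral u ennreal_leI)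
  qed
  finally have le: "(\<integral>\<^sup>+x. ennreal (v x) \<partial>M) \<le> ennreal c" by (simp add: Liminf_const)
  show i: "integrable M v"
  proof (rule integrableI_nonneg[OF v v0])
    show "(\<integral>\<^sup>+x. ennreal (v x) \<partial>M) < \<infinity>" using le by (rule le_less_trans) simp
  qed
  show "(\<integral>x. v x \<partial>M) \<le> c"
    using le c0 by (simp add: nn_integral_eq_integral[OF i v0])
qed

text \<open>The Riesz-Fischer argument: along a fast subsequence the increments have summable
  \<open>L\<^sup>1\<close> norms, so they are absolutely summable almost everywhere, and they
  telescope.\<close>

lemma L1_Cauchy_AE_convergent_subseq:
  fixes g :: "nat \<Rightarrow> 'x \<Rightarrow> 'b::{banach,second_countable_topology}"
  assumes g: "\<And>n. integrable M (g n)"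
    and cauchy: "\<And>e. e > 0 \<Longrightarrow> \<exists>N. \<forall>m\<ge>N. \<forall>n\<ge>N. (\<integral>x. norm (g m x - g n x) \<partial>M) < e"
  obtains f s where "f \<in> borel_measurable M" "strict_mono s" "AE x in M. (\<lambda>k. g (s k) x) \<longlonglongrightarrow> f x"
proof -
  have "\<exists>s. \<forall>k. (\<forall>m\<ge>s k. \<forall>n\<ge>s k. (\<integral>x. norm (g m x - g n x) \<partial>M) < (1/2)^k) \<and> s k < s (Suc k)"
  proof (rule dependent_nat_choice)
    show "\<exists>x. \<forall>m\<ge>x. \<forall>n\<ge>x. (\<integral>x. norm (g m x - g n x) \<partial>M) < (1/2)^0" using cauchy[of 1] by simp
    fix x k
    obtain N where "\<forall>m\<ge>N. \<forall>n\<ge>N. (\<integral>x. norm (g m x - g n x) \<partial>M) < (1/2)^Suc k"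
      using cauchy[of "(1/2)^Suc k"] by auto
    then show "\<exists>y. (\<forall>m\<ge>y. \<forall>n\<ge>y. (\<integral>x. norm (g m x - g n x) \<partial>M) < (1/2)^Suc k) \<and> x < y"
      by (intro exI[of _ "max N (Suc x)"]) auto
  qed
  then obtain s where s: "\<And>k m n. m \<ge> s k \<Longrightarrow> n \<ge> s k \<Longrightarrow> (\<integral>x. norm (g m x - g n x) \<partial>M) < (1/2)^k"
    and sS: "\<And>k. s k < s (Suc k)" by blast
  have mono: "strict_mono s" by (rule strict_mono_Suc_iff[THEN iffD2]) (use sS in auto)
  define d where "d k x = g (s (Suc k)) x - g (s k) x" for k x
  have di: "integrable M (d k)" for k unfolding d_def[abs_def] using g by simp
  have dI: "(\<integral>\<^sup>+x. ennreal (norm (d k x)) \<partial>M) \<le> ennreal ((1/2)^k)" for k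
  proof -
    have "(\<integral>x. norm (d k x) \<partial>M) \<le> (1/2)^k"
      using s[of k "s (Suc k)" "s k"] sS[of k] by (simp add: d_def)
    then show ?thesis using di[of k] by (subst nn_integral_eq_integral) (auto simp: ennreal_leI)
  qed
  have "(\<integral>\<^sup>+x. (\<Sum>k. ennreal (norm (d k x))) \<partial>M) = (\<Sum>k. \<integral>\<^sup>+x. ennreal (norm (d k x)) \<partial>M)"
    using di by (intro nn_integral_suminf) auto
  also have "\<dots> \<le> (\<Sum>k. ennreal ((1/2)^k))" by (intro suminf_le dI) auto
  also have "\<dots> = ennreal (\<Sum>k. (1/2)^k)" by (rule suminf_ennreal2) auto
  also have "\<dots> < \<infinity>" by simp
  finally have fin: "(\<integral>\<^sup>+x. (\<Sum>k. ennreal (norm (d k x))) \<partial>M) \<noteq> \<infinity>" by simp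
  have "AE x in M. (\<Sum>k. ennreal (norm (d k x))) \<noteq> \<infinity>"
    using di by (intro nn_integral_PInf_AE fin) auto
  then have conv: "AE x in M. convergent (\<lambda>k. g (s k) x)"
  proof eventually_elim
    case (elim x)
    then have "summable (\<lambda>k. norm (d k x))" by (intro summable_suminf_not_top) auto
    then have "summable (\<lambda>k. d k x)" by (rule summable_norm_cancel)
    then have "convergent (\<lambda>n. \<Sum>k<n. d k x)" by (simp add: summable_iff_convergent)
    then have "convergent (\<lambda>n. g (s n) x - g (s 0) x)"
      by (simp add: d_def sum_lessThan_telescope[of "\<lambda>k. g (s k) x"])
    from convergent_add[OF this convergent_const[of "g (s 0) x"]] show ?case by simp
  qed
  define f where "f x = lim (\<lambda>k. g (s k) x)" for x
  show thesis
  proof (rule that[of f s])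
    show "f \<in> borel_measurable M" unfolding f_def[abs_def]
      using g by (intro borel_measurable_lim_metric) auto
    show "AE x in M. (\<lambda>k. g (s k) x) \<longlonglongrightarrow> f x"
      using conv by eventually_elim (simp add: f_def convergent_LIMSEQ_iff)
  qed (rule mono)
qed

lemma Lp_ball_AE_limit:
  fixes f :: "'x \<Rightarrow> 'a::{real_normed_vector,second_countable_topology}"
  assumes g: "\<And>n. g n \<in> Lp_ball M s" and s: "s = \<infinity> \<or> (\<exists>t>0. s = ennreal t)"
    and f: "f \<in> borel_measurable M" and lim: "AE x in M. (\<lambda>n. g n x) \<longlonglongrightarrow> f x"
  shows "f \<in> Lp_ball M s"
  using s
proof
  assume s: "s = \<infinity>"
  have "AE x in M. \<forall>n. norm (g n x) \<le> 1"
    using g s Lp_ball_infinity by (auto simp: AE_all_countable)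
  with lim have "AE x in M. norm (f x) \<le> 1"
    by eventually_elim (rule LIMSEQ_le_const2[OF tendsto_norm], auto)
  then show ?thesis using s f Lp_ball_infinity by auto
next
  assume "\<exists>t>0. s = ennreal t"
  then obtain t where t: "t > 0" "s = ennreal t" by blast
  have gi: "integrable M (\<lambda>x. norm (g n x) powr t)" and gI: "(\<integral>x. norm (g n x) powr t \<partial>M) \<le> 1" for n
    using g[of n] t by (auto simp: Lp_ball_finite)
  have l: "AE x in M. (\<lambda>n. norm (g n x) powr t) \<longlonglongrightarrow> norm (f x) powr t"
    using lim by eventually_elim (use t in \<open>auto intro!: tendsto_powr' tendsto_norm\<close>)
  have m: "(\<lambda>x. norm (f x) powr t) \<in> borel_measurable M" using f by measurable
  have ev: "\<forall>\<^sub>F n in sequentially. (\<integral>x. norm (g n x) powr t \<partial>M) \<le> 1" using gI by simp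
  show ?thesis
    using Fatou_bound[OF gi _ m l ev] f t by (simp add: Lp_ball_finite)
qed

lemma powr_midpoint_le:
  fixes a b :: "'a::real_normed_field"
  assumes "1 \<le> t"
  shows "norm ((a + b) / 2) powr t \<le> (norm a powr t + norm b powr t) / 2"
proof -
  have half: "(x / 2) powr t \<le> x powr t / 2" if "0 \<le> x" for x :: real
  proof -
    have "(1 / 2 :: real) powr t \<le> (1 / 2) powr 1" using assms by (intro powr_mono') auto
    then have "x powr t * (1 / 2) powr t \<le> x powr t * (1 / 2)" by (intro mult_left_mono) auto
    then show ?thesis using that by (simp add: powr_mult[symmetric])
  qed
  have "norm ((a + b) / 2) \<le> norm a / 2 + norm b / 2"
    using norm_triangle_ineq[of a b] by (simp add: norm_divide)
  then have "norm ((a + b) / 2) powr t \<le> (norm a / 2 + norm b / 2) powr t"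
    using assms by (intro powr_mono2) auto
  \<comment> \<open>Convexity of the power is applied to positive arguments; if one of them
    vanishes, \<open>half\<close> suffices.\<close>
  also have "\<dots> \<le> norm a powr t / 2 + norm b powr t / 2"
  proof (cases "a = 0 \<or> b = 0")
    case True
    then show ?thesis using half[of "norm a"] half[of "norm b"] by auto
  next
    case False
    then show ?thesis
      using convex_onD[OF powr_convex[OF assms], of "1/2" "norm a" "norm b"] by simp
  qed
  finally show ?thesis by simp
qed

lemma Lp_ball_midpoint:
  fixes f g :: "'x \<Rightarrow> 'a::{real_normed_field,second_countable_topology}"
  assumes f: "f \<in> Lp_ball M s" and g: "g \<in> Lp_ball M s" and s: "s = \<infinity> \<or> (\<exists>t\<ge>1. s = ennreal t)"
  shows "(\<lambda>x. (f x + g x) / 2) \<in> Lp_ball M s"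
  using s
proof
  assume s: "s = \<infinity>"
  have [measurable]: "f \<in> borel_measurable M" "g \<in> borel_measurable M"
    and ae: "AE x in M. norm (f x) \<le> 1" "AE x in M. norm (g x) \<le> 1"
    using f g s Lp_ball_infinity by auto
  have "AE x in M. norm ((f x + g x) / 2) \<le> 1"
    using ae
  proof eventually_elim
    case (elim x)
    then show ?case using norm_triangle_ineq[of "f x" "g x"] by (simp add: norm_divide)
  qed
  moreover have "(\<lambda>x. (f x + g x) / 2) \<in> borel_measurable M" by measurable
  ultimately show ?thesis unfolding s Lp_ball_infinity by blast
next
  assume "\<exists>t\<ge>1. s = ennreal t"
  then obtain t where t: "t \<ge> 1" "s = ennreal t" by blast
  then have t0: "t > 0" by simp
  have [measurable]: "f \<in> borel_measurable M" "g \<in> borel_measurable M"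
    and i: "integrable M (\<lambda>x. norm (f x) powr t)" "integrable M (\<lambda>x. norm (g x) powr t)"
    and I: "(\<integral>x. norm (f x) powr t \<partial>M) \<le> 1" "(\<integral>x. norm (g x) powr t \<partial>M) \<le> 1"
    using f g t t0 by (auto simp: Lp_ball_finite)
  have i2: "integrable M (\<lambda>x. (norm (f x) powr t + norm (g x) powr t) / 2)" using i by simp
  have i3: "integrable M (\<lambda>x. norm ((f x + g x) / 2) powr t)"
    by (rule Bochner_Integration.integrable_bound[OF i2]) (use powr_midpoint_le[OF t(1)] in auto)
  have "(\<integral>x. norm ((f x + g x) / 2) powr t \<partial>M) \<le> (\<integral>x. (norm (f x) powr t + norm (g x) powr t) / 2 \<partial>M)"
    by (rule integral_mono[OF i3 i2 powr_midpoint_le[OF t(1)]])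
  also have "\<dots> = ((\<integral>x. norm (f x) powr t \<partial>M) + (\<integral>x. norm (g x) powr t \<partial>M)) / 2"
    using i by simp
  also have "\<dots> \<le> 1" using I by simp
  finally have "(\<integral>x. norm ((f x + g x) / 2) powr t \<partial>M) \<le> 1" .
  moreover have "(\<lambda>x. (f x + g x) / 2) \<in> borel_measurable M" by measurable
  ultimately show ?thesis using i3 unfolding t(2) Lp_ball_finite[OF t0] by blast
qed

text \<open>The length of the vector \<open>(1, z)\<close>. It is strictly convex and grows only
  linearly, so its integral is finite and uniformly bounded on the ball for every
  \<open>p > 1\<close>; the square of the norm would require \<open>p \<ge> 2\<close>.\<close>

definition hyp :: "'a::real_normed_vector \<Rightarrow> real" where
  "hyp z = sqrt (1 + (norm z)\<^sup>2)"

lemma hyp_bounds: "0 \<le> hyp z" "1 \<le> hyp z" "hyp z \<le> 1 + norm z"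
  by (auto simp: hyp_def intro!: real_le_lsqrt simp: power2_eq_square algebra_simps)

text \<open>
  The gap is that of the triangle inequality for the vectors \<open>(1, a)\<close> and \<open>(1, b)\<close>, whose Gram
  determinant is at least \<open>|a - b|\<^sup>2\<close>.
\<close>

lemma hyp_gap:
  fixes a b :: "'a::{real_normed_field,real_inner}"
  shows "0 \<le> hyp a + hyp b - 2 * hyp ((a + b) / 2)"
    and "(norm (a - b))\<^sup>2 \<le> 2 * (hyp a * hyp b) * (hyp a + hyp b) * (hyp a + hyp b - 2 * hyp ((a + b) / 2))"
proof -
  define A B C D where "A = hyp a" and "B = hyp b" and "C = 2 * hyp ((a + b) / 2)" and "D = 1 + inner a b"
  have A: "A\<^sup>2 = 1 + (norm a)\<^sup>2" and B: "B\<^sup>2 = 1 + (norm b)\<^sup>2" by (simp_all add: A_def B_def hyp_def)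
  have C: "C\<^sup>2 = 4 + (norm (a + b))\<^sup>2"
    by (simp add: C_def hyp_def power_mult_distrib norm_divide power_divide)
  have pos: "1 \<le> A" "1 \<le> B" "0 \<le> C" using hyp_bounds by (auto simp: A_def B_def C_def)
  have sum: "(norm (a + b))\<^sup>2 = (norm a)\<^sup>2 + (norm b)\<^sup>2 + 2 * inner a b"
    by (simp add: power2_norm_eq_inner inner_add_left inner_add_right inner_commute)
  have diff: "(norm (a - b))\<^sup>2 = (norm a)\<^sup>2 + (norm b)\<^sup>2 - 2 * inner a b"
    by (simp add: power2_norm_eq_inner inner_diff_left inner_diff_right inner_commute)
  have cs: "(inner a b)\<^sup>2 \<le> (norm a)\<^sup>2 * (norm b)\<^sup>2"
    using Cauchy_Schwarz_ineq[of a b] by (simp add: power2_norm_eq_inner)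
  \<comment> \<open>\<open>D\<close> is the inner product of \<open>(1, a)\<close> and
    \<open>(1, b)\<close>. The left side equals \<open>(norm (a - b))\<^sup>2\<close> plus the Gram
    determinant of \<open>a\<close> and \<open>b\<close>, which is nonnegative by
    Cauchy-Schwarz.\<close>
  have AB: "(A * B)\<^sup>2 - D\<^sup>2 \<ge> (norm (a - b))\<^sup>2"
    using cs by (simp add: power_mult_distrib A B D_def diff) (simp add: power2_eq_square algebra_simps)
  have AB0: "0 \<le> A * B" "0 \<le> A + B" using pos by (simp_all add: mult_nonneg_nonneg)
  have "D\<^sup>2 \<le> (A * B)\<^sup>2" using AB zero_le_power2[of "norm (a - b)"] by linarith
  then have DAB: "D \<le> A * B" by (rule power2_le_imp_le[OF _ AB0(1)])
  \<comment> \<open>\<open>A\<close>, \<open>B\<close> and \<open>C\<close> are the lengths of the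
    two vectors and of their sum.\<close>
  have ABC: "(A + B)\<^sup>2 - C\<^sup>2 = 2 * (A * B - D)"
    by (simp add: power2_sum[of A B] A B C D_def sum)
  moreover have "0 \<le> 2 * (A * B - D)" using DAB by simp
  ultimately have "0 \<le> (A + B)\<^sup>2 - C\<^sup>2" by (simp only:)
  then have "C\<^sup>2 \<le> (A + B)\<^sup>2" by (simp only: diff_ge_0_iff_ge)
  then have CAB: "C \<le> A + B" by (rule power2_le_imp_le[OF _ AB0(2)])
  then show "0 \<le> hyp a + hyp b - 2 * hyp ((a + b) / 2)" by (simp add: A_def B_def C_def)
  have "2 * (A * B - D) = (A + B - C) * (A + B + C)"
    using ABC by (simp add: power2_eq_square algebra_simps)
  also have "\<dots> \<le> (A + B - C) * (2 * (A + B))" using CAB by (intro mult_left_mono) auto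
  also have "\<dots> = 2 * ((A + B - C) * (A + B))" by (simp only: ac_simps)
  finally have 1: "A * B - D \<le> (A + B - C) * (A + B)" by (simp only: mult_le_cancel_left_pos zero_less_numeral)
  have "(norm (a - b))\<^sup>2 \<le> (A * B - D) * (A * B + D)"
    using AB by (simp add: power2_eq_square algebra_simps)
  also have "\<dots> \<le> (A * B - D) * (2 * (A * B))" using DAB by (intro mult_left_mono) auto
  also have "\<dots> \<le> ((A + B - C) * (A + B)) * (2 * (A * B))" using 1 pos by (intro mult_right_mono) auto
  also have "\<dots> = 2 * (A * B) * (A + B) * (A + B - C)" by (simp only: ac_simps)
  finally show "(norm (a - b))\<^sup>2 \<le> 2 * (hyp a * hyp b) * (hyp a + hyp b) * (hyp a + hyp b - 2 * hyp ((a + b) / 2))"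
    by (simp only: A_def B_def C_def)
qed

text \<open>There are three regimes. A difference of norm at most \<open>\<eta>\<close> goes into
  the first term. A larger one is at most \<open>(norm (a - b))\<^sup>2 / \<eta>\<close>, which the
  gap controls while both norms are at most \<open>T\<close>; the bound \<open>1 + T\<close> for
  \<open>hyp\<close> there produces the cube. If a norm exceeds \<open>T\<close>, the
  \<open>P\<close>-th powers dominate.\<close>

lemma norm_diff_le_hyp_gap:
  fixes a b :: "'a::{real_normed_field,real_inner}"
  assumes \<eta>: "0 < \<eta>" and T: "1 \<le> T" and P: "1 < P"
  shows "norm (a - b) \<le> \<eta> + 4 * (1 + T)^3 / \<eta> * (hyp a + hyp b - 2 * hyp ((a + b) / 2))
    + 2 * T powr (1 - P) * (norm a powr P + norm b powr P)"
proof (cases "norm a \<le> T \<and> norm b \<le> T")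
  case True
  let ?G = "hyp a + hyp b - 2 * hyp ((a + b) / 2)"
  have h: "hyp a \<le> 1 + T" "hyp b \<le> 1 + T" using hyp_bounds(3)[of a] hyp_bounds(3)[of b] True by auto
  have "(norm (a - b))\<^sup>2 \<le> 2 * (hyp a * hyp b) * (hyp a + hyp b) * ?G" by (rule hyp_gap)
  also have "\<dots> \<le> 2 * ((1 + T) * (1 + T)) * ((1 + T) + (1 + T)) * ?G"
    using h T hyp_gap(1)[of a b] hyp_bounds(1) by (intro mult_mono add_mono mult_nonneg_nonneg add_nonneg_nonneg) auto
  also have "\<dots> = 4 * (1 + T)^3 * ?G" by (simp add: power3_eq_cube)
  finally have sq: "(norm (a - b))\<^sup>2 \<le> 4 * (1 + T)^3 * ?G" .
  have "norm (a - b) \<le> \<eta> + (norm (a - b))\<^sup>2 / \<eta>"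
  proof (cases "norm (a - b) \<le> \<eta>")
    case True
    then show ?thesis using \<eta> by (intro add_increasing2) auto
  next
    case False
    then have "norm (a - b) * \<eta> \<le> (norm (a - b))\<^sup>2" by (simp add: power2_eq_square mult_left_mono)
    then have "norm (a - b) \<le> (norm (a - b))\<^sup>2 / \<eta>" using \<eta> by (simp add: field_simps)
    then show ?thesis using \<eta> by simp
  qed
  also have "(norm (a - b))\<^sup>2 / \<eta> \<le> 4 * (1 + T)^3 * ?G / \<eta>" using sq \<eta> by (intro divide_right_mono) auto
  finally have "norm (a - b) \<le> \<eta> + 4 * (1 + T)^3 / \<eta> * ?G" by simp
  moreover have "0 \<le> 2 * T powr (1 - P) * (norm a powr P + norm b powr P)" by simp
  ultimately show ?thesis by linarith
next
  case False
  define m where "m = max (norm a) (norm b)"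
  have m: "T < m" using False by (auto simp: m_def)
  have "norm (a - b) \<le> 2 * m" using norm_triangle_ineq4[of a b] by (simp add: m_def)
  also have "m = m powr (1 - P) * m powr P" using m T by (simp add: powr_add[symmetric])
  also have "m powr (1 - P) * m powr P \<le> T powr (1 - P) * (norm a powr P + norm b powr P)"
    using m T P by (intro mult_mono powr_mono2') (auto simp: m_def max_def)
  finally have "norm (a - b) \<le> 2 * T powr (1 - P) * (norm a powr P + norm b powr P)" by simp
  moreover have "0 \<le> 4 * (1 + T)^3 / \<eta> * (hyp a + hyp b - 2 * hyp ((a + b) / 2))"
    using \<eta> T hyp_gap(1)[of a b] by simp
  ultimately show ?thesis using \<eta> by linarith
qed

section \<open>The limit of a Cauchy sequence of functions\<close>

context exponents
begin

lemma LP_integrable: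
  fixes f :: "'a::{real_normed_field,banach,second_countable_topology} cube_fun"
  assumes "f \<in> LP"
  shows "integrable cube f" "integrable cube (\<lambda>x. hyp (f x))"
proof -
  interpret prob_space "unit_cube l" by (rule prob_space_unit_cube)
  have [measurable]: "f \<in> borel_measurable cube"
    and i: "integrable cube (\<lambda>x. norm (f x) powr P)"
    using assms P by (auto simp: Lp_space_finite)
  have i1: "integrable cube (\<lambda>x. 1 + norm (f x) powr P)" using i by simp
  have le: "norm (f x) \<le> norm (1 + norm (f x) powr P)" for x
    using powr_le_one_plus_powr[of "norm (f x)" 1 P] P by simp
  show "integrable cube f"
    by (rule Bochner_Integration.integrable_bound[OF i1]) (use le in auto)
  then have i2: "integrable cube (\<lambda>x. 1 + norm (f x))" by simp
  have m: "(\<lambda>x. hyp (f x)) \<in> borel_measurable cube" unfolding hyp_def by measurable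
  show "integrable cube (\<lambda>x. hyp (f x))"
    by (rule Bochner_Integration.integrable_bound[OF i2 m]) (simp add: abs_of_nonneg[OF hyp_bounds(1)] hyp_bounds(3))
qed

lemma L1_dist_le_hyp_gap:
  fixes f g :: "'a::{real_normed_field,euclidean_space} cube_fun"
  assumes f: "f \<in> Lp_ball cube p" and g: "g \<in> Lp_ball cube p"
    and \<eta>: "0 < \<eta>" and T: "1 \<le> T"
  shows "(\<integral>x. norm (f x - g x) \<partial>cube) \<le> \<eta> + 4 * (1 + T)^3 / \<eta> *
    ((\<integral>x. hyp (f x) \<partial>cube) + (\<integral>x. hyp (g x) \<partial>cube) - 2 * (\<integral>x. hyp ((f x + g x) / 2) \<partial>cube))
    + 4 * T powr (1 - P)"
proof -
  interpret prob_space "unit_cube l" by (rule prob_space_unit_cube)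
  have P1: "p = \<infinity> \<or> (\<exists>t\<ge>1. p = ennreal t)" using p P by (auto intro: exI[of _ P])
  have m: "(\<lambda>x. (f x + g x) / 2) \<in> LP" by (rule ball_pD(1)[OF Lp_ball_midpoint[OF f g P1]])
  note fL = ball_pD[OF f] and gL = ball_pD[OF g]
  have i: "integrable cube (\<lambda>x. norm (f x) powr P)" "integrable cube (\<lambda>x. norm (g x) powr P)"
    using fL gL P by (auto simp: Lp_space_finite)
  note h = LP_integrable(2)[OF fL(1)] LP_integrable(2)[OF gL(1)] LP_integrable(2)[OF m]
  let ?c = "4 * (1 + T)^3 / \<eta>"
  have "(\<integral>x. norm (f x - g x) \<partial>cube) \<le>
    (\<integral>x. \<eta> + ?c * (hyp (f x) + hyp (g x) - 2 * hyp ((f x + g x) / 2))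
      + 2 * T powr (1 - P) * (norm (f x) powr P + norm (g x) powr P) \<partial>cube)"
    using LP_integrable(1)[OF fL(1)] LP_integrable(1)[OF gL(1)] i h
    by (intro integral_mono norm_diff_le_hyp_gap[OF \<eta> T P]) auto
  also have "\<dots> = \<eta> + ?c * ((\<integral>x. hyp (f x) \<partial>cube) + (\<integral>x. hyp (g x) \<partial>cube)
      - 2 * (\<integral>x. hyp ((f x + g x) / 2) \<partial>cube))
    + 2 * T powr (1 - P) * ((\<integral>x. norm (f x) powr P \<partial>cube) + (\<integral>x. norm (g x) powr P \<partial>cube))"
    using i h prob_space by simp
  also have "2 * T powr (1 - P) * ((\<integral>x. norm (f x) powr P \<partial>cube) + (\<integral>x. norm (g x) powr P \<partial>cube))
      \<le> 2 * T powr (1 - P) * (1 + 1)"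
    using fL(2) gL(2) by (intro mult_left_mono add_mono) auto
  finally show ?thesis by simp
qed

text \<open>Closeness in \<open>L\<^sup>1\<close> suffices, because an \<open>L\<^sup>1\<close>
  bound is a cut bound and the \<open>P\<close>-th moments of differences of ball elements are
  bounded by \<open>2 powr P * 2\<close>.\<close>

lemma R_dist_le_of_L1_close:
  assumes e: "0 < e"
  obtains \<delta> where "0 < \<delta>"
    "\<And>f g :: 'a::{real_normed_field,euclidean_space} cube_fun. \<lbrakk>f \<in> Lp_ball cube p; g \<in> Lp_ball cube p;
      (\<integral>x. norm (f x - g x) \<partial>cube) \<le> \<delta>\<rbrakk> \<Longrightarrow> R_dist q l f g \<le> e"
proof -
  have P0: "P > 0" using P by simp
  obtain L where L: "0 < L" "\<And>(h :: 'a cube_fun) \<kappa>. \<lbrakk>h \<in> LP; (\<integral>x. norm (h x) powr P \<partial>cube) \<le> 2 powr P * 2; cut_bounded h \<kappa>\<rbrakk>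
      \<Longrightarrow> R_norm q l h \<le> L * \<kappa> + e / 2"
    using R_norm_le_cut_bound[of "2 powr P * 2" "e / 2", where 'a = 'a] e by auto
  show thesis
  proof (rule that[of "e / (2 * L)"])
    show "0 < e / (2 * L)" using e L by simp
    fix f g :: "'a cube_fun"
    assume f: "f \<in> Lp_ball cube p" and g: "g \<in> Lp_ball cube p"
      and le: "(\<integral>x. norm (f x - g x) \<partial>cube) \<le> e / (2 * L)"
    note D = Lp_space_diff[OF P0 ball_pD(1)[OF f] ball_pD(1)[OF g]]
    have "2 powr P * ((\<integral>x. norm (f x) powr P \<partial>cube) + (\<integral>x. norm (g x) powr P \<partial>cube)) \<le> 2 powr P * (1 + 1)"
      by (intro mult_left_mono add_mono ball_pD(2) f g) simp
    from order_trans[OF D(2) this] have B: "(\<integral>x. norm (f x - g x) powr P \<partial>cube) \<le> 2 powr P * 2"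
      by (simp only: one_add_one)
    have "R_norm q l (\<lambda>x. f x - g x) \<le> L * (e / (2 * L)) + e / 2"
      by (rule L(2)[OF D(1) B cut_boundedI[OF LP_integrable(1)[OF D(1)] le]])
    also have "\<dots> = e" using L(1) by simp
    finally show "R_dist q l f g \<le> e" by (simp add: R_dist_def)
  qed
qed

text \<open>\<open>V n\<close> is the infimum of the functional over the constraint set
  \<open>C n\<close>. The sets decrease, so \<open>V\<close> increases, and being bounded it
  converges. Midpoints of near minimisers stay in the set, where the functional cannot fall below
  \<open>V n\<close>; this forces the convexity gap to 0, and the gap controls the
  \<open>L\<^sup>1\<close> distance.\<close>

lemma R_dist_complete:
  fixes h :: "nat \<Rightarrow> 'a::{real_normed_field,euclidean_space} cube_fun"
  assumes h: "range h \<subseteq> Lp_ball cube p" and \<epsilon>: "\<epsilon> \<longlonglongrightarrow> 0"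
    and cauchy: "\<And>k i j. k \<le> i \<Longrightarrow> k \<le> j \<Longrightarrow> R_dist q l (h i) (h j) \<le> \<epsilon> k"
  shows "\<exists>f\<in>Lp_ball cube p. (\<lambda>n. R_dist q l (h n) f) \<longlonglongrightarrow> 0"
proof -
  define M where "M = unit_cube l"
  interpret M: prob_space M unfolding M_def by (rule prob_space_unit_cube)
  have P0: "P > 0" using P by simp
  have P1: "p = \<infinity> \<or> (\<exists>t\<ge>1. p = ennreal t)" using p P by (auto intro: exI[of _ P])
  let ?X = "Lp_ball cube p :: ('a cube_fun) set"
  have hX: "h n \<in> ?X" for n using h by blast
  note pm = pseudometric_R_dist[where 'a = 'a, unfolded pseudometric_on_def]
  have tri: "R_dist q l f f'' \<le> R_dist q l f f' + R_dist q l f' f''" if "f \<in> ?X" "f' \<in> ?X" "f'' \<in> ?X" for f f' f''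
    using pm ball_pD(1)[OF that(1)] ball_pD(1)[OF that(2)] ball_pD(1)[OF that(3)] by blast
  have R0: "0 \<le> R_dist q l f f'" if "f \<in> ?X" "f' \<in> ?X" for f f'
    using pm ball_pD(1)[OF that(1)] ball_pD(1)[OF that(2)] by blast
  define C where "C n = {g \<in> ?X. \<forall>k\<le>n. \<forall>j\<ge>k. R_dist q l (h j) g \<le> \<epsilon> k}" for n
  have hC: "h n \<in> C n" for n using hX cauchy by (auto simp: C_def)
  have CX: "C n \<subseteq> ?X" for n by (auto simp: C_def)
  have Cmono: "C m \<subseteq> C n" if "n \<le> m" for m n using that by (auto simp: C_def)
  have Cmid: "(\<lambda>x. (f x + g x) / 2) \<in> C n" if f: "f \<in> C n" and g: "g \<in> C n" for f g n
  proof -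
    have fX: "f \<in> ?X" and gX: "g \<in> ?X" using f g CX by blast+
    have m: "(\<lambda>x. (f x + g x) / 2) \<in> ?X" by (rule Lp_ball_midpoint[OF fX gX P1])
    have "R_dist q l (h j) (\<lambda>x. (f x + g x) / 2) \<le> \<epsilon> k" if "k \<le> n" "k \<le> j" for k j
    proof -
      note df = Lp_space_diff(1)[OF P0 ball_pD(1)[OF hX[of j]] ball_pD(1)[OF fX]]
      note dg = Lp_space_diff(1)[OF P0 ball_pD(1)[OF hX[of j]] ball_pD(1)[OF gX]]
      note s = Lp_space_add(1)[OF P0 df dg]
      have "(\<lambda>x. h j x - (f x + g x) / 2) = (\<lambda>x. (1 / 2) * ((h j x - f x) + (h j x - g x)))"
        by (simp add: fun_eq_iff field_simps)
      then have "R_dist q l (h j) (\<lambda>x. (f x + g x) / 2) \<le> norm (1 / 2 :: 'a) * R_norm q l (\<lambda>x. (h j x - f x) + (h j x - g x))"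
        using R_norm_cmult[OF s, of "1 / 2"] by (simp only: R_dist_def)
      also have "\<dots> \<le> 1 / 2 * (R_dist q l (h j) f + R_dist q l (h j) g)"
        using R_norm_add[OF df dg] by (simp add: R_dist_def norm_divide)
      also have "\<dots> \<le> 1 / 2 * (\<epsilon> k + \<epsilon> k)"
        using f g that by (intro mult_left_mono add_mono) (auto simp: C_def)
      finally show ?thesis by simp
    qed
    then show ?thesis using m by (simp add: C_def)
  qed
  define \<Phi> where "\<Phi> g = (\<integral>x. hyp (g x) \<partial>cube)" for g :: "'a cube_fun"
  have \<Phi>0: "0 \<le> \<Phi> g" for g unfolding \<Phi>_def by (intro integral_nonneg_AE AE_I2 hyp_bounds(1))
  define V where "V n = (INF g\<in>C n. \<Phi> g)" for n
  have bdd: "bdd_below (\<Phi> ` C n)" for n by (rule bdd_belowI2[OF \<Phi>0])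
  have VC: "V n \<le> \<Phi> g" if "g \<in> C n" for g n
    unfolding V_def by (rule cINF_lower[OF bdd that])
  have Vinc: "V n \<le> V m" if "n \<le> m" for n m
    unfolding V_def[of m] using hC[of m] Cmono[OF that] VC by (intro cINF_greatest) auto
  \<comment> \<open>3 is 2 plus the bound 1 for the integral of
    \<open>norm (f x) powr P\<close>.\<close>
  have \<Phi>3: "\<Phi> f \<le> 3" if f: "f \<in> ?X" for f
  proof -
    have i: "integrable M (\<lambda>x. norm (f x) powr P)"
      using ball_pD(1)[OF f] P by (simp add: Lp_space_finite M_def)
    have i2: "integrable M (\<lambda>x. 2 + norm (f x) powr P)" using i by simp
    have le: "hyp (f x) \<le> 2 + norm (f x) powr P" for x
      using hyp_bounds(3)[of "f x"] powr_le_one_plus_powr[of "norm (f x)" 1 P] P by simp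
    have "\<Phi> f \<le> (\<integral>x. 2 + norm (f x) powr P \<partial>M)"
      unfolding \<Phi>_def M_def[symmetric]
      by (rule integral_mono[OF LP_integrable(2)[OF ball_pD(1)[OF f], folded M_def] i2 le])
    also have "\<dots> = 2 + (\<integral>x. norm (f x) powr P \<partial>M)" using i M.prob_space by simp
    finally show ?thesis using ball_pD(2)[OF f] by (simp add: M_def)
  qed
  have "V n \<le> 3" for n using VC[OF hC] \<Phi>3[OF hX] by (rule order_trans)
  then obtain v where Vv: "V \<longlonglongrightarrow> v" and "\<And>n. V n \<le> v"
    using incseq_convergent[of V 3] Vinc by (auto simp: incseq_def)
  define \<rho> where "\<rho> n = inverse (real (Suc n))" for n
  have "\<exists>g\<in>C n. \<Phi> g < V n + \<rho> n" for n
  proof -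
    have "(INF g\<in>C n. \<Phi> g) < V n + \<rho> n" by (simp add: V_def \<rho>_def)
    then show ?thesis using hC[of n] bdd[of n] by (subst (asm) cINF_less_iff) auto
  qed
  then obtain g where gC: "\<And>n. g n \<in> C n" and g\<Phi>: "\<And>n. \<Phi> (g n) < V n + \<rho> n" by metis
  have gX: "g n \<in> ?X" for n using gC CX by blast
  \<comment> \<open>\<open>v - V n\<close> bounds the rise of the infima beyond index
    \<open>n\<close>, and \<open>\<rho> n\<close> the amount by which the \<open>g i\<close> with
    \<open>i \<ge> n\<close> miss them.\<close>
  define \<gamma> where "\<gamma> n = (v - V n) + \<rho> n" for n
  have gap: "\<Phi> (g i) + \<Phi> (g j) - 2 * \<Phi> (\<lambda>x. (g i x + g j x) / 2) \<le> 2 * \<gamma> n" if "n \<le> i" "n \<le> j" for i j n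
  proof -
    have "g i \<in> C n" "g j \<in> C n" using gC Cmono that by blast+
    then have 1: "V n \<le> \<Phi> (\<lambda>x. (g i x + g j x) / 2)" by (intro VC Cmid)
    have 2: "\<rho> i \<le> \<rho> n" "\<rho> j \<le> \<rho> n"
      using that by (simp_all add: \<rho>_def)
    have arith: "a + b - 2 * c \<le> 2 * ((w - d) + t)"
      if "d \<le> c" "t1 \<le> t" "t2 \<le> t" "a < d1 + t1" "b < d2 + t2" "d1 \<le> w" "d2 \<le> w"
      for a b c d w t t1 t2 d1 d2 :: real
      using that by (simp add: algebra_simps)
    show ?thesis unfolding \<gamma>_def
      by (rule arith[OF 1 2 g\<Phi>[of i] g\<Phi>[of j] \<open>\<And>n. V n \<le> v\<close>[of i] \<open>\<And>n. V n \<le> v\<close>[of j]])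
  qed
  have "(\<lambda>n. (v - V n) + \<rho> n) \<longlonglongrightarrow> (v - v) + 0"
    unfolding \<rho>_def by (intro tendsto_intros Vv LIMSEQ_inverse_real_of_nat)
  then have \<gamma>0: "\<gamma> \<longlonglongrightarrow> 0" by (simp add: \<gamma>_def[abs_def])
  \<comment> \<open>Each of the three terms of \<open>L1_dist_le_hyp_gap\<close> gets
    \<open>e / 3\<close>: \<open>\<eta>\<close> directly, the moment term through \<open>T\<close>,
    and the gap term through \<open>N\<close>, which is chosen after \<open>T\<close>.\<close>
  have L1: "\<exists>N. \<forall>i\<ge>N. \<forall>j\<ge>N. (\<integral>x. norm (g i x - g j x) \<partial>M) < e" if e: "e > 0" for e
  proof -
    have "((\<lambda>t. 4 * t powr (1 - P)) \<longlongrightarrow> 4 * 0) at_top"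
      using P by (intro tendsto_mult tendsto_const tendsto_neg_powr filterlim_ident) auto
    then have "\<forall>\<^sub>F t in at_top. 4 * t powr (1 - P) < e / 3" using e by (intro order_tendstoD) auto
    then have "\<forall>\<^sub>F t in at_top. 4 * t powr (1 - P) < e / 3 \<and> 1 \<le> t"
      using eventually_ge_at_top[of "1::real"] by eventually_elim auto
    then obtain T where T: "4 * T powr (1 - P) < e / 3" "1 \<le> T" by (auto dest: eventually_happens)
    define c where "c = 4 * (1 + T)^3 / (e / 3)"
    have c: "0 < c" using T e by (simp add: c_def)
    have "\<forall>\<^sub>F n in sequentially. \<gamma> n < e / (6 * c)" using \<gamma>0 e c by (intro order_tendstoD) auto
    then obtain N where "\<gamma> N < e / (6 * c)" by (auto simp: eventually_sequentially)
    then have cN: "c * (2 * \<gamma> N) < e / 3" using c by (simp add: field_simps)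
    have "(\<integral>x. norm (g i x - g j x) \<partial>M) < e" if ij: "N \<le> i" "N \<le> j" for i j
    proof -
      have "(\<integral>x. norm (g i x - g j x) \<partial>M) \<le> e / 3 + c * (\<Phi> (g i) + \<Phi> (g j) - 2 * \<Phi> (\<lambda>x. (g i x + g j x) / 2)) + 4 * T powr (1 - P)"
        using L1_dist_le_hyp_gap[OF gX[of i] gX[of j] _ T(2), of "e / 3"] e by (simp add: M_def \<Phi>_def c_def)
      also have "c * (\<Phi> (g i) + \<Phi> (g j) - 2 * \<Phi> (\<lambda>x. (g i x + g j x) / 2)) \<le> c * (2 * \<gamma> N)"
        using gap[OF ij] c by (intro mult_left_mono) auto
      finally show ?thesis using cN T by linarith
    qed
    then show ?thesis by blast
  qed
  have gi: "integrable M (g n)" for n unfolding M_def by (rule LP_integrable(1)[OF ball_pD(1)[OF gX]])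
  obtain f s where fm: "f \<in> borel_measurable M" and s: "strict_mono s"
    and lim: "AE x in M. (\<lambda>k. g (s k) x) \<longlonglongrightarrow> f x"
    using L1_Cauchy_AE_convergent_subseq[OF gi L1] by blast
  have fX: "f \<in> ?X"
    by (rule Lp_ball_AE_limit[OF gX exponent_cases(1) fm[unfolded M_def] lim[unfolded M_def]])
  have fL1: "\<exists>N. \<forall>i\<ge>N. (\<integral>x. norm (g i x - f x) \<partial>M) \<le> e" if e: "e > 0" for e
  proof -
    obtain N where N: "\<And>i j. i \<ge> N \<Longrightarrow> j \<ge> N \<Longrightarrow> (\<integral>x. norm (g i x - g j x) \<partial>M) < e" using L1[OF e] by blast
    have "(\<integral>x. norm (g i x - f x) \<partial>M) \<le> e" if i: "i \<ge> N" for i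
    proof (rule Fatou_bound(2)[where u = "\<lambda>k x. norm (g i x - g (s k) x)"])
      show "AE x in M. (\<lambda>k. norm (g i x - g (s k) x)) \<longlonglongrightarrow> norm (g i x - f x)"
        using lim by eventually_elim (intro tendsto_intros)
      have "k \<ge> N \<Longrightarrow> s k \<ge> N" for k using seq_suble[OF s, of k] by linarith
      then show "\<forall>\<^sub>F k in sequentially. (\<integral>x. norm (g i x - g (s k) x) \<partial>M) \<le> e"
        unfolding eventually_sequentially using N[OF i] by (intro exI[of _ N]) (auto intro: less_imp_le)
    qed (use gi fm in auto)
    then show ?thesis by blast
  qed
  \<comment> \<open>For \<open>n \<ge> j\<close> the function \<open>g n\<close> obeys the
    constraint with index \<open>j\<close>, and this passes to the \<open>L\<^sup>1\<close> limit
    \<open>f\<close>.\<close>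
  have final: "R_dist q l (h j) f \<le> \<epsilon> j" for j
  proof (rule field_le_epsilon)
    fix e :: real assume e: "0 < e"
    obtain \<delta> where \<delta>: "0 < \<delta>" "\<And>f g :: 'a cube_fun. \<lbrakk>f \<in> ?X; g \<in> ?X;
      (\<integral>x. norm (f x - g x) \<partial>cube) \<le> \<delta>\<rbrakk> \<Longrightarrow> R_dist q l f g \<le> e"
      using R_dist_le_of_L1_close[OF e, where 'a = 'a] by blast
    obtain N where N: "\<And>i. i \<ge> N \<Longrightarrow> (\<integral>x. norm (g i x - f x) \<partial>M) \<le> \<delta>" using fL1[OF \<delta>(1)] by blast
    define n where "n = max N j"
    have "R_dist q l (h j) f \<le> R_dist q l (h j) (g n) + R_dist q l (g n) f" by (rule tri[OF hX gX fX])
    also have "R_dist q l (h j) (g n) \<le> \<epsilon> j" using gC[of n] by (simp add: C_def n_def)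
    also have "R_dist q l (g n) f \<le> e" using N[of n] by (intro \<delta>(2) gX fX) (simp add: n_def M_def)
    finally show "R_dist q l (h j) f \<le> \<epsilon> j + e" by simp
  qed
  have "(\<lambda>n. R_dist q l (h n) f) \<longlonglongrightarrow> 0"
    by (rule real_tendsto_sandwich[OF _ _ tendsto_const \<epsilon>]) (use R0[OF hX fX] final in auto)
  then show ?thesis using fX by blast
qed

end

section \<open>Weak regularity\<close>

text \<open>As the nearest point map of a convex set it is 1-Lipschitz, and it fixes the ball of
  radius \<open>M\<close>. Hence it never increases the distance to a point of that ball.\<close>

definition cap :: "real \<Rightarrow> 'a::euclidean_space \<Rightarrow> 'a" where
  "cap M = closest_point (cball 0 M)"

lemma cap_lipschitz: "0 \<le> M \<Longrightarrow> norm (cap M y - cap M z) \<le> norm (y - z)"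
  using closest_point_lipschitz[of "cball 0 M" y z] by (simp add: cap_def dist_norm)

lemma norm_cap_le: "0 \<le> M \<Longrightarrow> norm (cap M z) \<le> M"
  using closest_point_in_set[of "cball 0 M" z] by (simp add: cap_def)

lemma cap_id: "norm z \<le> M \<Longrightarrow> cap M z = z"
  unfolding cap_def by (rule closest_point_self) simp

lemma borel_measurable_cap [measurable]: "0 \<le> M \<Longrightarrow> cap M \<in> borel_measurable borel"
  unfolding cap_def
  by (intro borel_measurable_continuous_onI continuous_on_closest_point) auto

text \<open>
  Capping after every step keeps the approximants bounded by \<open>M\<close> independently of the number of
  steps, as the choice of the number of steps depends on the bound.
\<close>

fun capped_sum :: "nat \<Rightarrow> real \<Rightarrow> (nat \<Rightarrow> 'a) \<Rightarrow> (nat \<Rightarrow> nat \<Rightarrow> real \<Rightarrow> 'a) \<Rightarrow> nat \<Rightarrow> (nat \<Rightarrow> real) \<Rightarrow>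
    'a::{real_normed_field,euclidean_space}" where
  "capped_sum l M t w 0 x = 0"
| "capped_sum l M t w (Suc n) x = cap M (capped_sum l M t w n x + t n * tensor l (w n) x)"

lemma norm_capped_sum_le: "0 \<le> M \<Longrightarrow> norm (capped_sum l M t w n x) \<le> M"
  by (cases n) (auto simp: norm_cap_le)

lemma capped_sum_cong:
  "(\<And>j. j < n \<Longrightarrow> t j = t' j) \<Longrightarrow> (\<And>j. j < n \<Longrightarrow> w j = w' j) \<Longrightarrow>
    capped_sum l M t w n x = capped_sum l M t' w' n x"
  by (induction n) auto

text \<open>As \<open>cap\<close> is 1-Lipschitz, the errors of the single terms add up without
  being amplified. Two evaluation points are allowed because the rounded sum will be read at a
  rearranged point.\<close>

lemma capped_sum_diff_le:
  assumes "0 \<le> M"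
  shows "norm (capped_sum l M t w n x - capped_sum l M t' w' n x') \<le>
    (\<Sum>j<n. norm (t j * tensor l (w j) x - t' j * tensor l (w' j) x'))"
proof (induction n)
  case (Suc n)
  let ?a = "capped_sum l M t w n x" and ?a' = "capped_sum l M t' w' n x'"
  let ?b = "t n * tensor l (w n) x" and ?b' = "t' n * tensor l (w' n) x'"
  have "norm (cap M (?a + ?b) - cap M (?a' + ?b')) \<le> norm ((?a + ?b) - (?a' + ?b'))"
    by (rule cap_lipschitz[OF assms])
  also have "\<dots> \<le> norm (?a - ?a') + norm (?b - ?b')"
    using norm_triangle_ineq[of "?a - ?a'" "?b - ?b'"] by (simp add: algebra_simps)
  finally show ?case using Suc by simp
qed simp

lemma borel_measurable_capped_sum:
  assumes M: "0 \<le> M" and w: "\<And>j i. i < l \<Longrightarrow> w j i \<in> borel_measurable unit_interval"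
  shows "capped_sum l M t w n \<in> borel_measurable (unit_cube l)"
proof (induction n)
  case (Suc n)
  have [measurable]: "tensor l (w n) \<in> borel_measurable (unit_cube l)"
    by (rule borel_measurable_tensor) (rule w)
  note [measurable] = Suc borel_measurable_cap[OF M]
  have "(\<lambda>x. cap M (capped_sum l M t w n x + t n * tensor l (w n) x)) \<in> borel_measurable (unit_cube l)"
    by measurable
  then show ?case by simp
qed simp

text \<open>This is complex conjugation, stated for real and complex scalars at once (\<open>conjugate 0 = 0\<close>).\<close>

definition conjugate :: "'a::real_normed_field \<Rightarrow> 'a" where
  "conjugate z = of_real ((norm z)\<^sup>2) / z"

lemma norm_conjugate [simp]: "norm (conjugate z) = norm z"
  by (cases "z = 0") (simp_all add: conjugate_def norm_divide norm_power power2_eq_square norm_mult)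

text \<open>The conjugate of a test product is again a tensor product and so can serve as an
  increment of the approximant.\<close>

lemma tensor_conjugate: "tensor l (\<lambda>i y. conjugate (r i y)) x = conjugate (tensor l r x)"
  by (simp add: tensor_def conjugate_def prod_dividef prod_norm[symmetric] prod_power_distrib)

text \<open>Polarisation derives this from multiplicativity of the norm alone, without a case
  distinction between real and complex scalars.\<close>

lemma inner_mult_mult:
  fixes z u v :: "'a::{real_normed_field,real_inner}"
  shows "inner (z * u) (z * v) = (norm z)\<^sup>2 * inner u v"
  unfolding dot_norm distrib_left[symmetric] norm_mult power_mult_distrib by (simp add: algebra_simps)

text \<open>Multiplication by \<open>conjugate z\<close> is the adjoint of multiplication by
  \<open>z\<close>: multiplying both arguments by \<open>z\<close> makes the second one a real
  multiple of \<open>v\<close>.\<close>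

lemma inner_conjugate:
  fixes z u v :: "'a::{real_normed_field,real_inner}"
  shows "inner u (v * conjugate z) = inner (z * u) v"
proof (cases "z = 0")
  case False
  have "(norm z)\<^sup>2 * inner u (v * conjugate z) = inner (z * u) (z * (v * conjugate z))"
    by (rule inner_mult_mult[symmetric])
  also have "z * (v * conjugate z) = (norm z)\<^sup>2 *\<^sub>R v"
    using False by (simp add: conjugate_def scaleR_conv_of_real)
  also have "inner (z * u) ((norm z)\<^sup>2 *\<^sub>R v) = (norm z)\<^sup>2 * inner (z * u) v" by simp
  finally show ?thesis using False by simp
qed (simp add: conjugate_def)

text \<open>The points of the net are numbered so that rounding to the first net point within
  \<open>\<delta>\<close> is a definite map with finitely many values on the ball; its measurability
  is then easy to see.\<close>

lemma finite_net_cball: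
  fixes R :: real
  assumes "0 \<le> R" "0 < \<delta>"
  obtains d :: "nat \<Rightarrow> 'a::euclidean_space" and s where
    "\<And>n. n < s \<Longrightarrow> norm (d n) \<le> R"
    "\<And>z. norm z \<le> R \<Longrightarrow> (LEAST n. norm (z - d n) \<le> \<delta>) < s \<and> norm (z - d (LEAST n. norm (z - d n) \<le> \<delta>)) \<le> \<delta>"
proof -
  obtain K where K: "finite K" "K \<subseteq> cball (0::'a) R" "cball 0 R \<subseteq> (\<Union>x\<in>K. ball x \<delta>)"
    using seq_compact_imp_totally_bounded[OF compact_imp_seq_compact[OF compact_cball], rule_format, OF assms(2), of "0::'a" R]
    by (elim exE conjE) (rule that)
  obtain xs where xs: "set xs = K" using finite_list[OF K(1)] by blast
  define s where "s = length xs"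
  show thesis
  proof (rule that[of s "\<lambda>n. xs ! n"])
    show "norm (xs ! n) \<le> R" if "n < s" for n
      using that K(2) xs by (auto simp: s_def subset_iff)
    fix z :: 'a assume "norm z \<le> R"
    then obtain x where x: "x \<in> K" "z \<in> ball x \<delta>" using K(3) by (auto simp: subset_iff)
    then obtain k where k: "k < s" "xs ! k = x" using xs by (metis in_set_conv_nth s_def)
    then have "norm (z - xs ! k) \<le> \<delta>" using x by (simp add: dist_norm norm_minus_commute)
    then show "(LEAST n. norm (z - xs ! n) \<le> \<delta>) < s \<and> norm (z - xs ! (LEAST n. norm (z - xs ! n) \<le> \<delta>)) \<le> \<delta>"
      using Least_le[of "\<lambda>n. norm (z - xs ! n) \<le> \<delta>" k] LeastI[of "\<lambda>n. norm (z - xs ! n) \<le> \<delta>" k] k(1)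
      by auto
  qed
qed

lemma term_rounding_le:
  fixes t t' :: "'a::real_normed_field"
  assumes "norm t \<le> B" "norm (t - t') \<le> \<delta>" "0 \<le> \<delta>"
    and "\<And>i. i < l \<Longrightarrow> norm (w i (x i)) \<le> 1" "\<And>i. i < l \<Longrightarrow> norm (w' i (x' i)) \<le> 1"
    and "\<And>i. i < l \<Longrightarrow> norm (w i (x i) - w' i (x' i)) \<le> \<delta>"
  shows "norm (t * tensor l w x - t' * tensor l w' x') \<le> (1 + B * l) * \<delta>"
proof -
  have "norm (tensor l w x - tensor l w' x') \<le> (\<Sum>i<l. norm (w i (x i) - w' i (x' i)))"
    unfolding tensor_def using assms by (intro norm_prod_diff) auto
  also have "\<dots> \<le> (\<Sum>i<l. \<delta>)" using assms by (intro sum_mono) auto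
  finally have d: "norm (tensor l w x - tensor l w' x') \<le> l * \<delta>" by simp
  have t1: "norm (tensor l w' x') \<le> 1"
    unfolding tensor_def prod_norm[symmetric] using assms by (intro prod_le_1) auto
  have "t * tensor l w x - t' * tensor l w' x' = t * (tensor l w x - tensor l w' x') + (t - t') * tensor l w' x'"
    by (simp add: algebra_simps)
  also have "norm \<dots> \<le> norm t * norm (tensor l w x - tensor l w' x') + norm (t - t') * norm (tensor l w' x')"
    by (rule order_trans[OF norm_triangle_ineq]) (simp add: norm_mult)
  also have "\<dots> \<le> B * (l * \<delta>) + \<delta> * 1"
    using assms d t1 order_trans[OF norm_ge_zero assms(1)] by (intro add_mono mult_mono) auto
  finally show ?thesis by (simp add: algebra_simps)
qed

lemma measurable_cell [measurable]: "cell m \<in> measurable unit_interval (count_space UNIV)"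
proof -
  have "(\<lambda>x. x) \<in> borel_measurable unit_interval"
    by (intro measurable_restrict_space1 measurable_completion) simp
  then have "(\<lambda>x. \<lfloor>real m * x\<rfloor>) \<in> measurable unit_interval (count_space UNIV)" by measurable
  from measurable_compose[OF this, of nat "count_space UNIV"] show ?thesis
    by (simp add: cell_def[abs_def])
qed

section \<open>Energy decrement and a finite net for its outcomes\<close>

context exponents
begin

lemma cut_bounded_add:
  fixes f g :: "'a::{real_normed_field,banach,second_countable_topology} cube_fun"
  assumes "cut_bounded f \<kappa>" "cut_bounded g \<mu>" "integrable cube f" "integrable cube g"
  shows "cut_bounded (\<lambda>x. f x + g x) (\<kappa> + \<mu>)"
  unfolding cut_bounded_def
proof (intro allI impI)
  fix r :: "nat \<Rightarrow> real \<Rightarrow> 'a"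
  assume r: "\<forall>i<l. r i \<in> borel_measurable unit_interval \<and> (\<forall>x. norm (r i x) \<le> 1)"
  have [measurable]: "tensor l r \<in> borel_measurable cube"
    using r by (auto intro: borel_measurable_tensor)
  have t: "norm (tensor l r x * h x) \<le> norm (h x)" for x h
    using norm_tensor_le_1[of l r x] r by (simp add: norm_mult mult_left_le_one_le)
  have i: "integrable cube (\<lambda>x. tensor l r x * h x)" if h: "integrable cube h" for h
  proof (rule Bochner_Integration.integrable_bound[OF h])
    show "(\<lambda>x. tensor l r x * h x) \<in> borel_measurable cube" using h by measurable
  qed (use t in auto)
  have "(\<integral>x. tensor l r x * (f x + g x) \<partial>cube) =
      (\<integral>x. tensor l r x * f x \<partial>cube) + (\<integral>x. tensor l r x * g x \<partial>cube)"
    using i[OF assms(3)] i[OF assms(4)] by (simp add: distrib_left)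
  moreover have "norm (\<integral>x. tensor l r x * f x \<partial>cube) \<le> \<kappa>"
    and "norm (\<integral>x. tensor l r x * g x \<partial>cube) \<le> \<mu>"
    using assms(1,2) r unfolding cut_bounded_def by blast+
  ultimately show "norm (\<integral>x. tensor l r x * (f x + g x) \<partial>cube) \<le> \<kappa> + \<mu>"
    by (simp add: norm_triangle_mono)
qed

text \<open>Failure of the cut bound supplies a tensor product \<open>z\<close> whose pairing
  \<open>t\<close> with the error \<open>f - a\<close> exceeds \<open>\<kappa>\<close> in norm. A
  step by \<open>t * conjugate z\<close> removes twice \<open>(norm t)\<^sup>2\<close> from the
  energy through the cross term and adds at most \<open>(norm t)\<^sup>2\<close> through the
  quadratic term.\<close>

lemma capped_greedy_step:
  fixes f a :: "'a::{real_normed_field,euclidean_space} cube_fun"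
  assumes M: "0 \<le> M"
    and f: "f \<in> borel_measurable cube" "\<And>x. norm (f x) \<le> M"
    and a: "a \<in> borel_measurable cube" "\<And>x. norm (a x) \<le> M"
    and nc: "\<not> cut_bounded (\<lambda>x. f x - a x) \<kappa>" and \<kappa>: "0 \<le> \<kappa>"
  obtains t w where "norm t \<le> 2 * M" "\<And>i. i < l \<Longrightarrow> w i \<in> borel_measurable unit_interval"
    "\<And>i y. norm (w i y) \<le> 1"
    "(\<integral>x. (norm (f x - cap M (a x + t * tensor l w x)))\<^sup>2 \<partial>cube) \<le>
      (\<integral>x. (norm (f x - a x))\<^sup>2 \<partial>cube) - \<kappa>\<^sup>2"
proof -
  interpret prob_space "unit_cube l" by (rule prob_space_unit_cube)
  note [measurable] = f(1) a(1) borel_measurable_cap[OF M]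
  obtain r0 :: "nat \<Rightarrow> real \<Rightarrow> 'a"
    where r0: "\<forall>i<l. r0 i \<in> borel_measurable unit_interval \<and> (\<forall>x. norm (r0 i x) \<le> 1)"
      and big0: "\<kappa> < norm (\<integral>x. tensor l r0 x * (f x - a x) \<partial>cube)"
    using nc unfolding cut_bounded_def by (auto simp: not_le)
  \<comment> \<open>Factors with index at least \<open>l\<close> do not enter the product; setting
    them to 0 makes the bound by 1 hold for every index, as the conclusion asks.\<close>
  define r where "r i = (if i < l then r0 i else (\<lambda>_. 0))" for i
  have tr: "tensor l r = tensor l r0" by (simp add: tensor_def[abs_def] r_def)
  have rm: "r i \<in> borel_measurable unit_interval" if "i < l" for i using r0 that by (simp add: r_def)
  have r1: "norm (r i x) \<le> 1" for i x using r0 by (simp add: r_def)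
  define z where "z = tensor l r"
  have [measurable]: "z \<in> borel_measurable cube"
    unfolding z_def by (rule borel_measurable_tensor) (rule rm)
  have z1: "norm (z x) \<le> 1" for x unfolding z_def by (rule norm_tensor_le_1) (rule r1)
  have fa: "norm (f x - a x) \<le> 2 * M" for x
    using norm_triangle_ineq4[of "f x" "a x"] f(2)[of x] a(2)[of x] by linarith
  have zfa: "norm (z x * (f x - a x)) \<le> 2 * M" for x
    using mult_mono[OF z1 fa] by (simp add: norm_mult)
  have iz: "integrable cube (\<lambda>x. z x * (f x - a x))"
    by (rule integrable_const_bound[of _ "2 * M"]) (use zfa in auto)
  define t where "t = (\<integral>x. z x * (f x - a x) \<partial>cube)"
  define w where "w i y = conjugate (r i y)" for i y
  have wt: "tensor l w x = conjugate (z x)" for x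
    unfolding w_def z_def by (rule tensor_conjugate)
  have wm: "w i \<in> borel_measurable unit_interval" if "i < l" for i
    using rm[OF that] unfolding w_def conjugate_def by measurable
  have "norm t \<le> (\<integral>x. norm (z x * (f x - a x)) \<partial>cube)"
    unfolding t_def by (rule integral_norm_bound)
  also have "\<dots> \<le> (\<integral>x. 2 * M \<partial>cube)" using iz zfa by (intro integral_mono) auto
  finally have t2: "norm t \<le> 2 * M" using prob_space by simp
  \<comment> \<open>\<open>f x\<close> is fixed by \<open>cap\<close>, so capping cannot increase
    the error. After expanding the square, \<open>inner_conjugate\<close> turns the cross term into
    one whose integral is \<open>(norm t)\<^sup>2\<close>.\<close>
  have pt: "(norm (f x - cap M (a x + t * tensor l w x)))\<^sup>2 \<le>
      (norm (f x - a x))\<^sup>2 - 2 * inner (z x * (f x - a x)) t + (norm t)\<^sup>2" for x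
  proof -
    have "norm (f x - cap M (a x + t * tensor l w x)) = norm (cap M (f x) - cap M (a x + t * tensor l w x))"
      by (simp add: cap_id f(2))
    also have "\<dots> \<le> norm (f x - (a x + t * tensor l w x))" by (rule cap_lipschitz[OF M])
    finally have "(norm (f x - cap M (a x + t * tensor l w x)))\<^sup>2 \<le> (norm (f x - (a x + t * tensor l w x)))\<^sup>2"
      by (rule power_mono) simp
    also have "\<dots> = (norm ((f x - a x) - t * conjugate (z x)))\<^sup>2" by (simp add: wt diff_diff_eq)
    also have "\<dots> = (norm (f x - a x))\<^sup>2 - 2 * inner (f x - a x) (t * conjugate (z x)) + (norm (t * conjugate (z x)))\<^sup>2"
      unfolding power2_norm_eq_inner by (simp add: inner_diff_left inner_diff_right inner_commute)
    also have "inner (f x - a x) (t * conjugate (z x)) = inner (z x * (f x - a x)) t" by (rule inner_conjugate)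
    also have "(norm (t * conjugate (z x)))\<^sup>2 \<le> (norm t)\<^sup>2"
      using z1[of x] by (intro power_mono) (simp_all add: norm_mult mult_left_le)
    finally show ?thesis by simp
  qed
  have i1: "integrable cube (\<lambda>x. (norm (f x - a x))\<^sup>2)"
  proof (rule integrable_const_bound[of _ "(2 * M)\<^sup>2"])
    show "AE x in unit_cube l. norm ((norm (f x - a x))\<^sup>2) \<le> (2 * M)\<^sup>2"
      using power_mono[OF fa norm_ge_zero, where n = 2] by (intro AE_I2) simp
  qed measurable
  have [measurable]: "tensor l w \<in> borel_measurable cube"
    by (rule borel_measurable_tensor) (rule wm)
  have i2: "integrable cube (\<lambda>x. (norm (f x - cap M (a x + t * tensor l w x)))\<^sup>2)"
  proof (rule integrable_const_bound[of _ "(2 * M)\<^sup>2"])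
    have "norm (f x - cap M (a x + t * tensor l w x)) \<le> 2 * M" for x
      using norm_triangle_ineq4[of "f x" "cap M (a x + t * tensor l w x)"] f(2)[of x]
        norm_cap_le[OF M, of "a x + t * tensor l w x"] by linarith
    from power_mono[OF this norm_ge_zero, where n = 2]
    show "AE x in unit_cube l. norm ((norm (f x - cap M (a x + t * tensor l w x)))\<^sup>2) \<le> (2 * M)\<^sup>2"
      by (intro AE_I2) simp
  qed measurable
  have i3: "integrable cube (\<lambda>x. inner (z x * (f x - a x)) t)"
    by (rule integrable_inner_left) (rule iz)
  have "(\<integral>x. (norm (f x - cap M (a x + t * tensor l w x)))\<^sup>2 \<partial>cube) \<le>
    (\<integral>x. (norm (f x - a x))\<^sup>2 - 2 * inner (z x * (f x - a x)) t + (norm t)\<^sup>2 \<partial>cube)"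
    using i1 i2 i3 pt by (intro integral_mono) auto
  also have "\<dots> = (\<integral>x. (norm (f x - a x))\<^sup>2 \<partial>cube) - 2 * (\<integral>x. inner (z x * (f x - a x)) t \<partial>cube) + (norm t)\<^sup>2"
    using i1 i3 prob_space by simp
  also have "(\<integral>x. inner (z x * (f x - a x)) t \<partial>cube) = (norm t)\<^sup>2"
    using iz by (simp add: integral_inner_left t_def[symmetric] power2_norm_eq_inner)
  also have "(\<integral>x. (norm (f x - a x))\<^sup>2 \<partial>cube) - 2 * (norm t)\<^sup>2 + (norm t)\<^sup>2 \<le>
      (\<integral>x. (norm (f x - a x))\<^sup>2 \<partial>cube) - \<kappa>\<^sup>2"
  proof -
    have "\<kappa> \<le> norm t" using big0 by (simp add: t_def z_def tr)
    then have "\<kappa>\<^sup>2 \<le> (norm t)\<^sup>2" using \<kappa> by (intro power_mono)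
    then show ?thesis by simp
  qed
  finally have fin: "(\<integral>x. (norm (f x - cap M (a x + t * tensor l w x)))\<^sup>2 \<partial>cube) \<le>
      (\<integral>x. (norm (f x - a x))\<^sup>2 \<partial>cube) - \<kappa>\<^sup>2" .
  have w1: "norm (w i y) \<le> 1" for i y unfolding w_def norm_conjugate by (rule r1)
  show thesis by (rule that[OF t2 wm w1 fin])
qed

text \<open>The energy starts at no more than \<open>M\<^sup>2\<close>, loses
  \<open>\<kappa>\<^sup>2\<close> with every step and stays nonnegative, so the cut bound is reached
  within \<open>n\<close> steps. The length is exactly \<open>n\<close> for every \<open>f\<close>,
  to match a net of sums of fixed length.\<close>

lemma capped_greedy:
  fixes f :: "'a::{real_normed_field,euclidean_space} cube_fun"
  assumes M: "0 \<le> M" and f: "f \<in> borel_measurable cube" "\<And>x. norm (f x) \<le> M"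
    and \<kappa>: "0 \<le> \<kappa>" and n: "M\<^sup>2 < real n * \<kappa>\<^sup>2"
  obtains t w where "\<And>j. norm (t j) \<le> 2 * M" "\<And>j i. i < l \<Longrightarrow> w j i \<in> borel_measurable unit_interval"
    "\<And>j i y. norm (w j i y) \<le> 1" "cut_bounded (\<lambda>x. f x - capped_sum l M t w n x) \<kappa>"
proof -
  interpret prob_space "unit_cube l" by (rule prob_space_unit_cube)
  define good where "good t w \<longleftrightarrow> (\<forall>j. norm (t j) \<le> 2 * M) \<and>
      (\<forall>j. \<forall>i<l. w j i \<in> borel_measurable unit_interval) \<and> (\<forall>j i y. norm (w j i y) \<le> 1)"
    for t :: "nat \<Rightarrow> 'a" and w :: "nat \<Rightarrow> nat \<Rightarrow> real \<Rightarrow> 'a"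
  have "\<exists>t w. good t w \<and> (cut_bounded (\<lambda>x. f x - capped_sum l M t w k x) \<kappa> \<or>
      (\<integral>x. (norm (f x - capped_sum l M t w k x))\<^sup>2 \<partial>cube) \<le> M\<^sup>2 - real k * \<kappa>\<^sup>2)" for k
  proof (induction k)
    case 0
    have le: "(norm (f x))\<^sup>2 \<le> M\<^sup>2" for x using f(2) by (intro power_mono) auto
    have i: "integrable cube (\<lambda>x. (norm (f x))\<^sup>2)"
      by (rule integrable_const_bound[of _ "M\<^sup>2"]) (use le f(1) in auto)
    have "(\<integral>x. (norm (f x))\<^sup>2 \<partial>cube) \<le> (\<integral>x. M\<^sup>2 \<partial>cube)"
      using i le by (intro integral_mono) auto
    also have "\<dots> = M\<^sup>2" using prob_space by simp
    finally show ?case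
      using M by (intro exI[of _ "\<lambda>_. 0"] exI[of _ "\<lambda>_ _ _. 0"]) (simp add: good_def)
  next
    case (Suc k)
    then obtain t w where g: "good t w" and alt: "cut_bounded (\<lambda>x. f x - capped_sum l M t w k x) \<kappa> \<or>
      (\<integral>x. (norm (f x - capped_sum l M t w k x))\<^sup>2 \<partial>cube) \<le> M\<^sup>2 - real k * \<kappa>\<^sup>2" by blast
    let ?a = "capped_sum l M t w k"
    have am: "?a \<in> borel_measurable cube"
      using g by (intro borel_measurable_capped_sum[OF M]) (auto simp: good_def)
    have upd: "capped_sum l M (t(k := s)) (w(k := v)) (Suc k) x = cap M (?a x + s * tensor l v x)" for s v x
      using capped_sum_cong[of k "t(k := s)" t "w(k := v)" w l M x] by simp
    show ?case
    proof (cases "cut_bounded (\<lambda>x. f x - ?a x) \<kappa>")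
      case True
      \<comment> \<open>Once the cut bound holds, the sum is padded by a term with coefficient 0;
        \<open>cap\<close> leaves it unchanged since its norm is at most \<open>M\<close>
        already.\<close>
      have "capped_sum l M (t(k := 0)) (w(k := w k)) (Suc k) x = ?a x" for x
        unfolding upd by (simp add: cap_id norm_capped_sum_le[OF M])
      then have "cut_bounded (\<lambda>x. f x - capped_sum l M (t(k := 0)) w (Suc k) x) \<kappa>" using True by simp
      moreover have "good (t(k := 0)) w" using g M by (auto simp: good_def)
      ultimately show ?thesis by blast
    next
      case False
      obtain s v where s: "norm s \<le> 2 * M" and v: "\<And>i. i < l \<Longrightarrow> v i \<in> borel_measurable unit_interval"
        "\<And>i y. norm (v i y) \<le> 1"
        and dec: "(\<integral>x. (norm (f x - cap M (?a x + s * tensor l v x)))\<^sup>2 \<partial>cube) \<le>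
          (\<integral>x. (norm (f x - ?a x))\<^sup>2 \<partial>cube) - \<kappa>\<^sup>2"
        using capped_greedy_step[OF M f am norm_capped_sum_le[OF M] False \<kappa>] by blast
      have "good (t(k := s)) (w(k := v))" using g s v by (auto simp: good_def)
      moreover have "(\<integral>x. (norm (f x - capped_sum l M (t(k := s)) (w(k := v)) (Suc k) x))\<^sup>2 \<partial>cube) \<le> M\<^sup>2 - real (Suc k) * \<kappa>\<^sup>2"
        unfolding upd using dec alt False by (simp add: algebra_simps)
      ultimately show ?thesis by blast
    qed
  qed
  then obtain t w where g: "good t w" and alt: "cut_bounded (\<lambda>x. f x - capped_sum l M t w n x) \<kappa> \<or>
      (\<integral>x. (norm (f x - capped_sum l M t w n x))\<^sup>2 \<partial>cube) \<le> M\<^sup>2 - real n * \<kappa>\<^sup>2" by blast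
  have "0 \<le> (\<integral>x. (norm (f x - capped_sum l M t w n x))\<^sup>2 \<partial>cube)" by simp
  then have "\<not> (\<integral>x. (norm (f x - capped_sum l M t w n x))\<^sup>2 \<partial>cube) \<le> M\<^sup>2 - real n * \<kappa>\<^sup>2"
    using n by linarith
  then have "cut_bounded (\<lambda>x. f x - capped_sum l M t w n x) \<kappa>" using alt by blast
  then show thesis using that[of t w] g by (auto simp: good_def)
qed

text \<open>Coefficients and values of factors are rounded to finite nets. The colour of
  \<open>y\<close> is the table of all \<open>n * l\<close> rounded factor values at
  \<open>y\<close>, so that a single bijection straightens all factors simultaneously. What remains
  is determined by finitely many rounded coefficients and one table per cell.\<close>

lemma capped_sum_net:
  fixes n :: nat
  assumes M: "0 \<le> M" and \<kappa>: "0 < \<kappa>"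
  obtains F :: "('a::{real_normed_field,euclidean_space} cube_fun) set"
  where "finite F" "\<And>g. g \<in> F \<Longrightarrow> g \<in> borel_measurable cube" "\<And>g x. g \<in> F \<Longrightarrow> norm (g x) \<le> M"
    "\<And>t w. \<lbrakk>\<forall>j. norm (t j) \<le> 2 * M; \<forall>j. \<forall>i<l. w j i \<in> borel_measurable unit_interval; \<forall>j i y. norm (w j i y) \<le> 1\<rbrakk>
      \<Longrightarrow> \<exists>g\<in>F. \<exists>\<tau>\<in>MPB.
        (\<integral>x. norm (capped_sum l M t w n x - bijection_action l \<tau> g x) \<partial>cube) \<le> \<kappa>"
proof -
  interpret prob_space "unit_cube l" by (rule prob_space_unit_cube)
  \<comment> \<open>Where no coordinate is exceptional, each of the \<open>n\<close> terms has
    rounding error at most \<open>(1 + 2 * M * l) * \<delta>\<close>. Elsewhere the trivial bound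
    \<open>2 * M\<close> is used, and the exceptional points have measure at most
    \<open>l * \<eta>\<close>. Each contribution gets \<open>\<kappa> / 2\<close>.\<close>
  define A where "A = real n * (1 + 2 * M * l)"
  have A: "0 \<le> A" using M by (simp add: A_def)
  define \<delta> where "\<delta> = \<kappa> / (2 * (A + 1))"
  have \<delta>: "0 < \<delta>" using \<kappa> A by (simp add: \<delta>_def)
  have A\<delta>: "A * \<delta> \<le> \<kappa> / 2" using \<kappa> A by (simp add: \<delta>_def field_simps)
  define \<eta> where "\<eta> = \<kappa> / (2 * (2 * M * l + 1))"
  have Ml: "0 \<le> 2 * M * l" using M by simp
  have \<eta>: "0 < \<eta>" using \<kappa> Ml by (simp add: \<eta>_def)
  have M\<eta>: "2 * M * l * \<eta> \<le> \<kappa> / 2"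
  proof -
    have "u * (\<kappa> / (2 * (u + 1))) \<le> \<kappa> / 2" if "0 \<le> u" for u using that \<kappa> by (simp add: field_simps)
    from this[OF Ml] show ?thesis by (simp add: \<eta>_def)
  qed
  obtain d1 :: "nat \<Rightarrow> 'a" and s1 where d1: "\<And>k. k < s1 \<Longrightarrow> norm (d1 k) \<le> 1"
    "\<And>z. norm z \<le> 1 \<Longrightarrow> (LEAST k. norm (z - d1 k) \<le> \<delta>) < s1 \<and> norm (z - d1 (LEAST k. norm (z - d1 k) \<le> \<delta>)) \<le> \<delta>"
    using finite_net_cball[of 1 \<delta>] \<delta> by (metis zero_le_one)
  obtain d2 :: "nat \<Rightarrow> 'a" and s2 where d2:
    "\<And>z. norm z \<le> 2 * M \<Longrightarrow> (LEAST k. norm (z - d2 k) \<le> \<delta>) < s2 \<and> norm (z - d2 (LEAST k. norm (z - d2 k) \<le> \<delta>)) \<le> \<delta>"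
    using finite_net_cball[of "2 * M" \<delta>] \<delta> M by (metis mult_nonneg_nonneg zero_le_numeral)
  define rd1 where "rd1 z = (LEAST k. norm (z - d1 k) \<le> \<delta>)" for z
  define rd2 where "rd2 z = (LEAST k. norm (z - d2 k) \<le> \<delta>)" for z
  define I where "I = {..<n} \<times> {..<l}"
  define Z where "Z = PiE I (\<lambda>_. {..<s1})"
  have finI: "finite I" by (simp add: I_def)
  have finZ: "finite Z" unfolding Z_def by (intro finite_PiE finI) simp
  obtain m where m: "m > 0" and rearrange: "\<And>c. \<lbrakk>\<And>x. x \<in> {0..1} \<Longrightarrow> c x \<in> Z; \<And>z. z \<in> Z \<Longrightarrow> {x\<in>{0..1}. c x = z} \<in> sets lebesgue\<rbrakk> \<Longrightarrow>
    \<exists>\<tau>\<in>MPB. \<exists>e E. (\<forall>b. e b \<in> Z) \<and> E \<in> sets lebesgue \<and> E \<subseteq> {0..1} \<and>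
      measure lebesgue E \<le> \<eta> \<and> (\<forall>x\<in>{0..1} - E. c x = e (cell m (\<tau> x)))"
    using rearrangement_to_uniform_steps[OF finZ \<eta>] by blast
  have cell_le: "cell m y \<le> m" if "y \<in> {0..1}" for y
    using cell_less[OF m, of y] that by (cases "y = 1") (auto simp: cell_def)
  \<comment> \<open>The minimum confines the index to \<open>{..m}\<close>, where \<open>m\<close>
    belongs to the right end point, so the tables \<open>e\<close> need be specified on a finite set
    only.\<close>
  define W where "W e j i y = d1 (e (min (cell m y) m) (j, i))"
    for e :: "nat \<Rightarrow> nat \<times> nat \<Rightarrow> nat" and j i :: nat and y :: real
  define G where "G = (\<lambda>(k, e). capped_sum l M (\<lambda>j. d2 (k j)) (W e) n)"
  define F where "F = G ` (PiE {..<n} (\<lambda>_. {..<s2}) \<times> PiE {..m} (\<lambda>_. Z))"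
  have Wm: "W e j i \<in> borel_measurable unit_interval" for e j i
    unfolding W_def by (rule measurable_compose[OF measurable_cell]) simp
  have Gm: "G ke \<in> borel_measurable cube" for ke
    unfolding G_def case_prod_beta by (rule borel_measurable_capped_sum[OF M Wm])
  have GM: "norm (G ke x) \<le> M" for ke x
    unfolding G_def case_prod_beta by (rule norm_capped_sum_le[OF M])
  show thesis
  proof (rule that[of F])
    show "finite F" unfolding F_def using finZ by (intro finite_imageI finite_cartesian_product finite_PiE) auto
    show "g \<in> borel_measurable cube" if "g \<in> F" for g using that Gm by (auto simp: F_def)
    show "norm (g x) \<le> M" if "g \<in> F" for g x using that GM by (auto simp: F_def)
    fix t :: "nat \<Rightarrow> 'a" and w :: "nat \<Rightarrow> nat \<Rightarrow> real \<Rightarrow> 'a"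
    assume "\<forall>j. norm (t j) \<le> 2 * M" "\<forall>j. \<forall>i<l. w j i \<in> borel_measurable unit_interval"
      "\<forall>j i y. norm (w j i y) \<le> 1"
    then have t: "norm (t j) \<le> 2 * M" and wm: "i < l \<Longrightarrow> w j i \<in> borel_measurable unit_interval"
      and w1: "norm (w j i y) \<le> 1" for j i y by auto
    define c where "c y = (\<lambda>ji\<in>I. rd1 (w (fst ji) (snd ji) y))" for y
    have cZ: "c y \<in> Z" for y
      using d1(2)[OF w1] by (auto simp: c_def Z_def rd1_def)
    have cm: "{y\<in>{0..1}. c y = z} \<in> sets lebesgue" if z: "z \<in> Z" for z
    proof -
      have r: "(\<lambda>y. rd1 (w j i y)) \<in> measurable unit_interval (count_space UNIV)" if "i < l" for j i
      proof -
        note [measurable] = wm[OF that, of j]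
        show ?thesis unfolding rd1_def by measurable
      qed
      have eq: "{y\<in>{0..1}. c y = z} = {y \<in> space unit_interval. \<forall>ji\<in>I. rd1 (w (fst ji) (snd ji) y) = z ji}"
        using z by (auto simp: c_def Z_def PiE_iff extensional_def fun_eq_iff)
      have "{y \<in> space unit_interval. \<forall>ji\<in>I. rd1 (w (fst ji) (snd ji) y) = z ji} \<in> sets unit_interval"
      proof (intro sets.sets_Collect_finite_All finI)
        fix ji assume "ji \<in> I"
        then have "snd ji < l" by (auto simp: I_def)
        from measurable_sets[OF r[OF this, of "fst ji"], of "{z ji}"]
        show "{y \<in> space unit_interval. rd1 (w (fst ji) (snd ji) y) = z ji} \<in> sets unit_interval"
          by (simp add: vimage_def Int_def conj_commute)
      qed
      then show ?thesis unfolding eq sets_unit_interval_iff by blast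
    qed
    obtain \<tau> e E where \<tau>: "\<tau> \<in> MPB" and e: "\<And>b. e b \<in> Z"
      and E: "E \<in> sets lebesgue" "E \<subseteq> {0..1}" "measure lebesgue E \<le> \<eta>"
      and ce: "\<And>y. y \<in> {0..1} - E \<Longrightarrow> c y = e (cell m (\<tau> y))"
      using rearrange[OF cZ cm] by blast
    have EU: "E \<in> sets unit_interval" using E by (simp add: sets_unit_interval_iff)
    define k where "k = (\<lambda>j\<in>{..<n}. rd2 (t j))"
    define e' where "e' = restrict e {..m}"
    define g where "g = G (k, e')"
    have "k \<in> PiE {..<n} (\<lambda>_. {..<s2})" using d2[OF t] by (auto simp: k_def rd2_def)
    moreover have "e' \<in> PiE {..m} (\<lambda>_. Z)" using e by (auto simp: e'_def)
    ultimately have gF: "g \<in> F" by (auto simp: F_def g_def)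
    \<comment> \<open>The action composes with the inverse of the acting bijection, and
      \<open>g\<close> is to be read at the points \<open>\<tau> (x i)\<close>; hence the inverse of
      \<open>\<tau>\<close> acts.\<close>
    define \<sigma> where "\<sigma> = inv_into {0..1} \<tau>"
    have \<sigma>: "\<sigma> \<in> MPB" unfolding \<sigma>_def by (rule inv_in_bijections[OF \<tau>])
    let ?a = "capped_sum l M t w n" and ?b = "bijection_action l \<sigma> g"
    have am: "?a \<in> borel_measurable cube" by (rule borel_measurable_capped_sum[OF M wm])
    have bm: "?b \<in> borel_measurable cube"
      unfolding g_def by (rule borel_measurable_bijection_action[OF \<sigma> Gm])
    note [measurable] = am bm
    have ab2M: "norm (?a x - ?b x) \<le> 2 * M" for x
      using norm_triangle_ineq4[of "?a x" "?b x"] norm_capped_sum_le[OF M, of l t w n x] GM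
      unfolding bijection_action_def g_def by (smt (verit))
    have pt: "norm (?a x - ?b x) \<le> \<kappa> / 2 + 2 * M * (\<Sum>i<l. indicator E (x i))" if x: "x \<in> space cube" for x
    proof (cases "\<exists>i<l. x i \<in> E")
      case True
      then obtain i where i: "i < l" "x i \<in> E" by blast
      have "(1::real) \<le> (\<Sum>i<l. indicator E (x i))"
        using member_le_sum[of i "{..<l}" "\<lambda>i. indicator E (x i) :: real"] i by simp
      then have "2 * M * 1 \<le> 2 * M * (\<Sum>i<l. indicator E (x i))" using M by (intro mult_left_mono) auto
      then show ?thesis using ab2M[of x] \<kappa> by linarith
    next
      case False
      define x' where "x' = (\<lambda>i\<in>{..<l}. inv_into {0..1} \<sigma> (x i))"
      have b: "?b x = capped_sum l M (\<lambda>j. d2 (k j)) (W e') n x'"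
        by (simp add: bijection_action_def g_def G_def x'_def)
      have W': "W e' j i (x' i) = d1 (rd1 (w j i (x i)))" if "i < l" "j < n" for i j
      proof -
        have xi: "x i \<in> {0..1} - E" using x False that by (auto simp: space_unit_cube PiE_iff)
        then have x'i: "x' i = \<tau> (x i)"
          using that inv_into_inv_into_eq[OF bijectionsD(1)[OF \<tau>], of "x i"] by (simp add: x'_def \<sigma>_def)
        have "\<tau> (x i) \<in> {0..1}" using bij_betw_apply[OF bijectionsD(1)[OF \<tau>]] xi by blast
        then have "W e' j i (x' i) = d1 (e (cell m (\<tau> (x i))) (j, i))"
          using cell_le[of "\<tau> (x i)"] by (simp add: W_def x'i e'_def min_absorb1)
        also have "\<dots> = d1 (c (x i) (j, i))" using ce[OF xi] by simp
        also have "\<dots> = d1 (rd1 (w j i (x i)))" using that by (simp add: c_def I_def)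
        finally show ?thesis .
      qed
      have "norm (?a x - ?b x) \<le> (\<Sum>j<n. norm (t j * tensor l (w j) x - d2 (k j) * tensor l (W e' j) x'))"
        unfolding b by (rule capped_sum_diff_le[OF M])
      also have "\<dots> \<le> (\<Sum>j<n. (1 + 2 * M * l) * \<delta>)"
      proof (intro sum_mono term_rounding_le t w1)
        fix j assume j: "j \<in> {..<n}"
        show "norm (t j - d2 (k j)) \<le> \<delta>" using d2[OF t, of j] j by (simp add: k_def rd2_def)
        show "norm (W e' j i (x' i)) \<le> 1" if "i < l" for i
          using d1(1) d1(2)[OF w1] W'[OF that] j by (simp add: rd1_def)
        show "norm (w j i (x i) - W e' j i (x' i)) \<le> \<delta>" if "i < l" for i
          using d1(2)[OF w1] W'[OF that] j by (simp add: rd1_def)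
      qed (use \<delta> in simp)
      also have "\<dots> = A * \<delta>" by (simp add: A_def)
      also have "\<dots> \<le> \<kappa> / 2" by (rule A\<delta>)
      finally show ?thesis using M by (intro add_increasing2) (auto intro!: mult_nonneg_nonneg sum_nonneg)
    qed
    have iE: "integrable unit_interval (indicator E :: real \<Rightarrow> real)"
      using EU sets.Int_space_eq2[OF EU]
        finite_measure.emeasure_finite[OF prob_space.finite_measure[OF prob_space_unit_interval], of E]
      by (simp add: integrable_indicator_iff less_top[symmetric])
    have IE: "(\<integral>y. indicator E y \<partial>unit_interval) \<le> \<eta>"
    proof -
      have "measure unit_interval E = measure lebesgue E"
        using E(2) by (simp add: Sigma_Algebra.measure_def emeasure_unit_interval)
      then show ?thesis using E(3) EU by (simp add: Int_absorb2[OF E(2)])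
    qed
    have ic: "integrable cube (\<lambda>x. indicator E (x i) :: real)" if "i < l" for i
      by (rule integrable_component[OF that iE])
    have iS: "integrable cube (\<lambda>x. \<Sum>i<l. indicator E (x i) :: real)"
      using ic by (intro Bochner_Integration.integrable_sum) auto
    then have i1: "integrable cube (\<lambda>x. \<kappa> / 2 + 2 * M * (\<Sum>i<l. indicator E (x i)))" by simp
    have i2: "integrable cube (\<lambda>x. norm (?a x - ?b x))"
      by (rule integrable_const_bound[of _ "2 * M"]) (use ab2M in auto)
    have "(\<integral>x. norm (?a x - ?b x) \<partial>cube) \<le> (\<integral>x. \<kappa> / 2 + 2 * M * (\<Sum>i<l. indicator E (x i)) \<partial>cube)"
      by (rule integral_mono[OF i2 i1 pt])
    also have "\<dots> = \<kappa> / 2 + 2 * M * (\<Sum>i<l. \<integral>x. indicator E (x i) \<partial>cube)"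
      using iS ic prob_space by (simp add: Bochner_Integration.integral_sum)
    also have "\<dots> \<le> \<kappa> / 2 + 2 * M * (\<Sum>i<l. \<eta>)"
      using IE M iE by (intro add_left_mono mult_left_mono sum_mono) (auto simp: integral_component)
    also have "\<dots> \<le> \<kappa>" using M\<eta> by (simp add: mult.assoc)
    finally show "\<exists>g\<in>F. \<exists>\<tau>\<in>MPB.
        (\<integral>x. norm (capped_sum l M t w n x - bijection_action l \<tau> g x) \<partial>cube) \<le> \<kappa>"
      using gF \<sigma> by blast
  qed
qed

end

section \<open>Total boundedness and compactness\<close>

context exponents
begin

lemma bounded_in_LP:
  fixes h :: "'a::{real_normed_field,banach,second_countable_topology} cube_fun"
  assumes [measurable]: "h \<in> borel_measurable cube" and B: "\<And>x. norm (h x) \<le> B"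
  shows "h \<in> LP" "(\<integral>x. norm (h x) powr P \<partial>cube) \<le> B powr P"
proof -
  interpret prob_space "unit_cube l" by (rule prob_space_unit_cube)
  have le: "norm (h x) powr P \<le> B powr P" for x using B P by (intro powr_mono2) auto
  have i: "integrable cube (\<lambda>x. norm (h x) powr P)"
    by (rule integrable_const_bound[of _ "B powr P"]) (use le in auto)
  then show "h \<in> LP" using P by (simp add: Lp_space_finite)
  have "(\<integral>x. norm (h x) powr P \<partial>cube) \<le> (\<integral>x. B powr P \<partial>cube)"
    using i le by (intro integral_mono) auto
  then show "(\<integral>x. norm (h x) powr P \<partial>cube) \<le> B powr P" using prob_space by simp
qed

text \<open>Above \<open>M\<close> the norm of \<open>f x\<close> is its \<open>P\<close>-th power
  times \<open>norm (f x) powr (1 - P)\<close>, and the latter is at most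
  \<open>M powr (1 - P)\<close>. So the cut bound becomes small for large \<open>M\<close> while the
  \<open>P\<close>-th moment stays below a fixed bound, as the passage to the \<open>R\<close>-norm
  requires.\<close>

lemma truncation_error:
  fixes f h :: "'a::{real_normed_field,banach,second_countable_topology} cube_fun"
  assumes f: "f \<in> Lp_ball cube p" and M: "1 \<le> M"
    and h_def: "\<And>x. h x = (if norm (f x) \<le> M then 0 else f x)"
  shows "h \<in> LP" "(\<integral>x. norm (h x) powr P \<partial>cube) \<le> 1" "cut_bounded h (M powr (1 - P))"
proof -
  have [measurable]: "f \<in> borel_measurable cube" and i: "integrable cube (\<lambda>x. norm (f x) powr P)"
    using ball_pD(1)[OF f] P by (auto simp: Lp_space_finite)
  have hm[measurable]: "h \<in> borel_measurable cube" unfolding h_def[abs_def] by measurable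
  have le: "norm (h x) powr P \<le> norm (f x) powr P" for x by (simp add: h_def)
  have ih: "integrable cube (\<lambda>x. norm (h x) powr P)"
    by (rule Bochner_Integration.integrable_bound[OF i]) (use le in auto)
  then show hL: "h \<in> LP" using P by (simp add: Lp_space_finite)
  show "(\<integral>x. norm (h x) powr P \<partial>cube) \<le> 1"
    using integral_mono[OF ih i le] ball_pD(2)[OF f] by simp
  have le1: "norm (h x) \<le> M powr (1 - P) * norm (f x) powr P" for x
  proof (cases "norm (f x) \<le> M")
    case False
    then have "norm (h x) = norm (f x) powr (1 - P) * norm (f x) powr P"
      using M by (simp add: h_def powr_add[symmetric])
    also have "\<dots> \<le> M powr (1 - P) * norm (f x) powr P"
      using False M P by (intro mult_right_mono powr_mono2') auto
    finally show ?thesis .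
  qed (simp add: h_def)
  show "cut_bounded h (M powr (1 - P))"
  proof (rule cut_boundedI[OF LP_integrable(1)[OF hL]])
    have "(\<integral>x. norm (h x) \<partial>cube) \<le> (\<integral>x. M powr (1 - P) * norm (f x) powr P \<partial>cube)"
      using LP_integrable(1)[OF hL] i le1 by (intro integral_mono) auto
    also have "\<dots> = M powr (1 - P) * (\<integral>x. norm (f x) powr P \<partial>cube)" by simp
    also have "\<dots> \<le> M powr (1 - P) * 1" by (intro mult_left_mono ball_pD(2) f) simp
    finally show "(\<integral>x. norm (h x) \<partial>cube) \<le> M powr (1 - P)" by simp
  qed
qed

text \<open>The constants are chosen in the order \<open>L1\<close>, \<open>M\<close>,
  \<open>L2\<close>, \<open>\<kappa>\<close>, \<open>n\<close>. That \<open>L2\<close> can precede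
  \<open>n\<close> is due to the bound \<open>2 * M\<close> for all differences that occur, whatever
  \<open>n\<close> is. Half of \<open>e\<close> is for the part of \<open>f\<close> above
  \<open>M\<close>, the other half for the rest.\<close>

lemma R_dist_orbit_net:
  assumes e: "0 < e"
  obtains F :: "('a::{real_normed_field,euclidean_space} cube_fun) set"
  where "finite F" "F \<subseteq> LP"
    "\<And>f. f \<in> Lp_ball cube p \<Longrightarrow>
      \<exists>g\<in>F. \<exists>\<tau>\<in>MPB. R_dist q l f (bijection_action l \<tau> g) < e"
proof -
  have e4: "0 < e / 4" using e by simp
  obtain L1 where L1: "0 < L1" "\<And>(h :: 'a cube_fun) \<kappa>. \<lbrakk>h \<in> LP; (\<integral>x. norm (h x) powr P \<partial>cube) \<le> 1; cut_bounded h \<kappa>\<rbrakk>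
      \<Longrightarrow> R_norm q l h \<le> L1 * \<kappa> + e / 4"
    by (rule R_norm_le_cut_bound[OF zero_le_one e4, where 'a = 'a]) (rule that)
  have "((\<lambda>t. L1 * t powr (1 - P)) \<longlongrightarrow> L1 * 0) at_top"
    using P by (intro tendsto_mult tendsto_const tendsto_neg_powr filterlim_ident) auto
  then have "\<forall>\<^sub>F t in at_top. L1 * t powr (1 - P) < e / 4" using e by (intro order_tendstoD) auto
  then have "\<forall>\<^sub>F t in at_top. L1 * t powr (1 - P) < e / 4 \<and> 1 \<le> t"
    using eventually_ge_at_top[of "1::real"] by eventually_elim auto
  then obtain M where M: "L1 * M powr (1 - P) < e / 4" "1 \<le> M" by (auto dest: eventually_happens)
  have M0: "0 \<le> M" using M by simp
  obtain L2 where L2: "0 < L2" "\<And>(h :: 'a cube_fun) \<kappa>. \<lbrakk>h \<in> LP; (\<integral>x. norm (h x) powr P \<partial>cube) \<le> (2 * M) powr P; cut_bounded h \<kappa>\<rbrakk>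
      \<Longrightarrow> R_norm q l h \<le> L2 * \<kappa> + e / 4"
    by (rule R_norm_le_cut_bound[OF powr_ge_zero e4, where 'a = 'a]) (rule that)
  \<comment> \<open>The greedy approximation and the net each add \<open>\<kappa>\<close> to the cut
    bound, and \<open>L2 * (\<kappa> + \<kappa>) = e / 4\<close>.\<close>
  define \<kappa> where "\<kappa> = e / (8 * L2)"
  have \<kappa>: "0 < \<kappa>" using e L2 by (simp add: \<kappa>_def)
  obtain n :: nat where "M\<^sup>2 / \<kappa>\<^sup>2 < real n" using reals_Archimedean2 by blast
  then have n: "M\<^sup>2 < real n * \<kappa>\<^sup>2" using \<kappa> by (simp add: field_simps)
  obtain F :: "('a cube_fun) set"
    where F: "finite F" "\<And>g. g \<in> F \<Longrightarrow> g \<in> borel_measurable cube" "\<And>g x. g \<in> F \<Longrightarrow> norm (g x) \<le> M"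
    and net: "\<And>t w. \<lbrakk>\<forall>j. norm (t j) \<le> 2 * M; \<forall>j. \<forall>i<l. w j i \<in> borel_measurable unit_interval; \<forall>j i y. norm (w j i y) \<le> 1\<rbrakk>
      \<Longrightarrow> \<exists>g\<in>F. \<exists>\<tau>\<in>MPB.
        (\<integral>x. norm (capped_sum l M t w n x - bijection_action l \<tau> g x) \<partial>cube) \<le> \<kappa>"
    by (rule capped_sum_net[OF M0 \<kappa>, where 'a = 'a and n = n]) (rule that)
  show thesis
  proof (rule that[of F])
    show "finite F" by (rule F)
    show "F \<subseteq> LP"
    proof
      fix g assume g: "g \<in> F"
      show "g \<in> LP" by (rule bounded_in_LP(1)[OF F(2)[OF g] F(3)[OF g]])
    qed
    fix f :: "'a cube_fun" assume f: "f \<in> Lp_ball cube p"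
    have [measurable]: "f \<in> borel_measurable cube" using ball_pD(1)[OF f] P by (simp add: Lp_space_finite)
    define h where "h x = (if norm (f x) \<le> M then 0 else f x)" for x
    note h = truncation_error[OF f M(2) h_def]
    define b where "b x = (if norm (f x) \<le> M then f x else 0)" for x
    have bm[measurable]: "b \<in> borel_measurable cube" unfolding b_def[abs_def] by measurable
    have bM: "norm (b x) \<le> M" for x using M0 by (simp add: b_def)
    obtain t w where t: "\<And>j. norm (t j) \<le> 2 * M" and w: "\<And>j i. i < l \<Longrightarrow> w j i \<in> borel_measurable unit_interval"
      "\<And>j i y. norm (w j i y) \<le> 1" and cut: "cut_bounded (\<lambda>x. b x - capped_sum l M t w n x) \<kappa>"
      by (rule capped_greedy[OF M0 bm bM less_imp_le[OF \<kappa>] n]) (rule that)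
    let ?a = "capped_sum l M t w n"
    obtain g \<tau> where g: "g \<in> F" and \<tau>: "\<tau> \<in> MPB"
      and ag: "(\<integral>x. norm (?a x - bijection_action l \<tau> g x) \<partial>cube) \<le> \<kappa>"
      using net[of t w] t w by auto
    let ?g = "bijection_action l \<tau> g"
    have am[measurable]: "?a \<in> borel_measurable cube" by (rule borel_measurable_capped_sum[OF M0 w(1)])
    have gm[measurable]: "?g \<in> borel_measurable cube" by (rule borel_measurable_bijection_action[OF \<tau> F(2)[OF g]])
    have gM: "norm (?g x) \<le> M" for x unfolding bijection_action_def by (rule F(3)[OF g])
    have aM: "norm (?a x) \<le> M" for x by (rule norm_capped_sum_le[OF M0])
    have d: "norm (u - v) \<le> 2 * M" if "norm u \<le> M" "norm v \<le> M" for u v :: 'a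
      using norm_triangle_ineq4[of u v] that by linarith
    have m: "(\<lambda>x. b x - ?a x) \<in> borel_measurable cube" "(\<lambda>x. ?a x - ?g x) \<in> borel_measurable cube"
      "(\<lambda>x. b x - ?g x) \<in> borel_measurable cube" by measurable
    note ba = bounded_in_LP[OF m(1) d[OF bM aM]]
      and ag' = bounded_in_LP[OF m(2) d[OF aM gM]]
      and bg = bounded_in_LP[OF m(3) d[OF bM gM]]
    have "cut_bounded (\<lambda>x. (b x - ?a x) + (?a x - ?g x)) (\<kappa> + \<kappa>)"
      by (rule cut_bounded_add[OF cut cut_boundedI[OF LP_integrable(1)[OF ag'(1)] ag]
            LP_integrable(1)[OF ba(1)] LP_integrable(1)[OF ag'(1)]])
    then have "cut_bounded (\<lambda>x. b x - ?g x) (\<kappa> + \<kappa>)" by simp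
    from L2(2)[OF bg this] have "R_norm q l (\<lambda>x. b x - ?g x) \<le> L2 * (\<kappa> + \<kappa>) + e / 4" .
    also have "\<dots> = e / 2" using L2(1) by (simp add: \<kappa>_def field_simps)
    finally have 1: "R_norm q l (\<lambda>x. b x - ?g x) \<le> e / 2" .
    have 2: "R_norm q l h < e / 2" using L1(2)[OF h] M(1) by linarith
    have "(\<lambda>x. f x - ?g x) = (\<lambda>x. h x + (b x - ?g x))" by (simp add: h_def b_def fun_eq_iff)
    then have "R_dist q l f ?g \<le> R_norm q l h + R_norm q l (\<lambda>x. b x - ?g x)"
      using R_norm_add[OF h(1) bg(1)] by (simp only: R_dist_def)
    then have "R_dist q l f ?g < e" using 1 2 by linarith
    then show "\<exists>g\<in>F. \<exists>\<tau>\<in>MPB. R_dist q l f (bijection_action l \<tau> g) < e"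
      using g \<tau> by blast
  qed
qed

text \<open>Real and complex scalars are instances of this sort: \<open>euclidean_space\<close>
  supplies the inner product for the convexity and energy arguments and compact balls for the
  nets.\<close>

theorem compact_Lp_ball:
  "compact_pseudometric_space
    (Lp_ball cube p :: ('a::{real_normed_field,euclidean_space} cube_fun) set)
    (R_quotient_dist q l)"
proof -
  interpret isometric_action "LP :: ('a cube_fun) set" "R_dist q l" MPB
    "bijection_action l"
    by (rule isometric_action_bijections)
  let ?X = "Lp_ball cube p :: ('a cube_fun) set"
  have XL: "?X \<subseteq> LP" using ball_pD(1) by blast
  have eq: "orbit_dist = R_quotient_dist q l"
    by (simp add: fun_eq_iff orbit_dist_def R_quotient_dist_def)
  note PM = pseudometric_on_orbit_dist[unfolded pseudometric_on_def]
  have "compact_pseudometric_space ?X orbit_dist"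
  proof (rule compact_pseudometric_spaceI)
    show "pseudometric_on ?X orbit_dist"
      by (rule pseudometric_on_subset[OF pseudometric_on_orbit_dist XL])
    show "\<exists>F. finite F \<and> F \<subseteq> ?X \<and> (\<forall>f\<in>?X. \<exists>g\<in>F. orbit_dist g f < e)" if e: "e > 0" for e
    proof -
      obtain F :: "('a cube_fun) set" where F: "finite F" "F \<subseteq> LP"
        and net: "\<And>f. f \<in> ?X \<Longrightarrow> \<exists>g\<in>F. \<exists>\<tau>\<in>MPB. R_dist q l f (bijection_action l \<tau> g) < e / 2"
        by (rule R_dist_orbit_net[OF half_gt_zero[OF e], where 'a = 'a]) (rule that)
      \<comment> \<open>The centres from \<open>F\<close> need not lie in the ball. Each centre that
        is within \<open>e / 2\<close> of some ball element is replaced by such an element, at the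
        cost of doubling the radius.\<close>
      define near where "near g = (SOME f. f \<in> ?X \<and> orbit_dist f g < e / 2)" for g
      define F' where "F' = {g \<in> F. \<exists>f\<in>?X. orbit_dist f g < e / 2}"
      have near: "near g \<in> ?X \<and> orbit_dist (near g) g < e / 2" if "g \<in> F'" for g
      proof -
        have "\<exists>f. f \<in> ?X \<and> orbit_dist f g < e / 2" using that unfolding F'_def by blast
        then show ?thesis unfolding near_def by (rule someI_ex)
      qed
      have "\<exists>y\<in>near ` F'. orbit_dist y f < e" if f: "f \<in> ?X" for f
      proof -
        obtain g \<tau> where g: "g \<in> F" and \<tau>: "\<tau> \<in> MPB"
          and d: "R_dist q l f (bijection_action l \<tau> g) < e / 2" using net[OF f] by blast
        have fL: "f \<in> LP" and gL: "g \<in> LP" using f XL g F by blast+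
        have fg: "orbit_dist f g < e / 2" using orbit_dist_le[OF fL gL \<tau>] d by linarith
        then have "g \<in> F'" using f g by (auto simp: F'_def)
        from near[OF this] have nX: "near g \<in> ?X" and n: "orbit_dist (near g) g < e / 2" by auto
        have nL: "near g \<in> LP" using nX XL by blast
        have "orbit_dist (near g) f \<le> orbit_dist (near g) g + orbit_dist g f"
          using PM nL gL fL by blast
        moreover have "orbit_dist g f = orbit_dist f g" using PM gL fL by blast
        ultimately have "orbit_dist (near g) f < e" using n fg by linarith
        then show ?thesis using \<open>g \<in> F'\<close> by blast
      qed
      moreover have "finite (near ` F')" using F by (simp add: F'_def)
      moreover have "near ` F' \<subseteq> ?X" using near by blast
      ultimately show ?thesis by blast
    qed
    show "\<exists>x\<in>?X. (\<lambda>n. orbit_dist (f n) x) \<longlonglongrightarrow> 0"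
      if f: "range f \<subseteq> ?X" and c: "\<forall>e>0. \<exists>N. \<forall>m\<ge>N. \<forall>n\<ge>N. orbit_dist (f m) (f n) < e" for f :: "nat \<Rightarrow> _"
      by (rule orbit_dist_complete[OF XL bijection_action_in_ball R_dist_complete f c])
  qed
  then show ?thesis by (simp only: eq)
qed

end

text \<open>For finite \<open>p\<close> the exponents \<open>P\<close> and \<open>S\<close> are
  forced. For infinite \<open>p\<close> any \<open>S\<close> strictly between 1 and \<open>Q\<close>
  will do, here the midpoint, and \<open>P\<close> is its conjugate. For infinite \<open>q\<close>
  any finite \<open>Q\<close> above the conjugate exponent is allowed; 2, or that exponent plus 1,
  is taken.\<close>

lemma exponents_exist:
  assumes "1 < p" and "1 \<le> q" and "conj_exponent p < q"
  shows "\<exists>P Q S. exponents p q P Q S"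
proof (cases p)
  case top
  then have q1: "1 < q" using assms(3) by (simp add: conj_exponent_def)
  obtain Q where Q: "q = ennreal Q \<or> q = \<infinity>" "1 < Q"
    using q1 by (cases q) (auto intro: that[of 2])
  define S where "S = (1 + Q) / 2"
  have S: "1 < S" "S < Q" using Q by (auto simp: S_def)
  have "exponents p q (S / (S - 1)) Q S"
    using S Q top by unfold_locales (auto simp: field_simps)
  then show ?thesis by blast
next
  case (real P)
  have P: "1 < P" using assms(1) real by simp
  have "conj_exponent p = ennreal P / (ennreal P - ennreal 1)"
    using assms(1) real by (simp add: conj_exponent_def)
  also have "\<dots> = ennreal (P / (P - 1))"
    using P by (simp only: ennreal_minus zero_le_one) (simp add: divide_ennreal)
  finally have c: "ennreal (P / (P - 1)) < q" using assms(3) by simp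
  obtain Q where Q: "q = ennreal Q \<or> q = \<infinity>" "P / (P - 1) < Q"
    using c P by (cases q) (auto simp: ennreal_less_iff intro: that[of "P / (P - 1) + 1"])
  have "exponents p q P Q (P / (P - 1))"
    using P Q real by unfold_locales (auto simp: field_simps)
  then show ?thesis by blast
qed

theorem theorem4p1:
  fixes p q :: ennreal and l :: nat
  assumes "1 < p" and "1 \<le> q" and "conj_exponent p < q"
  shows "compact_pseudometric_space
           (Lp_ball (unit_cube l) p :: ((nat \<Rightarrow> real) \<Rightarrow> real) set) (R_quotient_dist q l) \<and>
         compact_pseudometric_space
           (Lp_ball (unit_cube l) p :: ((nat \<Rightarrow> real) \<Rightarrow> complex) set) (R_quotient_dist q l)"
proof -
  obtain P Q S where "exponents p q P Q S" using exponents_exist[OF assms] by blast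
  then interpret exponents l p q P Q S .
  show ?thesis by (intro conjI compact_Lp_ball)
qed

end
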